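(* As $\gamma\downarrow0$, the functionals $\mathcal F_\gamma:L^1(\Omega)\to[0,\infty]$ $\Gamma$-converge to $\mathcal F_0$ with respect to strong convergence in $L^1(\Omega)$. Moreover, the family is equicoercive in $L^1(\Omega)$: if $\gamma_n\downarrow0$ and $\sup_n\mathcal F_{\gamma_n}(u_n)<\infty$, then $(u_n)_n$ is precompact in $L^1(\Omega)$, and every $L^1$-cluster point belongs to $BV(\Omega)\cap L^2(\Omega)$.
   Context: $\Omega\subset\mathbb R^N$ is a bounded Lipschitz domain, $f\in L^2(\Omega)$, $\alpha>0$ is fixed, and $\kappa\in L^\infty(\Omega)$ is fixed with $0<\kappa_-\le\kappa(x)\le\kappa_+<\infty$ for a.e. $x\in\Omega$. With $\log^+r:=\max\{0,\log r\}$ for $r>0$ and $\log^+0:=0$, define for $\gamma>0$ $$\varphi_\gamma(x,t):=\alpha t\Bigl(1+\gamma\log^+\frac{t}{\kappa(x)}\Bigr),\qquad t\ge0,$$ $X_\gamma:=\{u\in L^2(\Omega)\cap W^{1,1}(\Omega):\int_\Omega\varphi_\gamma(x,|\nabla u|)\,dx<\infty\}$, and $$\mathcal F_\gamma(u):=\begin{cases}\frac12\|u-f\|_{L^2(\Omega)}^2+\int_\Omega\varphi_\gamma(x,|\nabla u|)\,dx,&u\in X_\gamma,\\+\infty,&u\in L^1(\Omega)\setminus X_\gamma.\end{cases}$$ The ROF functional is $$\mathcal F_0(u):=\begin{cases}\frac12\|u-f\|_{L^2(\Omega)}^2+\alpha|Du|(\Omega),&u\in BV(\Omega)\cap L^2(\Omega),\\+\infty,&u\in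 L^1(\Omega)\setminus(BV(\Omega)\cap L^2(\Omega)),\end{cases}$$ where $|Du|(\Omega)$ is the total variation of the distributional derivative $Du$. *)

theory Defs
  imports "HOL-Analysis.Analysis"
begin

text \<open>Functions on \<open>\<Omega>\<close> are represented by total functions; only their restriction to \<open>\<Omega>\<close>, up to
  Lebesgue-null sets, enters the notions below.\<close>

subsection \<open>Lipschitz domains\<close>

text \<open>In a ball around each boundary point, \<open>\<Omega>\<close> is the strict epigraph, in some direction \<open>e\<close>, of a
  Lipschitz function on the hyperplane orthogonal to \<open>e\<close>;
  \<open>x - (x \<bullet> e) *\<^sub>R e\<close> is the projection of \<open>x\<close> to that hyperplane.\<close>

definition lipschitz_boundary :: "'a::euclidean_space set \<Rightarrow> bool" where
  "lipschitz_boundary \<Omega> \<longleftrightarrow>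
     (\<forall>p\<in>frontier \<Omega>. \<exists>r>0. \<exists>e g L. norm e = 1 \<and> L-lipschitz_on {y. y \<bullet> e = 0} (g :: 'a \<Rightarrow> real) \<and>
        \<Omega> \<inter> ball p r = {x \<in> ball p r. g (x - (x \<bullet> e) *\<^sub>R e) < x \<bullet> e})"

definition bounded_lipschitz_domain :: "'a::euclidean_space set \<Rightarrow> bool" where
  "bounded_lipschitz_domain \<Omega> \<longleftrightarrow>
     open \<Omega> \<and> connected \<Omega> \<and> \<Omega> \<noteq> {} \<and> bounded \<Omega> \<and> lipschitz_boundary \<Omega>"

subsection \<open>Test functions\<close>

primrec C_k :: "nat \<Rightarrow> ('a::euclidean_space \<Rightarrow> 'b::real_normed_vector) \<Rightarrow> bool" where
  "C_k 0 f \<longleftrightarrow> continuous_on UNIV f"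
| "C_k (Suc k) f \<longleftrightarrow>
     (\<forall>x. f differentiable (at x)) \<and> (\<forall>v. C_k k (\<lambda>x. frechet_derivative f (at x) v))"

definition test_functions ::
    "'a::euclidean_space set \<Rightarrow> ('a \<Rightarrow> 'b::real_normed_vector) set" where
  "test_functions \<Omega> =
     {\<phi>. (\<forall>k. C_k k \<phi>) \<and> compact (closure {x. \<phi> x \<noteq> 0}) \<and> closure {x. \<phi> x \<noteq> 0} \<subseteq> \<Omega>}"

definition divergence :: "('a::euclidean_space \<Rightarrow> 'a) \<Rightarrow> 'a \<Rightarrow> real" where
  "divergence \<phi> x = (\<Sum>i\<in>Basis. frechet_derivative \<phi> (at x) i \<bullet> i)"

subsection \<open>Function spaces\<close>

definition L1 :: "'a::euclidean_space set \<Rightarrow> ('a \<Rightarrow> real) set" where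
  "L1 \<Omega> = {u. integrable (lebesgue_on \<Omega>) u}"

definition L1_dist :: "'a::euclidean_space set \<Rightarrow> ('a \<Rightarrow> real) \<Rightarrow> ('a \<Rightarrow> real) \<Rightarrow> real" where
  "L1_dist \<Omega> u v = (\<integral>x. \<bar>u x - v x\<bar> \<partial>lebesgue_on \<Omega>)"

definition L2 :: "'a::euclidean_space set \<Rightarrow> ('a \<Rightarrow> real) set" where
  "L2 \<Omega> = {u \<in> borel_measurable (lebesgue_on \<Omega>). integrable (lebesgue_on \<Omega>) (\<lambda>x. (u x)\<^sup>2)}"

definition L2_norm :: "'a::euclidean_space set \<Rightarrow> ('a \<Rightarrow> real) \<Rightarrow> real" where
  "L2_norm \<Omega> u = sqrt (\<integral>x. (u x)\<^sup>2 \<partial>lebesgue_on \<Omega>)"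

text \<open>An integrable weak gradient, not just a locally integrable one.\<close>

definition is_weak_gradient ::
    "'a::euclidean_space set \<Rightarrow> ('a \<Rightarrow> real) \<Rightarrow> ('a \<Rightarrow> 'a) \<Rightarrow> bool" where
  "is_weak_gradient \<Omega> u G \<longleftrightarrow> integrable (lebesgue_on \<Omega>) G \<and>
     (\<forall>\<phi>\<in>test_functions \<Omega>. \<forall>i\<in>Basis.
        (\<integral>x. u x * frechet_derivative \<phi> (at x) i \<partial>lebesgue_on \<Omega>)
          = - (\<integral>x. (G x \<bullet> i) * \<phi> x \<partial>lebesgue_on \<Omega>))"

definition W11 :: "'a::euclidean_space set \<Rightarrow> ('a \<Rightarrow> real) set" where
  "W11 \<Omega> = {u \<in> L1 \<Omega>. \<exists>G. is_weak_gradient \<Omega> u G}"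

text \<open>Weak gradients are unique up to null sets, so the choice is immaterial.\<close>

definition weak_gradient :: "'a::euclidean_space set \<Rightarrow> ('a \<Rightarrow> real) \<Rightarrow> 'a \<Rightarrow> 'a" where
  "weak_gradient \<Omega> u = (SOME G. is_weak_gradient \<Omega> u G)"

text \<open>The distributional derivative \<open>Du\<close>, as a functional on test vector fields, and its total
  variation. The set of admissible values is symmetric, so that the truncation of negative values
  by \<^const>\<open>ennreal\<close> is harmless.\<close>

definition distr_derivative ::
    "'a::euclidean_space set \<Rightarrow> ('a \<Rightarrow> real) \<Rightarrow> ('a \<Rightarrow> 'a) \<Rightarrow> real" where
  "distr_derivative \<Omega> u \<phi> = - (\<integral>x. u x * divergence \<phi> x \<partial>lebesgue_on \<Omega>)"

definition total_variation :: "'a::euclidean_space set \<Rightarrow> ('a \<Rightarrow> real) \<Rightarrow> ennreal" where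
  "total_variation \<Omega> u =
     (SUP \<phi>\<in>{\<phi> \<in> test_functions \<Omega>. \<forall>x. norm (\<phi> x) \<le> 1}. ennreal (distr_derivative \<Omega> u \<phi>))"

definition BV :: "'a::euclidean_space set \<Rightarrow> ('a \<Rightarrow> real) set" where
  "BV \<Omega> = {u \<in> L1 \<Omega>. total_variation \<Omega> u < \<infinity>}"

subsection \<open>The functionals\<close>

definition log_plus :: "real \<Rightarrow> real" where
  "log_plus r = (if r > 0 then max 0 (ln r) else 0)"

definition phi :: "real \<Rightarrow> ('a \<Rightarrow> real) \<Rightarrow> real \<Rightarrow> 'a \<Rightarrow> real \<Rightarrow> real" where
  "phi \<alpha> \<kappa> \<gamma> x t = \<alpha> * t * (1 + \<gamma> * log_plus (t / \<kappa> x))"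

definition gradient_energy ::
    "'a::euclidean_space set \<Rightarrow> real \<Rightarrow> ('a \<Rightarrow> real) \<Rightarrow> real \<Rightarrow> ('a \<Rightarrow> real) \<Rightarrow> ennreal" where
  "gradient_energy \<Omega> \<alpha> \<kappa> \<gamma> u =
     (\<integral>\<^sup>+x. ennreal (phi \<alpha> \<kappa> \<gamma> x (norm (weak_gradient \<Omega> u x))) \<partial>lebesgue_on \<Omega>)"

definition X_space ::
    "'a::euclidean_space set \<Rightarrow> real \<Rightarrow> ('a \<Rightarrow> real) \<Rightarrow> real \<Rightarrow> ('a \<Rightarrow> real) set" where
  "X_space \<Omega> \<alpha> \<kappa> \<gamma> = {u \<in> L2 \<Omega> \<inter> W11 \<Omega>. gradient_energy \<Omega> \<alpha> \<kappa> \<gamma> u < \<infinity>}"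

definition F_gamma ::
    "'a::euclidean_space set \<Rightarrow> ('a \<Rightarrow> real) \<Rightarrow> real \<Rightarrow> ('a \<Rightarrow> real) \<Rightarrow> real \<Rightarrow> ('a \<Rightarrow> real) \<Rightarrow> ennreal" where
  "F_gamma \<Omega> f \<alpha> \<kappa> \<gamma> u =
     (if u \<in> X_space \<Omega> \<alpha> \<kappa> \<gamma>
      then ennreal (1/2 * (L2_norm \<Omega> (\<lambda>x. u x - f x))\<^sup>2) + gradient_energy \<Omega> \<alpha> \<kappa> \<gamma> u
      else \<infinity>)"

definition F_ROF ::
    "'a::euclidean_space set \<Rightarrow> ('a \<Rightarrow> real) \<Rightarrow> real \<Rightarrow> ('a \<Rightarrow> real) \<Rightarrow> ennreal" where
  "F_ROF \<Omega> f \<alpha> u =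
     (if u \<in> BV \<Omega> \<inter> L2 \<Omega>
      then ennreal (1/2 * (L2_norm \<Omega> (\<lambda>x. u x - f x))\<^sup>2) + ennreal \<alpha> * total_variation \<Omega> u
      else \<infinity>)"

subsection \<open>Gamma-convergence and compactness\<close>

text \<open>\<open>X\<close> is the carrier and \<open>d\<close> a (pseudo-)metric on it, such as \<^const>\<open>L1\<close> and \<^const>\<open>L1_dist\<close>.\<close>

definition gamma_converges ::
    "'u set \<Rightarrow> ('u \<Rightarrow> 'u \<Rightarrow> real) \<Rightarrow> (nat \<Rightarrow> 'u \<Rightarrow> ennreal) \<Rightarrow> ('u \<Rightarrow> ennreal) \<Rightarrow> bool" where
  "gamma_converges X d Fn F \<longleftrightarrow>
     (\<forall>u\<in>X.
        (\<forall>v. (\<forall>n. v n \<in> X) \<and> (\<lambda>n. d (v n) u) \<longlonglongrightarrow> 0 \<longrightarrow> F u \<le> liminf (\<lambda>n. Fn n (v n))) \<and>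
        (\<exists>v. (\<forall>n. v n \<in> X) \<and> (\<lambda>n. d (v n) u) \<longlonglongrightarrow> 0 \<and> limsup (\<lambda>n. Fn n (v n)) \<le> F u))"

text \<open>Gamma-convergence of a family as the parameter decreases to 0 means Gamma-convergence along
  every sequence of positive parameters tending to 0.\<close>

definition gamma_converges_at_right_0 ::
    "'u set \<Rightarrow> ('u \<Rightarrow> 'u \<Rightarrow> real) \<Rightarrow> (real \<Rightarrow> 'u \<Rightarrow> ennreal) \<Rightarrow> ('u \<Rightarrow> ennreal) \<Rightarrow> bool" where
  "gamma_converges_at_right_0 X d F F0 \<longleftrightarrow>
     (\<forall>g. (\<forall>n. 0 < g n) \<and> g \<longlonglongrightarrow> 0 \<longrightarrow> gamma_converges X d (\<lambda>n. F (g n)) F0)"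

definition precompact :: "'u set \<Rightarrow> ('u \<Rightarrow> 'u \<Rightarrow> real) \<Rightarrow> 'u set \<Rightarrow> bool" where
  "precompact X d A \<longleftrightarrow> A \<subseteq> X \<and>
     (\<forall>s::nat \<Rightarrow> 'u. (\<forall>n. s n \<in> A) \<longrightarrow>
        (\<exists>l\<in>X. \<exists>r. strict_mono r \<and> (\<lambda>n. d (s (r n)) l) \<longlonglongrightarrow> 0))"

definition cluster_point :: "'u set \<Rightarrow> ('u \<Rightarrow> 'u \<Rightarrow> real) \<Rightarrow> (nat \<Rightarrow> 'u) \<Rightarrow> 'u \<Rightarrow> bool" where
  "cluster_point X d s l \<longleftrightarrow> l \<in> X \<and> (\<forall>\<epsilon>>0. \<exists>\<^sub>F n in sequentially. d (s n) l < \<epsilon>)"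

end

theory Submission
  imports Defs "HOL-Complex_Analysis.Great_Picard" "HOL-Library.Diagonal_Subsequence"
begin

text \<open>
  The logarithmic term is nonnegative, so every \<^const>\<open>F_gamma\<close> dominates \<^const>\<open>F_ROF\<close>
  (\<open>F_ROF_le_F_gamma\<close>). The lower bound of the Gamma-limit and the equicoercivity are therefore
  statements about \<^const>\<open>F_ROF\<close> alone: its lower semicontinuity in \<open>L\<^sup>1\<close> (\<open>F_ROF_lsc\<close>) and the
  compactness of its sublevel sets (\<open>F_ROF_bounded_compact\<close>). Semicontinuity holds because the total
  variation is a supremum of \<open>L\<^sup>1\<close>-continuous functionals and because of Fatou's lemma for the
  fidelity term.

  For the upper bound, note that for a fixed function with bounded gradient the logarithmic term is
  at most \<open>\<gamma>\<close> times a finite constant (\<open>gradient_energy_test_function\<close>), so it vanishes in the limit. It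
  remains to approximate a given \<open>u \<in> BV \<inter> L\<^sup>2\<close> in \<open>L\<^sup>2\<close> by smooth functions \<open>w\<close> with bounded gradient
  such that \<open>\<integral>|\<nabla>w|\<close> does not exceed the total variation of \<open>u\<close> by more than a small error
  (\<open>smooth_strict_approximation\<close>), and to let the approximation improve slowly enough along
  \<open>\<gamma> \<rightarrow> 0\<close> (\<open>diagonal_index\<close>).

  The approximation uses the Lipschitz boundary: near a boundary point the domain lies above a Lipschitz
  graph, so a small upward shift, followed by a perturbation of a comparable but smaller size, keeps
  nearby points of the domain inside the domain. Pieces of \<open>u\<close>, cut out by a partition of unity, are
  shifted and mollified accordingly. The variation of the result is estimated by duality: all operations are moved to the
  test field, which stays admissible. In this way the distributional derivative never has to be
  represented by a measure.

  For compactness, the functions are first replaced by smooth approximations, and then cut off inside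
  the domain; the bound in \<open>L\<^sup>2\<close> makes the discarded mass uniformly small. The cut-off functions are
  uniformly close to their mollifications at a fixed scale, and these are compact by the theorem of
  Arzela and Ascoli.
\<close>

section \<open>Smooth functions\<close>

definition smooth :: "('a::euclidean_space \<Rightarrow> 'b::real_normed_vector) \<Rightarrow> bool" where
  "smooth f \<longleftrightarrow> (\<forall>k. C_k k f)"

lemma C_k_SucI:
  assumes "\<And>x. (f has_derivative f' x) (at x)" "\<And>v. C_k k (\<lambda>x. f' x v)"
  shows "C_k (Suc k) f"
proof -
  have "frechet_derivative f (at x) = f' x" for x
    using frechet_derivative_at[OF assms(1)] by simp
  with assms show ?thesis
    by (auto simp: differentiable_def)
qed

lemma C_k_has_derivative:
  "C_k (Suc k) f \<Longrightarrow> (f has_derivative frechet_derivative f (at x)) (at x)"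
  by (simp add: frechet_derivative_works)

lemma C_k_directional: "C_k (Suc k) f \<Longrightarrow> C_k k (\<lambda>x. frechet_derivative f (at x) v)"
  by simp

lemma C_k_Suc_imp: "C_k (Suc k) f \<Longrightarrow> C_k k f"
proof (induction k arbitrary: f)
  case 0
  then show ?case
    by (auto simp: continuous_on_eq_continuous_at differentiable_imp_continuous_within)
next
  case (Suc k)
  then show ?case by (metis C_k.simps(2))
qed

lemma smooth_C_k: "smooth f \<Longrightarrow> C_k k f"
  by (simp add: smooth_def)

lemma smooth_has_derivative:
  "smooth f \<Longrightarrow> (f has_derivative frechet_derivative f (at x)) (at x)"
  using C_k_has_derivative smooth_C_k by blast

lemma smooth_directional: "smooth f \<Longrightarrow> smooth (\<lambda>x. frechet_derivative f (at x) v)"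
  unfolding smooth_def by (metis C_k.simps(2))

lemma smooth_continuous: "smooth f \<Longrightarrow> continuous_on S f"
  using smooth_C_k[of f 0] continuous_on_subset by auto

lemma smooth_borel[measurable_dest]: "smooth f \<Longrightarrow> f \<in> borel_measurable borel"
  by (intro borel_measurable_continuous_onI smooth_continuous)

text \<open>The derivatives of affine substitutions, of linear images and of convolutions are of the same
  form as the functions themselves. For such classes this rule replaces an induction over the order of
  differentiation.\<close>

lemma smooth_coinduct:
  assumes "P f"
    and step: "\<And>f. P f \<Longrightarrow> \<exists>f'. (\<forall>x. (f has_derivative f' x) (at x)) \<and> (\<forall>v. P (\<lambda>x. f' x v))"
  shows "smooth f"
proof -
  have "\<forall>f. P f \<longrightarrow> C_k k f" for k
  proof (induction k)
    case 0
    then show ?case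
      using step has_derivative_continuous
      by (metis C_k.simps(1) continuous_at_imp_continuous_on)
  next
    case (Suc k)
    then show ?case using step C_k_SucI by metis
  qed
  with assms(1) show ?thesis by (simp add: smooth_def)
qed

lemma smooth_const: "smooth (\<lambda>x. c)"
  by (rule smooth_coinduct[where P="\<lambda>f. \<exists>c. f = (\<lambda>x. c)"]) (auto intro!: exI[where x="\<lambda>_ _. 0"])

lemma smooth_bounded_linear_comp:
  assumes "smooth f" "bounded_linear T"
  shows "smooth (\<lambda>x. T (f x))"
proof (rule smooth_coinduct[where P="\<lambda>h. \<exists>f. smooth f \<and> h = (\<lambda>x. T (f x))"])
  show "\<exists>f'. smooth f' \<and> (\<lambda>x. T (f x)) = (\<lambda>x. T (f' x))" using assms by blast
next
  fix h assume "\<exists>f. smooth f \<and> h = (\<lambda>x. T (f x))"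
  then obtain f where f: "smooth f" "h = (\<lambda>x. T (f x))" by blast
  show "\<exists>f'. (\<forall>x. (h has_derivative f' x) (at x)) \<and>
        (\<forall>v. \<exists>fa. smooth fa \<and> (\<lambda>x. f' x v) = (\<lambda>x. T (fa x)))"
    using bounded_linear.has_derivative[OF assms(2) smooth_has_derivative[OF f(1)]]
      smooth_directional[OF f(1)] f(2)
    by (intro exI[where x="\<lambda>x v. T (frechet_derivative f (at x) v)"]) auto
qed

lemma smooth_affine_comp:
  fixes f :: "'a::euclidean_space \<Rightarrow> 'b::real_normed_vector"
  assumes "smooth f"
  shows "smooth (\<lambda>x. f (a + c *\<^sub>R x))"
proof (rule smooth_coinduct[where P="\<lambda>h. \<exists>f::'a \<Rightarrow> 'b. smooth f \<and> h = (\<lambda>x. f (a + c *\<^sub>R x))"])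
  show "\<exists>f'::'a \<Rightarrow> 'b. smooth f' \<and> (\<lambda>x. f (a + c *\<^sub>R x)) = (\<lambda>x. f' (a + c *\<^sub>R x))"
    using assms by blast
next
  fix h :: "'a \<Rightarrow> 'b" assume "\<exists>f::'a \<Rightarrow> 'b. smooth f \<and> h = (\<lambda>x. f (a + c *\<^sub>R x))"
  then obtain f :: "'a \<Rightarrow> 'b" where f: "smooth f" "h = (\<lambda>x. f (a + c *\<^sub>R x))" by blast
  have "((\<lambda>x. f (a + c *\<^sub>R x)) has_derivative
      (\<lambda>v. frechet_derivative f (at (a + c *\<^sub>R x)) (c *\<^sub>R v))) (at x)" for x
    by (rule has_derivative_compose[OF _ smooth_has_derivative[OF f(1)]])
       (auto intro!: derivative_eq_intros)
  then show "\<exists>f'. (\<forall>x. (h has_derivative f' x) (at x)) \<and>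
        (\<forall>v. \<exists>fa::'a \<Rightarrow> 'b. smooth fa \<and> (\<lambda>x. f' x v) = (\<lambda>x. fa (a + c *\<^sub>R x)))"
    unfolding f(2)
  proof (intro exI[where x="\<lambda>x v. frechet_derivative f (at (a + c *\<^sub>R x)) (c *\<^sub>R v)"] conjI allI)
    show "\<exists>fa::'a \<Rightarrow> 'b. smooth fa \<and>
        (\<lambda>x. frechet_derivative f (at (a + c *\<^sub>R x)) (c *\<^sub>R v)) = (\<lambda>x. fa (a + c *\<^sub>R x))" for v
      using smooth_directional[OF f(1), of "c *\<^sub>R v"]
      by (intro exI[where x="\<lambda>x. frechet_derivative f (at x) (c *\<^sub>R v)"] conjI refl)
  qed
qed

lemma C_k_add: "C_k k f \<Longrightarrow> C_k k g \<Longrightarrow> C_k k (\<lambda>x. f x + g x)"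
proof (induction k arbitrary: f g)
  case (Suc k)
  show ?case
  proof (rule C_k_SucI)
    show "((\<lambda>x. f x + g x) has_derivative
        (\<lambda>v. frechet_derivative f (at x) v + frechet_derivative g (at x) v)) (at x)" for x
      using Suc.prems by (intro has_derivative_add C_k_has_derivative)
    show "C_k k (\<lambda>x. frechet_derivative f (at x) v + frechet_derivative g (at x) v)" for v
      using Suc.prems by (intro Suc.IH C_k_directional)
  qed
qed (auto intro: continuous_intros)

lemma smooth_add: "smooth f \<Longrightarrow> smooth g \<Longrightarrow> smooth (\<lambda>x. f x + g x)"
  by (simp add: smooth_def C_k_add)

lemma smooth_minus: "smooth f \<Longrightarrow> smooth (\<lambda>x. - f x)"
  using smooth_bounded_linear_comp[OF _ bounded_linear_minus[OF bounded_linear_ident]] by blast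

lemma smooth_diff: "smooth f \<Longrightarrow> smooth g \<Longrightarrow> smooth (\<lambda>x. f x - g x)"
  using smooth_add[of f "\<lambda>x. - g x"] smooth_minus[of g] by simp

lemma smooth_sum: "(\<And>i. i \<in> I \<Longrightarrow> smooth (f i)) \<Longrightarrow> smooth (\<lambda>x. \<Sum>i\<in>I. f i x)"
  by (induction I rule: infinite_finite_induct) (auto simp: smooth_const intro!: smooth_add)

lemma C_k_bilinear:
  assumes "bounded_bilinear prd"
  shows "C_k k f \<Longrightarrow> C_k k g \<Longrightarrow> C_k k (\<lambda>x. prd (f x) (g x))"
proof (induction k arbitrary: f g)
  case 0
  then show ?case by (simp add: bounded_bilinear.continuous_on[OF assms])
next
  case (Suc k)
  show ?case
  proof (rule C_k_SucI)
    show "((\<lambda>x. prd (f x) (g x)) has_derivative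
        (\<lambda>v. prd (f x) (frechet_derivative g (at x) v) + prd (frechet_derivative f (at x) v) (g x)))
          (at x)" for x
      using Suc.prems by (intro bounded_bilinear.FDERIV[OF assms] C_k_has_derivative)
    show "C_k k (\<lambda>x. prd (f x) (frechet_derivative g (at x) v) +
        prd (frechet_derivative f (at x) v) (g x))" for v
      by (intro C_k_add Suc.IH C_k_directional Suc.prems C_k_Suc_imp[OF Suc.prems(1)]
          C_k_Suc_imp[OF Suc.prems(2)])
  qed
qed

lemma smooth_mult:
  fixes f g :: "'a::euclidean_space \<Rightarrow> real"
  shows "smooth f \<Longrightarrow> smooth g \<Longrightarrow> smooth (\<lambda>x. f x * g x)"
  by (simp add: smooth_def C_k_bilinear[OF bounded_bilinear_mult])

lemma smooth_scaleR: "smooth f \<Longrightarrow> smooth g \<Longrightarrow> smooth (\<lambda>x. f x *\<^sub>R g x)"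
  by (simp add: smooth_def C_k_bilinear[OF bounded_bilinear_scaleR])

lemma smooth_inner: "smooth f \<Longrightarrow> smooth g \<Longrightarrow> smooth (\<lambda>x. f x \<bullet> g x)"
  by (simp add: smooth_def C_k_bilinear[OF bounded_bilinear_inner])

lemma smooth_ident: "smooth (\<lambda>x. x)"
proof -
  have "C_k k (\<lambda>x::'a. x)" for k
  proof (cases k)
    case (Suc j)
    then show ?thesis
      using C_k_SucI[of "\<lambda>x. x" "\<lambda>x v. v" j] smooth_C_k[OF smooth_const] by auto
  qed auto
  then show ?thesis by (simp add: smooth_def)
qed

text \<open>The powers and the functions \<open>exp (-1/s) / s^n\<close> are not closed under differentiation one by
  one, but the derivative of each is a combination of two members of the same family. The induction
  over the order therefore runs over all members at once.\<close>

lemma smooth_compose_family: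
  fixes h :: "'i \<Rightarrow> real \<Rightarrow> real" and f :: "'a::euclidean_space \<Rightarrow> real"
  assumes h: "\<And>i s. s \<in> S \<Longrightarrow> (h i has_real_derivative a i * h (p i) s + b i * h (q i) s) (at s)"
    and f: "smooth f" "\<And>x. f x \<in> S"
  shows "smooth (\<lambda>x. h i (f x))"
proof -
  have "C_k k (\<lambda>x. h i (f x))" for k i
  proof (induction k arbitrary: i)
    case 0
    have "isCont (\<lambda>x. h i (f x)) x" for x
      by (rule isCont_o2[OF has_derivative_continuous[OF smooth_has_derivative[OF f(1)]]
            DERIV_isCont[OF h[OF f(2)]]])
    then show ?case by (simp add: continuous_at_imp_continuous_on)
  next
    case (Suc k)
    show ?case
    proof (rule C_k_SucI)
      show "((\<lambda>x. h i (f x)) has_derivative (\<lambda>v. (a i * h (p i) (f x) + b i * h (q i) (f x)) *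
          frechet_derivative f (at x) v)) (at x)" for x
        using has_derivative_compose[OF smooth_has_derivative[OF f(1)]
            h[OF f(2), unfolded has_field_derivative_def]] by simp
      show "C_k k (\<lambda>x. (a i * h (p i) (f x) + b i * h (q i) (f x)) * frechet_derivative f (at x) v)" for v
        by (intro C_k_bilinear[OF bounded_bilinear_mult] C_k_add Suc.IH
            smooth_C_k smooth_directional smooth_const f)
    qed
  qed
  then show ?thesis by (simp add: smooth_def)
qed

lemma smooth_powr:
  fixes f :: "'a::euclidean_space \<Rightarrow> real"
  assumes "smooth f" "\<And>x. f x > 0"
  shows "smooth (\<lambda>x. f x powr a)"
  by (rule smooth_compose_family[where h="\<lambda>a s. s powr a" and S="{0<..}" and a="\<lambda>a. a"
        and b="\<lambda>a. 0" and p="\<lambda>a. a - 1" and q="\<lambda>a. a" and i=a, OF _ assms(1)])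
     (use assms(2) in \<open>auto intro!: derivative_eq_intros\<close>)

section \<open>Bump functions and test functions\<close>

text \<open>The classical smooth function \<open>exp (-1/s)\<close> that vanishes to infinite order at 0 is \<open>flat 0\<close>; the
  powers of \<open>1/s\<close> close the family under differentiation.\<close>

definition flat :: "nat \<Rightarrow> real \<Rightarrow> real" where
  "flat n s = (if s > 0 then (1/s)^n * exp (-1/s) else 0)"

text \<open>With \<open>y = 1/s\<close> this is \<open>y^(n+2) / (n+2)! \<le> exp y\<close>, a single term of the exponential series. The
  quadratic decay is what makes the derivative at 0 vanish.\<close>

lemma flat_le_square: "\<bar>flat n s\<bar> \<le> fact (n + 2) * s\<^sup>2"
proof (cases "s > 0")
  case True
  define y where "y = 1/s"
  have y: "y > 0" using True by (simp add: y_def)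
  have "(\<Sum>k\<in>{n+2}. y ^ k /\<^sub>R fact k) \<le> (\<Sum>k. y ^ k /\<^sub>R fact k)"
    using y by (intro sum_le_suminf summable_exp_generic) auto
  then have "y ^ (n+2) / fact (n+2) \<le> exp y"
    by (simp add: exp_def divide_inverse mult.commute)
  then have "y ^ n * y^2 \<le> fact (n+2) * exp y"
    by (simp add: divide_le_eq power_add[symmetric] mult.commute del: fact_Suc fact_2 power_Suc)
  then have "y ^ n * exp (-y) \<le> fact (n+2) / y^2"
    using y by (simp add: exp_minus field_simps del: fact_Suc fact_2)
  then show ?thesis
    using True by (simp add: flat_def y_def power_one_over field_simps)
qed (auto simp: flat_def)

lemma flat_deriv:
  "(flat n has_real_derivative (- real n) * flat (n+1) s + 1 * flat (n+2) s) (at s)"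
proof (cases s "0::real" rule: linorder_cases)
  case less
  have ev: "\<forall>\<^sub>F t in nhds s. flat n t = 0"
    using less by (intro eventually_mono[OF eventually_nhds_in_open[of "{..<0}" s]]) (auto simp: flat_def)
  show ?thesis
    using less iffD2[OF DERIV_cong_ev[OF refl ev refl] DERIV_const] by (simp add: flat_def[of "_ + _"] flat_def[of "Suc _"])
next
  case greater
  have ev: "\<forall>\<^sub>F t in nhds s. flat n t = (1/t)^n * exp (-1/t)"
    using greater by (intro eventually_mono[OF eventually_nhds_in_open[of "{0<..}" s]]) (auto simp: flat_def)
  have "((\<lambda>t. (1/t)^n * exp (-1/t)) has_real_derivative
      (- real n) * flat (n+1) s + 1 * flat (n+2) s) (at s)"
    using greater
    by (cases n) (auto intro!: derivative_eq_intros simp: flat_def field_simps power2_eq_square,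
        rule ccontr, simp flip: power_Suc)
  then show ?thesis using DERIV_cong_ev[OF refl ev refl] by simp
next
  case equal
  have "((\<lambda>h. flat n h / h) \<longlongrightarrow> 0) (at 0)"
  proof (rule tendsto_rabs_zero_cancel, rule tendsto_sandwich[of "\<lambda>_. 0"])
    show "\<forall>\<^sub>F h in at 0. \<bar>flat n h / h\<bar> \<le> fact (n+2) * \<bar>h\<bar>"
      unfolding eventually_at_filter
    proof (intro always_eventually allI impI)
      fix h :: real assume "h \<noteq> 0"
      have "\<bar>flat n h / h\<bar> \<le> fact (n+2) * h\<^sup>2 / \<bar>h\<bar>"
        unfolding abs_divide by (intro divide_right_mono flat_le_square) auto
      also have "\<dots> = fact (n+2) * \<bar>h\<bar>"
        using \<open>h \<noteq> 0\<close> by (cases "h > 0") (auto simp: power2_eq_square)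
      finally show "\<bar>flat n h / h\<bar> \<le> fact (n+2) * \<bar>h\<bar>" .
    qed
    have "((\<lambda>h::real. fact (n+2) * \<bar>h\<bar>) \<longlongrightarrow> fact (n+2) * \<bar>0\<bar>) (at 0)"
      by (intro tendsto_intros)
    then show "((\<lambda>h::real. fact (n+2) * \<bar>h\<bar>) \<longlongrightarrow> 0) (at 0)" by simp
  qed auto
  then show ?thesis
    using equal by (simp add: DERIV_def flat_def)
qed

lemma smooth_flat: "smooth f \<Longrightarrow> smooth (\<lambda>x. flat n (f x))"
  by (rule smooth_compose_family[where S=UNIV, OF flat_deriv]) auto

lemma flat_nonneg: "flat n s \<ge> 0"
  by (simp add: flat_def)

lemma flat_0_mono: "s \<le> t \<Longrightarrow> flat 0 s \<le> flat 0 t"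
  by (auto simp: flat_def field_simps)

text \<open>A smooth transition from 1 on the negative half-line to 0 beyond 1. It has a genuine plateau,
  as \<open>flat 0\<close> vanishes to the left of 0 and is applied to a shifted reflection of itself.\<close>

definition smooth_step :: "real \<Rightarrow> real" where
  "smooth_step s = flat 0 (exp (-1) - flat 0 s) / flat 0 (exp (-1))"

lemma smooth_step_facts:
  "0 \<le> smooth_step s" "smooth_step s \<le> 1"
  "s \<le> 0 \<Longrightarrow> smooth_step s = 1" "1 \<le> s \<Longrightarrow> smooth_step s = 0"
proof -
  have pos: "flat 0 (exp (-1)) > 0" by (simp add: flat_def)
  show "0 \<le> smooth_step s" using pos by (simp add: smooth_step_def flat_nonneg)
  show "smooth_step s \<le> 1"
    using pos flat_nonneg[of 0 s] by (simp add: smooth_step_def flat_0_mono)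
  show "s \<le> 0 \<Longrightarrow> smooth_step s = 1" using pos by (simp add: smooth_step_def flat_def)
  assume "1 \<le> s"
  then have "exp (-1) \<le> flat 0 s" using flat_0_mono[of 1 s] by (simp add: flat_def)
  then show "smooth_step s = 0" by (simp add: smooth_step_def flat_def)
qed

text \<open>For \<open>r > 0\<close> this cut-off is 1 up to distance \<open>r\<close> from \<open>c\<close> and 0 beyond \<open>sqrt 2 * r\<close>, hence
  beyond \<open>3/2 * r\<close>.\<close>

definition bump :: "'a::euclidean_space \<Rightarrow> real \<Rightarrow> 'a \<Rightarrow> real" where
  "bump c r x = smooth_step ((x - c) \<bullet> (x - c) / r\<^sup>2 - 1)"

lemma smooth_bump: "smooth (bump c r)"
proof -
  have "smooth (\<lambda>x. (x - c) \<bullet> (x - c) / r\<^sup>2 - 1)"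
    unfolding divide_inverse
    by (intro smooth_diff smooth_mult smooth_inner smooth_ident smooth_const)
  then have "smooth (\<lambda>x. flat 0 (exp (-1) - flat 0 ((x - c) \<bullet> (x - c) / r\<^sup>2 - 1)) *
      inverse (flat 0 (exp (-1))))"
    by (intro smooth_mult smooth_flat smooth_const smooth_diff[OF smooth_const smooth_flat])
  then show ?thesis
    unfolding bump_def[abs_def] smooth_step_def divide_inverse .
qed

lemma bump_facts:
  fixes x c :: "'a::euclidean_space"
  shows "0 \<le> bump c r x" "bump c r x \<le> 1"
    "r > 0 \<Longrightarrow> norm (x - c) \<le> r \<Longrightarrow> bump c r x = 1"
    "r > 0 \<Longrightarrow> bump c r x \<noteq> 0 \<Longrightarrow> norm (x - c) \<le> 3/2 * r"
proof -
  show "0 \<le> bump c r x" "bump c r x \<le> 1" by (simp_all add: bump_def smooth_step_facts)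
  { assume "r > 0" "norm (x - c) \<le> r"
    then have "(x - c) \<bullet> (x - c) \<le> r\<^sup>2"
      by (metis norm_ge_zero power2_norm_eq_inner power_mono)
    then show "bump c r x = 1"
      using \<open>r > 0\<close> by (simp add: bump_def smooth_step_facts(3)) }
  { assume r: "r > 0" "bump c r x \<noteq> 0"
    show "norm (x - c) \<le> 3/2 * r"
    proof (rule ccontr)
      assume "\<not> norm (x - c) \<le> 3/2 * r"
      then have "(3/2 * r)\<^sup>2 \<le> (norm (x - c))\<^sup>2"
        using r by (intro power_mono) auto
      moreover have "2 * r\<^sup>2 \<le> (3/2 * r)\<^sup>2"
        unfolding power_mult_distrib by (intro mult_right_mono) (auto simp: power2_eq_square)
      ultimately have "2 * r\<^sup>2 \<le> (x - c) \<bullet> (x - c)"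
        using power2_norm_eq_inner[of "x - c"] by linarith
      then have "bump c r x = 0"
        using r by (simp add: bump_def smooth_step_facts(4) field_simps)
      with r show False by simp
    qed }
qed

lemma bump_uminus: "bump 0 r (- x) = bump 0 r x"
  by (simp add: bump_def)

lemma test_functionsI:
  assumes "smooth f" "compact K" "K \<subseteq> \<Omega>" "\<And>x. x \<notin> K \<Longrightarrow> f x = 0"
  shows "f \<in> test_functions \<Omega>"
proof -
  have "closure {x. f x \<noteq> 0} \<subseteq> K"
    using assms by (intro closure_minimal compact_imp_closed) auto
  with assms show ?thesis
    unfolding test_functions_def smooth_def
    by (auto simp: compact_closure intro: bounded_subset[OF compact_imp_bounded] closure_subset)
qed

lemma test_functionsE:
  assumes "f \<in> test_functions \<Omega>"
  obtains K where "compact K" "K \<subseteq> \<Omega>" "\<And>x. x \<notin> K \<Longrightarrow> f x = 0"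
    "\<And>x v. x \<notin> K \<Longrightarrow> frechet_derivative f (at x) v = 0"
proof
  let ?K = "closure {x. f x \<noteq> 0}"
  show "compact ?K" "?K \<subseteq> \<Omega>" using assms by (auto simp: test_functions_def)
  show out: "f x = 0" if "x \<notin> ?K" for x
    using that closure_subset[of "{x. f x \<noteq> 0}"] by auto
  show "frechet_derivative f (at x) v = 0" if "x \<notin> ?K" for x v
  proof -
    have "((\<lambda>_. 0) has_derivative (\<lambda>_. 0)) (at x)" by simp
    then have "(f has_derivative (\<lambda>_. 0)) (at x)"
      by (rule has_derivative_transform_within_open[of _ _ _ _ "- ?K"])
        (simp_all only: Compl_iff that out open_Compl closed_closure not_False_eq_True)
    from frechet_derivative_at[OF this, symmetric] show ?thesis by simp
  qed
qed

lemma test_functions_smooth: "f \<in> test_functions \<Omega> \<Longrightarrow> smooth f"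
  by (simp add: test_functions_def smooth_def)

lemma test_functions_mono: "f \<in> test_functions A \<Longrightarrow> A \<subseteq> B \<Longrightarrow> f \<in> test_functions B"
  by (auto simp: test_functions_def)

lemma test_functions_borel[measurable_dest]: "f \<in> test_functions \<Omega> \<Longrightarrow> f \<in> borel_measurable borel"
  by (intro smooth_borel test_functions_smooth)

lemma test_functions_directional:
  assumes "f \<in> test_functions \<Omega>"
  shows "(\<lambda>x. frechet_derivative f (at x) v) \<in> test_functions \<Omega>"
  by (rule test_functionsE[OF assms], rule test_functionsI)
    (auto intro: smooth_directional test_functions_smooth[OF assms])

lemma test_functions_supported_mult:
  assumes "f \<in> test_functions \<Omega>" "smooth g" "\<And>x. f x = 0 \<Longrightarrow> g x = 0"
  shows "g \<in> test_functions \<Omega>"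
  by (rule test_functionsE[OF assms(1)], rule test_functionsI[OF assms(2)]) (auto intro: assms(3))

lemma test_functions_bounded:
  assumes "f \<in> test_functions \<Omega>"
  obtains B where "B \<ge> 0" "\<And>x. norm (f x) \<le> B"
proof -
  obtain K where K: "compact K" "\<And>x. x \<notin> K \<Longrightarrow> f x = 0" using test_functionsE[OF assms] by metis
  have "bounded (f ` K)"
    using K assms by (intro compact_imp_bounded compact_continuous_image smooth_continuous
        test_functions_smooth)
  then obtain B where "B > 0" "\<And>x. x \<in> K \<Longrightarrow> norm (f x) \<le> B" by (auto simp: bounded_pos)
  then have "norm (f x) \<le> B" for x
    using K(2)[of x] by (cases "x \<in> K") auto
  with \<open>B > 0\<close> show ?thesis by (intro that[of B]) auto
qed

lemma test_functions_bump: "r > 0 \<Longrightarrow> cball c (3/2 * r) \<subseteq> \<Omega> \<Longrightarrow> bump c r \<in> test_functions \<Omega>"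
  by (rule test_functionsI[where K="cball c (3/2 * r)"])
    (use bump_facts(4)[of r c] in \<open>force simp: smooth_bump dist_norm norm_minus_commute\<close>)+

section \<open>Convolution and mollifiers\<close>

abbreviation directional ("\<partial>") where
  "\<partial> v f \<equiv> (\<lambda>x. frechet_derivative f (at x) v)"

lemma linear_frechet_derivative: "smooth f \<Longrightarrow> linear (frechet_derivative f (at x))"
  by (rule has_derivative_linear[OF smooth_has_derivative])

lemma frechet_derivative_expansion:
  assumes "smooth f"
  shows "\<partial> v f x = (\<Sum>b\<in>Basis. (v \<bullet> b) *\<^sub>R \<partial> b f x)"
proof -
  have "\<partial> v f x = \<partial> (\<Sum>b\<in>Basis. (v \<bullet> b) *\<^sub>R b) f x"
    by (simp add: euclidean_representation)
  also have "\<dots> = (\<Sum>b\<in>Basis. (v \<bullet> b) *\<^sub>R \<partial> b f x)"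
    using linear_frechet_derivative[OF assms, of x] by (simp add: linear_sum linear_cmul)
  finally show ?thesis .
qed

lemma compact_plus_cball: "compact K \<Longrightarrow> compact {x + y | x y. x \<in> K \<and> y \<in> cball (0::'a::euclidean_space) r}"
  using compact_sums[OF _ compact_cball] by blast

text \<open>Compactness applies to a neighbourhood of the support, and of two points at distance less than 1
  either both lie in that neighbourhood or neither lies in the support.\<close>

lemma compact_support_uniformly_continuous:
  fixes f :: "'a::euclidean_space \<Rightarrow> 'b::real_normed_vector"
  assumes "continuous_on UNIV f" "compact K" "\<And>x. x \<notin> K \<Longrightarrow> f x = 0" "\<eta> > 0"
  obtains \<delta> where "0 < \<delta>" "\<delta> \<le> 1" "\<And>x h. norm h < \<delta> \<Longrightarrow> norm (f (x + h) - f x) \<le> \<eta>"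
proof -
  define K' where "K' = {x + y | x y. x \<in> K \<and> y \<in> cball (0::'a) 1}"
  have "uniformly_continuous_on K' f"
    unfolding K'_def using assms
    by (intro compact_uniformly_continuous compact_plus_cball continuous_on_subset[OF assms(1)]) auto
  then obtain d where d: "d > 0" "\<And>x y. x \<in> K' \<Longrightarrow> y \<in> K' \<Longrightarrow> dist x y < d \<Longrightarrow> dist (f x) (f y) < \<eta>"
    using \<open>\<eta> > 0\<close> unfolding uniformly_continuous_on_def by metis
  show ?thesis
  proof (rule that[of "min d 1"])
    fix x h :: 'a assume h: "norm h < min d 1"
    show "norm (f (x + h) - f x) \<le> \<eta>"
    proof (cases "x \<in> K \<or> x + h \<in> K")
      case True
      have "x \<in> K'" "x + h \<in> K'"
      proof -
        have K'I: "y + z \<in> K'" if "y \<in> K" "norm z \<le> 1" for y z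
          unfolding K'_def using that by auto
        show "x \<in> K'" using K'I[of x 0] K'I[of "x + h" "- h"] h True by auto
        show "x + h \<in> K'" using K'I[of "x + h" 0] K'I[of x h] h True by auto
      qed
      from d(2)[OF this] h show ?thesis by (simp add: dist_norm norm_minus_commute)
    qed (use assms in auto)
  qed (use d in auto)
qed

text \<open>The remainder is controlled by the oscillation of the partial derivatives, which are uniformly
  continuous. As \<open>\<delta>\<close> does not depend on \<open>x\<close>, the estimate survives integration against any integrable
  function.\<close>

lemma test_functions_uniformly_differentiable:
  fixes f :: "'a::euclidean_space \<Rightarrow> 'b::real_normed_vector"
  assumes f: "f \<in> test_functions \<Omega>" and "\<eta> > 0"
  obtains \<delta> where "0 < \<delta>" "\<And>x h. norm h < \<delta> \<Longrightarrow> norm (f (x + h) - f x - \<partial> h f x) \<le> \<eta> * norm h"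
proof -
  have sm: "smooth f" using f test_functions_smooth by blast
  define \<eta>' where "\<eta>' = \<eta> / DIM('a)"
  have \<eta>': "\<eta>' > 0" using \<open>\<eta> > 0\<close> by (simp add: \<eta>'_def)
  have "\<exists>\<delta>>0. \<forall>x h. norm h < \<delta> \<longrightarrow> norm (\<partial> b f (x + h) - \<partial> b f x) \<le> \<eta>'" for b
  proof -
    have t: "\<partial> b f \<in> test_functions \<Omega>" using f by (rule test_functions_directional)
    obtain K where "compact K" "\<And>x. x \<notin> K \<Longrightarrow> \<partial> b f x = 0" using test_functionsE[OF t] by metis
    then show ?thesis
      using compact_support_uniformly_continuous[OF smooth_continuous[OF test_functions_smooth[OF t]], of K \<eta>'] \<eta>'
      by metis
  qed
  then obtain d where d: "\<And>b. d b > 0"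
    "\<And>b x h. norm h < d b \<Longrightarrow> norm (\<partial> b f (x + h) - \<partial> b f x) \<le> \<eta>'" by metis
  define \<delta> where "\<delta> = Min (d ` Basis)"
  have \<delta>: "\<delta> > 0" "\<And>b. b \<in> Basis \<Longrightarrow> \<delta> \<le> d b" unfolding \<delta>_def using d by auto
  have close: "onorm (frechet_derivative f (at (x + h)) - frechet_derivative f (at x)) \<le> \<eta>"
    if "norm h < \<delta>" for x h
  proof (rule onorm_bound)
    show "0 \<le> \<eta>" using \<open>\<eta> > 0\<close> by simp
    fix v :: 'a
    have "norm ((\<Sum>b\<in>Basis. (v \<bullet> b) *\<^sub>R (\<partial> b f (x + h) - \<partial> b f x))) \<le> (\<Sum>b\<in>(Basis::'a set). norm v * \<eta>')"
    proof (intro sum_norm_le)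
      fix b :: 'a assume b: "b \<in> Basis"
      have "\<bar>v \<bullet> b\<bar> * norm (\<partial> b f (x + h) - \<partial> b f x) \<le> norm v * \<eta>'"
        using that \<delta>(2)[OF b] by (intro mult_mono Basis_le_norm b d(2)) auto
      then show "norm ((v \<bullet> b) *\<^sub>R (\<partial> b f (x + h) - \<partial> b f x)) \<le> norm v * \<eta>'" by simp
    qed
    also have "\<dots> = \<eta> * norm v" by (simp add: \<eta>'_def)
    finally show "norm ((frechet_derivative f (at (x + h)) - frechet_derivative f (at x)) v) \<le> \<eta> * norm v"
      by (simp add: frechet_derivative_expansion[OF sm, where v=v] sum_subtractf scaleR_diff_right)
  qed
  show ?thesis
  proof (rule that[OF \<delta>(1)])
    fix x h :: 'a assume h: "norm h < \<delta>"
    have "norm (f (x + h) - f x - frechet_derivative f (at x) (x + h - x)) \<le> norm (x + h - x) * \<eta>"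
    proof (rule differentiable_bound_linearization[where S="ball x \<delta>"])
      show "x + t *\<^sub>R (x + h - x) \<in> ball x \<delta>" if "t \<in> {0..1}" for t
      proof -
        have "\<bar>t\<bar> * norm h \<le> 1 * norm h" using that by (intro mult_right_mono) auto
        then show ?thesis using h by (simp add: dist_norm)
      qed
      show "(f has_derivative frechet_derivative f (at y)) (at y within ball x \<delta>)" for y
        by (rule has_derivative_at_withinI[OF smooth_has_derivative[OF sm]])
      show "onorm (frechet_derivative f (at y) - frechet_derivative f (at x)) \<le> \<eta>" if "y \<in> ball x \<delta>" for y
        using close[of "y - x" x] that by (simp add: dist_norm norm_minus_commute)
    qed (use \<delta> in simp)
    then show "norm (f (x + h) - f x - \<partial> h f x) \<le> \<eta> * norm h" by (simp add: mult.commute)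
  qed
qed

lemma integrable_compact_support:
  fixes f :: "'a::euclidean_space \<Rightarrow> 'b::{banach, second_countable_topology}"
  assumes "f \<in> borel_measurable borel" "compact K" "\<And>x. x \<notin> K \<Longrightarrow> f x = 0" "\<And>x. norm (f x) \<le> B"
  shows "integrable lborel f"
proof (rule Bochner_Integration.integrable_bound)
  show "integrable lborel (\<lambda>x. B * indicator K x)"
    using assms(2) emeasure_compact_finite[of K]
    by (intro integrable_mult_right) (auto simp: borel_compact)
  show "AE x in lborel. norm (f x) \<le> norm (B * indicator K x)"
    using assms(3,4) order_trans[OF norm_ge_zero assms(4)] by (auto simp: indicator_def intro!: order_trans[OF assms(4)])
qed (use assms in simp)

lemma test_functions_integrable:
  fixes f :: "'a::euclidean_space \<Rightarrow> 'b::{banach, second_countable_topology}"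
  assumes "f \<in> test_functions \<Omega>"
  shows "integrable lborel f"
proof -
  obtain K where "compact K" "\<And>x. x \<notin> K \<Longrightarrow> f x = 0" using test_functionsE[OF assms] by metis
  moreover obtain B where "\<And>x. norm (f x) \<le> B" using test_functions_bounded[OF assms] by metis
  ultimately show ?thesis
    using assms by (intro integrable_compact_support[of f K B]) auto
qed

text \<open>The smooth factor \<open>f\<close> is vector-valued and the merely integrable factor \<open>g\<close> is scalar. This
  form covers both the mollification of a function (\<open>f\<close> is the mollifier) and the mollification of a
  test field (\<open>g\<close> is the mollifier).\<close>

definition convolution :: "('a::euclidean_space \<Rightarrow> 'b::euclidean_space) \<Rightarrow> ('a \<Rightarrow> real) \<Rightarrow> 'a \<Rightarrow> 'b" where
  "convolution f g x = (\<integral>y. g y *\<^sub>R f (x - y) \<partial>lborel)"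

lemma convolution_integrable:
  fixes f :: "'a::euclidean_space \<Rightarrow> 'b::euclidean_space"
  assumes [measurable]: "f \<in> borel_measurable borel" and B: "\<And>x. norm (f x) \<le> B" and g: "integrable lborel g"
  shows "integrable lborel (\<lambda>y. g y *\<^sub>R f (x - y))"
proof (rule Bochner_Integration.integrable_bound)
  show "integrable lborel (\<lambda>y. B * norm (g y))" using g by simp
  have [measurable]: "g \<in> borel_measurable borel" using borel_measurable_integrable[OF g] by simp
  show "(\<lambda>y. g y *\<^sub>R f (x - y)) \<in> borel_measurable lborel" by measurable
  show "AE y in lborel. norm (g y *\<^sub>R f (x - y)) \<le> norm (B * norm (g y))"
    using B order_trans[OF norm_ge_zero B] by (auto simp: mult.commute[of B] abs_mult intro!: mult_left_mono)
qed

lemma convolution_test_integrable: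
  fixes f :: "'a::euclidean_space \<Rightarrow> 'b::euclidean_space"
  assumes "f \<in> test_functions \<Omega>" "integrable lborel g"
  shows "integrable lborel (\<lambda>y. g y *\<^sub>R f (x - y))"
proof -
  obtain B where "\<And>x. norm (f x) \<le> B" using test_functions_bounded[OF assms(1)] by metis
  then show ?thesis by (intro convolution_integrable[OF test_functions_borel[OF assms(1)] _ assms(2)])
qed

lemma norm_convolution_le:
  fixes f :: "'a::euclidean_space \<Rightarrow> 'b::euclidean_space"
  assumes "f \<in> borel_measurable borel" "\<And>x. norm (f x) \<le> B" "integrable lborel g"
  shows "norm (convolution f g x) \<le> B * (\<integral>y. \<bar>g y\<bar> \<partial>lborel)"
proof -
  have "norm (convolution f g x) \<le> (\<integral>y. norm (g y *\<^sub>R f (x - y)) \<partial>lborel)"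
    unfolding convolution_def by (rule integral_norm_bound)
  also have "\<dots> \<le> (\<integral>y. B * \<bar>g y\<bar> \<partial>lborel)"
    using assms integrable_norm[OF convolution_integrable[OF assms]]
    by (intro integral_mono) (auto simp: mult.commute[of B] intro!: mult_left_mono)
  finally show ?thesis by simp
qed

lemma convolution_has_derivative:
  fixes f :: "'a::euclidean_space \<Rightarrow> 'b::euclidean_space"
  assumes f: "f \<in> test_functions \<Omega>" and g: "integrable lborel g"
  shows "(convolution f g has_derivative (\<lambda>v. convolution (\<partial> v f) g x)) (at x)"
  unfolding has_derivative_at_alt
proof (intro conjI allI impI)
  have sm: "smooth f" using f test_functions_smooth by blast
  have int: "integrable lborel (\<lambda>y. g y *\<^sub>R \<partial> v f (x - y))" for v x
    by (rule convolution_test_integrable[OF test_functions_directional[OF f] g])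
  have "linear (\<lambda>v. convolution (\<partial> v f) g x)"
  proof
    show "convolution (\<partial> (v + w) f) g x = convolution (\<partial> v f) g x + convolution (\<partial> w f) g x" for v w
      unfolding convolution_def linear_add[OF linear_frechet_derivative[OF sm]]
      using int by (simp add: scaleR_add_right)
    show "convolution (\<partial> (r *\<^sub>R v) f) g x = r *\<^sub>R convolution (\<partial> v f) g x" for r v
      unfolding convolution_def linear_cmul[OF linear_frechet_derivative[OF sm]]
      by (simp only: scaleR_left_commute[of _ r] integral_scaleR_right)
  qed
  then show "bounded_linear (\<lambda>v. convolution (\<partial> v f) g x)" by (simp add: linear_conv_bounded_linear)
  fix e :: real assume e: "e > 0"
  define G where "G = (\<integral>y. \<bar>g y\<bar> \<partial>lborel)"
  have G: "G \<ge> 0" unfolding G_def by simp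
  obtain \<delta> where \<delta>: "0 < \<delta>" "\<And>x h. norm h < \<delta> \<Longrightarrow> norm (f (x + h) - f x - \<partial> h f x) \<le> e / (G + 1) * norm h"
    using test_functions_uniformly_differentiable[OF f, of "e / (G + 1)"] e G
    by (metis add_nonneg_pos divide_pos_pos zero_less_one)
  show "\<exists>d>0. \<forall>y. norm (y - x) < d \<longrightarrow>
      norm (convolution f g y - convolution f g x - convolution (\<partial> (y - x) f) g x) \<le> e * norm (y - x)"
  proof (intro exI[of _ \<delta>] conjI \<delta>(1) allI impI)
    fix y assume y: "norm (y - x) < \<delta>"
    define h where "h = y - x"
    have int': "integrable lborel (\<lambda>y. g y *\<^sub>R f (x - y))" for x
      by (rule convolution_test_integrable[OF f g])
    have eq: "convolution f g y - convolution f g x - convolution (\<partial> (y - x) f) g x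
        = (\<integral>z. g z *\<^sub>R (f ((x - z) + h) - f (x - z) - \<partial> h f (x - z)) \<partial>lborel)"
      unfolding convolution_def using int int'
      by (subst Bochner_Integration.integral_diff[symmetric], simp, simp)+
        (simp add: h_def scaleR_diff_right algebra_simps)
    have "norm \<dots> \<le> (\<integral>z. norm (g z *\<^sub>R (f ((x - z) + h) - f (x - z) - \<partial> h f (x - z))) \<partial>lborel)"
      by (rule integral_norm_bound)
    also have "\<dots> \<le> (\<integral>z. \<bar>g z\<bar> * (e / (G + 1) * norm h) \<partial>lborel)"
    proof (rule integral_mono)
      have "integrable lborel (\<lambda>z. g z *\<^sub>R f (x + h - z) - g z *\<^sub>R f (x - z) - g z *\<^sub>R \<partial> h f (x - z))"
        by (intro Bochner_Integration.integrable_diff int int')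
      then show "integrable lborel (\<lambda>z. norm (g z *\<^sub>R (f ((x - z) + h) - f (x - z) - \<partial> h f (x - z))))"
        by (intro integrable_norm) (simp add: scaleR_diff_right algebra_simps)
      show "integrable lborel (\<lambda>z. \<bar>g z\<bar> * (e / (G + 1) * norm h))" using g by simp
      show "norm (g z *\<^sub>R (f ((x - z) + h) - f (x - z) - \<partial> h f (x - z))) \<le> \<bar>g z\<bar> * (e / (G + 1) * norm h)" for z
        unfolding norm_scaleR by (intro mult_left_mono \<delta>(2)) (use y in \<open>auto simp: h_def\<close>)
    qed
    also have "\<dots> = (G / (G + 1)) * (e * norm h)" by (simp add: G_def)
    also have "\<dots> \<le> 1 * (e * norm h)" using G e by (intro mult_right_mono) auto
    finally show "norm (convolution f g y - convolution f g x - convolution (\<partial> (y - x) f) g x) \<le> e * norm (y - x)"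
      unfolding eq by (simp add: h_def)
  qed
qed

lemma directional_convolution:
  assumes "f \<in> test_functions \<Omega>" "integrable lborel g"
  shows "\<partial> v (convolution f g) = convolution (\<partial> v f) g"
  using frechet_derivative_at[OF convolution_has_derivative[OF assms], symmetric] by simp

lemma smooth_convolution:
  fixes f :: "'a::euclidean_space \<Rightarrow> 'b::euclidean_space"
  assumes f: "f \<in> test_functions \<Omega>" and g: "integrable lborel g"
  shows "smooth (convolution f g)"
proof (rule smooth_coinduct[where P="\<lambda>h. \<exists>f::'a \<Rightarrow> 'b. f \<in> test_functions \<Omega> \<and> h = convolution f g"])
  fix h :: "'a \<Rightarrow> 'b" assume "\<exists>f. f \<in> test_functions \<Omega> \<and> h = convolution f g"
  then obtain f :: "'a \<Rightarrow> 'b" where f: "f \<in> test_functions \<Omega>" "h = convolution f g" by blast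
  show "\<exists>h'. (\<forall>x. (h has_derivative h' x) (at x)) \<and>
      (\<forall>v. \<exists>f. f \<in> test_functions \<Omega> \<and> (\<lambda>x. h' x v) = convolution f g)"
  proof (intro exI[of _ "\<lambda>x v. convolution (\<partial> v f) g x"] conjI allI)
    show "(h has_derivative (\<lambda>v. convolution (\<partial> v f) g x)) (at x)" for x
      unfolding f(2) by (rule convolution_has_derivative[OF f(1) g])
    show "\<exists>fa. fa \<in> test_functions \<Omega> \<and> (\<lambda>x. convolution (\<partial> v f) g x) = convolution fa g" for v
      by (intro exI[of _ "\<partial> v f"] conjI test_functions_directional[OF f(1)]) simp
  qed
qed (use f in blast)

lemma convolution_eq_0:
  assumes "\<And>x y. f x \<noteq> 0 \<Longrightarrow> g y \<noteq> 0 \<Longrightarrow> x + y \<noteq> z"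
  shows "convolution f g z = 0"
proof -
  have "(\<lambda>y. g y *\<^sub>R f (z - y)) = (\<lambda>_. 0)" using assms[of "z - _"] by fastforce
  then show ?thesis by (simp add: convolution_def)
qed

text \<open>Evenness is included because it makes mollification a symmetric operator.\<close>

definition mollifier :: "real \<Rightarrow> ('a::euclidean_space \<Rightarrow> real) \<Rightarrow> bool" where
  "mollifier \<epsilon> \<rho> \<longleftrightarrow> \<rho> \<in> test_functions UNIV \<and> (\<forall>x. 0 \<le> \<rho> x) \<and> (\<forall>x. \<rho> (- x) = \<rho> x) \<and>
     (\<forall>x. \<rho> x \<noteq> 0 \<longrightarrow> norm x \<le> \<epsilon>) \<and> (\<integral>x. \<rho> x \<partial>lborel) = 1"

lemma mollifier_exists:
  assumes "\<epsilon> > 0"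
  obtains \<rho> :: "'a::euclidean_space \<Rightarrow> real" where "mollifier \<epsilon> \<rho>"
proof -
  define b where "b = bump (0::'a) (\<epsilon> / 2)"
  have t: "b \<in> test_functions UNIV" unfolding b_def using assms by (intro test_functions_bump) auto
  have b: "b x \<ge> 0" "b (- x) = b x" "norm x \<le> \<epsilon>/2 \<Longrightarrow> b x = 1" for x
    using assms bump_facts(1,3)[where c="0::'a"] by (auto simp: b_def bump_uminus)
  have supp: "norm x \<le> \<epsilon>" if "b x \<noteq> 0" for x
    using bump_facts(4)[of "\<epsilon>/2" "0::'a" x] that assms by (simp add: b_def)
  have int: "integrable lborel b" by (rule test_functions_integrable[OF t])
  define I where "I = (\<integral>x. b x \<partial>lborel)"
  have "I > 0"
  proof -
    have "(\<integral>x. indicator (ball (0::'a) (\<epsilon>/2)) x \<partial>lborel) \<le> I"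
      unfolding I_def
    proof (rule integral_mono[OF _ int])
      show "integrable lborel (indicator (ball (0::'a) (\<epsilon>/2)) :: 'a \<Rightarrow> real)"
        using emeasure_lborel_ball_finite[of "0::'a" "\<epsilon>/2"] by (intro integrable_real_indicator) auto
    qed (use b in \<open>auto simp: indicator_def\<close>)
    moreover have "0 < measure lborel (ball (0::'a) (\<epsilon>/2))"
      using content_ball_pos[of "\<epsilon>/2" "0::'a"] assms by simp
    moreover have "(\<integral>x. indicator (ball (0::'a) (\<epsilon>/2)) x \<partial>lborel) = measure lborel (ball (0::'a) (\<epsilon>/2))"
      by simp
    ultimately show ?thesis by linarith
  qed
  moreover have "(\<lambda>x. b x * (1 / I)) \<in> test_functions UNIV"
    by (rule test_functions_supported_mult[OF t smooth_mult[OF test_functions_smooth[OF t] smooth_const]])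
      simp
  ultimately have "mollifier \<epsilon> (\<lambda>x. b x * (1 / I))"
    unfolding mollifier_def using b supp by (auto simp: I_def[symmetric])
  then show ?thesis by (rule that)
qed

lemma mollifierD:
  assumes "mollifier \<epsilon> \<rho>"
  shows "\<rho> \<in> test_functions UNIV" "0 \<le> \<rho> x" "\<rho> (- x) = \<rho> x" "\<rho> x \<noteq> 0 \<Longrightarrow> norm x \<le> \<epsilon>"
    "(\<integral>x. \<rho> x \<partial>lborel) = 1" "integrable lborel \<rho>"
  using assms test_functions_integrable unfolding mollifier_def by blast+

lemma norm_mollification_le:
  fixes f :: "'a::euclidean_space \<Rightarrow> 'b::euclidean_space"
  assumes "f \<in> borel_measurable borel" "\<And>x. norm (f x) \<le> B" "mollifier \<epsilon> \<rho>"
  shows "norm (convolution f \<rho> x) \<le> B"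
  using norm_convolution_le[OF assms(1,2) mollifierD(6)[OF assms(3)], of x] mollifierD(2,5)[OF assms(3)]
  by simp

lemma lborel_distr_affine:
  assumes "\<bar>c\<bar> = 1"
  shows "distr lborel borel (\<lambda>x::'a::euclidean_space. t + c *\<^sub>R x) = lborel"
  using lborel_affine[of c t] assms by (auto simp: density_1)

lemma integral_reflect:
  fixes f :: "'a::euclidean_space \<Rightarrow> 'b::{banach, second_countable_topology}"
  assumes [measurable]: "f \<in> borel_measurable borel"
  shows "(\<integral>x. f (t - x) \<partial>lborel) = (\<integral>x. f x \<partial>lborel)"
  using integral_distr[of "\<lambda>x. t + (-1) *\<^sub>R x" lborel borel f] lborel_distr_affine[of "-1" t]
  by simp

lemma nn_integral_translate:
  fixes f :: "'a::euclidean_space \<Rightarrow> ennreal"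
  assumes [measurable]: "f \<in> borel_measurable borel"
  shows "(\<integral>\<^sup>+x. f (x + t) \<partial>lborel) = (\<integral>\<^sup>+x. f x \<partial>lborel)"
  using nn_integral_distr[of "\<lambda>x. t + 1 *\<^sub>R x" lborel borel f] lborel_distr_affine[of 1 t]
  by (simp add: add.commute)

lemma integrable_translate:
  fixes f :: "'a::euclidean_space \<Rightarrow> 'b::{banach, second_countable_topology}"
  assumes "integrable lborel f"
  shows "integrable lborel (\<lambda>x. f (x + t))" "integrable lborel (\<lambda>x. f (t - x))"
proof -
  have [measurable]: "f \<in> borel_measurable borel" using borel_measurable_integrable[OF assms] by simp
  show "integrable lborel (\<lambda>x. f (x + t))"
    using integrable_distr[of "\<lambda>x. t + 1 *\<^sub>R x" lborel borel f] lborel_distr_affine[of 1 t] assms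
    by (simp add: add.commute)
  show "integrable lborel (\<lambda>x. f (t - x))"
    using integrable_distr[of "\<lambda>x. t + (-1) *\<^sub>R x" lborel borel f] lborel_distr_affine[of "-1" t] assms
    by simp
qed

lemma convolution_mollifier_eq:
  fixes g \<rho> :: "'a::euclidean_space \<Rightarrow> real"
  assumes [measurable]: "g \<in> borel_measurable borel" "\<rho> \<in> borel_measurable borel"
  shows "convolution \<rho> g x = (\<integral>z. \<rho> z * g (x - z) \<partial>lborel)"
  using integral_reflect[of "\<lambda>z. \<rho> z * g (x - z)" x] by (simp add: convolution_def mult.commute)

text \<open>Since the mollifier is even, mollifying with a shift is adjoint to mollifying with the
  opposite shift.\<close>

lemma convolution_adjoint:
  fixes g h \<rho> :: "'a::euclidean_space \<Rightarrow> real"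
  assumes \<rho>: "mollifier \<epsilon> \<rho>" and g: "integrable lborel g" and h: "integrable lborel h"
  shows "(\<integral>x. convolution \<rho> g (x + s) * h x \<partial>lborel) = (\<integral>y. g y * convolution h \<rho> (y - s) \<partial>lborel)"
proof -
  have [measurable]: "g \<in> borel_measurable borel" "h \<in> borel_measurable borel" "\<rho> \<in> borel_measurable borel"
    using borel_measurable_integrable[OF g] borel_measurable_integrable[OF h]
      test_functions_borel[OF mollifierD(1)[OF \<rho>]] by simp_all
  obtain B where B: "\<And>x. norm (\<rho> x) \<le> B" using test_functions_bounded[OF mollifierD(1)[OF \<rho>]] by metis
  have prd: "integrable (lborel \<Otimes>\<^sub>M lborel) (\<lambda>(x, y). B * (\<bar>h x\<bar> * \<bar>g y\<bar>))"
    using g h by (intro lborel_pair.Fubini_integrable) (auto simp: abs_mult)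
  have "integrable (lborel \<Otimes>\<^sub>M lborel) (\<lambda>(x, y). g y * \<rho> (x + s - y) * h x)"
  proof (rule Bochner_Integration.integrable_bound[OF prd])
    have "\<bar>g y * \<rho> (x + s - y) * h x\<bar> \<le> \<bar>B * (\<bar>h x\<bar> * \<bar>g y\<bar>)\<bar>" for x y
    proof -
      have "\<bar>\<rho> (x + s - y)\<bar> * (\<bar>h x\<bar> * \<bar>g y\<bar>) \<le> B * (\<bar>h x\<bar> * \<bar>g y\<bar>)"
        using B by (intro mult_right_mono) auto
      also have "\<dots> = \<bar>B * (\<bar>h x\<bar> * \<bar>g y\<bar>)\<bar>"
        using order_trans[OF norm_ge_zero B] by (simp add: abs_mult)
      finally show ?thesis by (simp add: abs_mult mult.commute mult.left_commute)
    qed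
    then show "AE p in lborel \<Otimes>\<^sub>M lborel. norm (case p of (x, y) \<Rightarrow> g y * \<rho> (x + s - y) * h x)
        \<le> norm (case p of (x, y) \<Rightarrow> B * (\<bar>h x\<bar> * \<bar>g y\<bar>))"
      by (auto simp: split_beta)
  qed measurable
  from lborel_pair.Fubini_integral[OF this]
  have "(\<integral>x. (\<integral>y. g y * \<rho> (x + s - y) * h x \<partial>lborel) \<partial>lborel) =
      (\<integral>y. (\<integral>x. g y * \<rho> (x + s - y) * h x \<partial>lborel) \<partial>lborel)" by simp
  moreover have "(\<integral>x. \<rho> (x + s - y) * h x \<partial>lborel) = convolution h \<rho> (y - s)" for y
    using integral_reflect[of "\<lambda>x. \<rho> (x + s - y) * h x" "y - s"]
    by (simp add: convolution_def mollifierD(3)[OF \<rho>] algebra_simps)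
  moreover have "(\<integral>x. convolution \<rho> g (x + s) * h x \<partial>lborel) =
      (\<integral>x. (\<integral>y. g y * \<rho> (x + s - y) * h x \<partial>lborel) \<partial>lborel)"
    unfolding convolution_def real_scaleR_def integral_mult_left_zero ..
  ultimately show ?thesis
    by (simp add: mult.assoc)
qed

section \<open>Mollification errors in the Lebesgue spaces\<close>

abbreviation L2_distance2 :: "('a::euclidean_space \<Rightarrow> real) \<Rightarrow> ('a \<Rightarrow> real) \<Rightarrow> ennreal" where
  "L2_distance2 g h \<equiv> (\<integral>\<^sup>+x. ennreal ((g x - h x)\<^sup>2) \<partial>lborel)"

lemma square_sum3_le: "(a + b + c)\<^sup>2 \<le> 3 * (a\<^sup>2 + b\<^sup>2 + (c::real)\<^sup>2)"
  using sum_squares_bound[of a b] sum_squares_bound[of b c] sum_squares_bound[of a c]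
  by (simp add: power2_eq_square algebra_simps)

lemma nn_integral_square_sum3:
  fixes a b c :: "'a \<Rightarrow> real"
  assumes [measurable]: "a \<in> borel_measurable M" "b \<in> borel_measurable M" "c \<in> borel_measurable M"
  shows "(\<integral>\<^sup>+x. ennreal ((a x + b x + c x)\<^sup>2) \<partial>M) \<le>
    3 * ((\<integral>\<^sup>+x. ennreal ((a x)\<^sup>2) \<partial>M) + (\<integral>\<^sup>+x. ennreal ((b x)\<^sup>2) \<partial>M) + (\<integral>\<^sup>+x. ennreal ((c x)\<^sup>2) \<partial>M))"
proof -
  have "(\<integral>\<^sup>+x. ennreal ((a x + b x + c x)\<^sup>2) \<partial>M) \<le>
      (\<integral>\<^sup>+x. 3 * (ennreal ((a x)\<^sup>2) + ennreal ((b x)\<^sup>2) + ennreal ((c x)\<^sup>2)) \<partial>M)"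
  proof (rule nn_integral_mono)
    fix x
    have "ennreal ((a x + b x + c x)\<^sup>2) \<le> ennreal (3 * ((a x)\<^sup>2 + (b x)\<^sup>2 + (c x)\<^sup>2))"
      by (intro ennreal_leI square_sum3_le)
    then show "ennreal ((a x + b x + c x)\<^sup>2) \<le> 3 * (ennreal ((a x)\<^sup>2) + ennreal ((b x)\<^sup>2) + ennreal ((c x)\<^sup>2))"
      by (simp add: ennreal_mult)
  qed
  also have "\<dots> = 3 * ((\<integral>\<^sup>+x. ennreal ((a x)\<^sup>2) \<partial>M) + (\<integral>\<^sup>+x. ennreal ((b x)\<^sup>2) \<partial>M) + (\<integral>\<^sup>+x. ennreal ((c x)\<^sup>2) \<partial>M))"
    by (simp add: nn_integral_cmult nn_integral_add)
  finally show ?thesis .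
qed

definition clamp_real :: "real \<Rightarrow> real \<Rightarrow> real" where
  "clamp_real M t = max (- M) (min M t)"

lemma clamp_real_facts:
  "M \<ge> 0 \<Longrightarrow> \<bar>clamp_real M t\<bar> \<le> M" "\<bar>t\<bar> \<le> M \<Longrightarrow> clamp_real M t = t"
  "M \<ge> 0 \<Longrightarrow> \<bar>t - clamp_real M t\<bar> \<le> \<bar>t\<bar>"
  by (auto simp: clamp_real_def)

lemma continuous_on_clamp_real: "continuous_on S f \<Longrightarrow> continuous_on S (\<lambda>x. clamp_real M (f x))"
  unfolding clamp_real_def by (intro continuous_intros)

lemma borel_clamp_real[measurable (raw)]:
  "f \<in> borel_measurable N \<Longrightarrow> (\<lambda>x. clamp_real M (f x)) \<in> borel_measurable N"
  unfolding clamp_real_def by (intro borel_measurable_max borel_measurable_min borel_measurable_const)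

lemma L2_truncation:
  fixes g :: "'a::euclidean_space \<Rightarrow> real"
  assumes [measurable]: "g \<in> borel_measurable borel" and g: "integrable lborel (\<lambda>x. (g x)\<^sup>2)" and "\<omega> > 0"
  obtains M where "M > 0" "L2_distance2 g (\<lambda>x. indicator (cball 0 M) x * clamp_real M (g x)) \<le> ennreal \<omega>"
proof -
  define h where "h n x = indicator (cball 0 (real (Suc n))) x * clamp_real (real (Suc n)) (g x)" for n x
  have [measurable]: "cball (0::'a) r \<in> sets borel" for r by simp
  have [measurable]: "h n \<in> borel_measurable borel" for n unfolding h_def by measurable
  have le: "(g x - h n x)\<^sup>2 \<le> (g x)\<^sup>2" for n x
  proof -
    have "\<bar>g x - h n x\<bar> \<le> \<bar>g x\<bar>"
      unfolding h_def by (cases "x \<in> cball 0 (real (Suc n))") (auto simp del: of_nat_Suc intro: clamp_real_facts)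
    then show ?thesis by (simp add: abs_le_square_iff)
  qed
  have "(\<lambda>n. \<integral>x. (g x - h n x)\<^sup>2 \<partial>lborel) \<longlonglongrightarrow> integral\<^sup>L lborel (\<lambda>x::'a. 0::real)"
  proof (rule integral_dominated_convergence[where w="\<lambda>x. (g x)\<^sup>2"])
    show "AE x in lborel. (\<lambda>n. (g x - h n x)\<^sup>2) \<longlonglongrightarrow> 0"
    proof (intro AE_I2 tendsto_eventually)
      fix x
      have "\<forall>\<^sub>F n in sequentially. max (norm x) \<bar>g x\<bar> \<le> real (Suc n)"
      proof -
        obtain N where "max (norm x) \<bar>g x\<bar> \<le> real N" using real_arch_simple by blast
        then show ?thesis by (intro eventually_sequentiallyI[of N]) auto
      qed
      then show "\<forall>\<^sub>F n in sequentially. (g x - h n x)\<^sup>2 = 0"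
        by eventually_elim (simp add: h_def clamp_real_facts)
    qed
  qed (use g le in auto)
  then have "(\<lambda>n. \<integral>x. (g x - h n x)\<^sup>2 \<partial>lborel) \<longlonglongrightarrow> 0" by simp
  from order_tendstoD(2)[OF this \<open>\<omega> > 0\<close>]
  obtain n where n: "(\<integral>x. (g x - h n x)\<^sup>2 \<partial>lborel) < \<omega>"
    by (auto simp: eventually_sequentially)
  have "integrable lborel (\<lambda>x. (g x - h n x)\<^sup>2)"
    by (rule Bochner_Integration.integrable_bound[OF g]) (use le in auto)
  then have "L2_distance2 g (h n) = ennreal (\<integral>x. (g x - h n x)\<^sup>2 \<partial>lborel)"
    by (intro nn_integral_eq_integral) auto
  with n show ?thesis
    by (intro that[of "real (Suc n)"]) (auto simp: h_def intro: ennreal_leI)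
qed

text \<open>A bounded function that vanishes outside a ball is an almost everywhere limit of continuous
  functions; clamping and cutting these off makes the convergence dominated.\<close>

lemma L2_continuous_approximation:
  fixes g :: "'a::euclidean_space \<Rightarrow> real"
  assumes [measurable]: "g \<in> borel_measurable borel" and g: "integrable lborel (\<lambda>x. (g x)\<^sup>2)" and "\<omega> > 0"
  obtains c K where "continuous_on UNIV c" "compact K" "\<And>x. x \<notin> K \<Longrightarrow> c x = 0"
    "L2_distance2 g c \<le> ennreal \<omega>"
proof -
  obtain M where M: "M > 0"
    "L2_distance2 g (\<lambda>x. indicator (cball 0 M) x * clamp_real M (g x)) \<le> ennreal (\<omega> / 6)"
    using L2_truncation[OF assms(1) g, of "\<omega> / 6"] \<open>\<omega> > 0\<close> by auto
  define h where "h x = indicator (cball 0 M) x * clamp_real M (g x)" for x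
  have [measurable]: "cball (0::'a) r \<in> sets borel" for r by simp
  have [measurable]: "h \<in> borel_measurable borel" unfolding h_def[abs_def] by measurable
  have h: "\<bar>h x\<bar> \<le> M" "norm x > M \<Longrightarrow> h x = 0" for x
    using M(1) by (auto simp: h_def clamp_real_facts indicator_def)
  have "h \<in> borel_measurable lebesgue" by (simp add: measurable_completion)
  then have "h measurable_on UNIV"
    using lebesgue_measurable_imp_measurable_on[of h UNIV] by auto
  then obtain N a where N: "negligible N" and a: "\<And>n. continuous_on UNIV (a n)"
      "\<And>x. x \<notin> N \<Longrightarrow> (\<lambda>n. a n x) \<longlonglongrightarrow> h x"
    unfolding measurable_on_def by auto
  define c where "c n x = bump 0 M x * clamp_real M (a n x)" for n x
  have c: "continuous_on UNIV (c n)" "\<bar>c n x\<bar> \<le> M" "norm x > 3/2 * M \<Longrightarrow> c n x = 0" for n x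
  proof -
    show "continuous_on UNIV (c n)"
      unfolding c_def by (intro continuous_intros continuous_on_clamp_real a smooth_continuous smooth_bump)
    show "norm x > 3/2 * M \<Longrightarrow> c n x = 0" using bump_facts(4)[of M 0 x] M(1) by (force simp: c_def)
    have "\<bar>bump 0 M x\<bar> * \<bar>clamp_real M (a n x)\<bar> \<le> 1 * M"
      using M(1) by (intro mult_mono clamp_real_facts) (auto simp: bump_facts)
    then show "\<bar>c n x\<bar> \<le> M" by (simp add: c_def abs_mult)
  qed
  have [measurable]: "c n \<in> borel_measurable borel" for n using c by (intro borel_measurable_continuous_onI)
  have bound: "(h x - c n x)\<^sup>2 \<le> 4 * M\<^sup>2 * indicator (cball 0 (3/2 * M)) x" for n x
  proof (cases "x \<in> cball 0 (3/2 * M)")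
    case True
    have "\<bar>h x - c n x\<bar> \<le> 2 * M" using h(1)[of x] c(2)[of n x] by linarith
    then have "\<bar>h x - c n x\<bar> \<le> \<bar>2 * M\<bar>" using M(1) by simp
    then have "(h x - c n x)\<^sup>2 \<le> (2 * M)\<^sup>2" by (rule abs_le_square_iff[THEN iffD1])
    then show ?thesis using True by simp
  qed (use h(2)[of x] c(3)[of x n] M(1) in auto)
  have dom: "integrable lborel (\<lambda>x. 4 * M\<^sup>2 * indicator (cball (0::'a) (3/2 * M)) x)"
    using emeasure_lborel_cball_finite[of "0::'a" "3/2 * M"]
    by (intro integrable_mult_right integrable_real_indicator) auto
  have "(\<lambda>n. \<integral>x. (h x - c n x)\<^sup>2 \<partial>lborel) \<longlonglongrightarrow> integral\<^sup>L lborel (\<lambda>x::'a. 0::real)"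
  proof (rule integral_dominated_convergence[OF _ _ dom])
    have "AE x in lebesgue. x \<notin> N" using N by (simp add: negligible_iff_null_sets AE_not_in)
    then have "AE x in lebesgue. (\<lambda>n. (h x - c n x)\<^sup>2) \<longlonglongrightarrow> 0"
    proof eventually_elim
      case (elim x)
      have "isCont (clamp_real M) (h x)"
        using continuous_on_clamp_real[OF continuous_on_id, of UNIV M]
        by (simp add: continuous_on_eq_continuous_at)
      then have "(\<lambda>n. h x - c n x) \<longlonglongrightarrow> h x - bump 0 M x * clamp_real M (h x)"
        unfolding c_def by (intro tendsto_intros isCont_tendsto_compose[of _ "clamp_real M"] a(2) elim)
      moreover have "bump 0 M x * clamp_real M (h x) = h x"
        using h(1)[of x] h(2)[of x] bump_facts(3)[of M x 0] M(1)
        by (cases "norm x \<le> M") (auto simp: clamp_real_facts)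
      ultimately have "(\<lambda>n. h x - c n x) \<longlonglongrightarrow> 0" by simp
      from tendsto_power[OF this, of 2] show ?case by simp
    qed
    then show "AE x in lborel. (\<lambda>n. (h x - c n x)\<^sup>2) \<longlonglongrightarrow> 0"
      by (simp add: AE_completion_iff)
    show "AE x in lborel. norm ((h x - c n x)\<^sup>2) \<le> 4 * M\<^sup>2 * indicator (cball 0 (3/2 * M)) x" for n
      using bound by simp
  qed auto
  then have "(\<lambda>n. \<integral>x. (h x - c n x)\<^sup>2 \<partial>lborel) \<longlonglongrightarrow> 0" by simp
  moreover have "\<omega> / 6 > 0" using \<open>\<omega> > 0\<close> by simp
  ultimately obtain n where n: "(\<integral>x. (h x - c n x)\<^sup>2 \<partial>lborel) < \<omega> / 6"
    using order_tendstoD(2) by (metis (no_types, lifting) eventually_sequentially order_refl)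
  have "integrable lborel (\<lambda>x. (h x - c n x)\<^sup>2)"
  proof (rule Bochner_Integration.integrable_bound[OF dom])
    have "norm ((h x - c n x)\<^sup>2) \<le> norm (4 * M\<^sup>2 * indicator (cball 0 (3/2 * M)) x)" for x
      using bound[of x n] by (simp add: abs_mult)
    then show "AE x in lborel. norm ((h x - c n x)\<^sup>2) \<le> norm (4 * M\<^sup>2 * indicator (cball 0 (3/2 * M)) x)"
      by simp
  qed simp
  then have hc: "L2_distance2 h (c n) \<le> ennreal (\<omega> / 6)"
    using n by (subst nn_integral_eq_integral) (auto intro: ennreal_leI)
  have "L2_distance2 g (c n) = (\<integral>\<^sup>+x. ennreal (((g x - h x) + (h x - c n x) + 0)\<^sup>2) \<partial>lborel)" by simp
  also have "\<dots> \<le> 3 * (L2_distance2 g h + L2_distance2 h (c n) + integral\<^sup>N lborel (\<lambda>x::'a. ennreal (0\<^sup>2)))"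
    by (intro nn_integral_square_sum3) measurable
  also have "\<dots> \<le> 3 * (ennreal (\<omega> / 6) + ennreal (\<omega> / 6) + 0)"
    using M(2) hc by (intro mult_left_mono add_mono) (auto simp: h_def[abs_def])
  also have "\<dots> = ennreal \<omega>"
    using \<open>\<omega> > 0\<close> by (simp add: ennreal_plus[symmetric] ennreal_mult[symmetric] flip: ennreal_numeral del: ennreal_plus)
  finally show ?thesis
    using c by (intro that[of "c n" "cball 0 (3/2 * M)"]) auto
qed

text \<open>Clear for uniformly continuous functions of compact support, and inherited by their \<open>L\<^sup>2\<close>
  closure: the three errors of size \<open>\<omega> / 9\<close> are added at the cost of a factor 3.\<close>

lemma L2_translation_continuous:
  fixes g :: "'a::euclidean_space \<Rightarrow> real"
  assumes [measurable]: "g \<in> borel_measurable borel" and g: "integrable lborel (\<lambda>x. (g x)\<^sup>2)" and "\<omega> > 0"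
  obtains \<delta> where "\<delta> > 0" "\<And>v. norm v < \<delta> \<Longrightarrow> L2_distance2 (\<lambda>x. g (x + v)) g \<le> ennreal \<omega>"
proof -
  obtain c K where c: "continuous_on UNIV c" "compact K" "\<And>x. x \<notin> K \<Longrightarrow> c x = 0"
    "L2_distance2 g c \<le> ennreal (\<omega> / 9)"
    using L2_continuous_approximation[OF assms(1) g, of "\<omega> / 9"] \<open>\<omega> > 0\<close> by auto
  have [measurable]: "c \<in> borel_measurable borel" using c by (intro borel_measurable_continuous_onI)
  define K' where "K' = {x + y | x y. x \<in> K \<and> y \<in> cball (0::'a) 1}"
  have K': "compact K'" unfolding K'_def using c(2) by (rule compact_plus_cball)
  define m where "m = measure lborel K'"
  have em: "emeasure lborel K' = ennreal m"
    using emeasure_compact_finite[OF K'] unfolding m_def by (simp add: emeasure_eq_ennreal_measure)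
  have m: "m \<ge> 0" unfolding m_def by simp
  define \<eta> where "\<eta> = sqrt (\<omega> / (9 * (m + 1)))"
  have \<eta>: "\<eta> > 0" "\<eta>\<^sup>2 * m \<le> \<omega> / 9"
  proof -
    show "\<eta> > 0" using \<open>\<omega> > 0\<close> m by (simp add: \<eta>_def)
    have "\<eta>\<^sup>2 * m = (\<omega> / 9) * (m / (m + 1))" using \<open>\<omega> > 0\<close> m by (simp add: \<eta>_def)
    also have "\<dots> \<le> (\<omega> / 9) * 1" using \<open>\<omega> > 0\<close> m by (intro mult_left_mono) auto
    finally show "\<eta>\<^sup>2 * m \<le> \<omega> / 9" by simp
  qed
  obtain \<delta> where \<delta>: "0 < \<delta>" "\<delta> \<le> 1" "\<And>x h. norm h < \<delta> \<Longrightarrow> norm (c (x + h) - c x) \<le> \<eta>"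
    using compact_support_uniformly_continuous[OF c(1-3) \<eta>(1)] by metis
  show ?thesis
  proof (rule that[OF \<delta>(1)])
    fix v :: 'a assume v: "norm v < \<delta>"
    have "L2_distance2 (\<lambda>x. c (x + v)) c \<le> (\<integral>\<^sup>+x. ennreal (\<eta>\<^sup>2) * indicator K' x \<partial>lborel)"
    proof (rule nn_integral_mono)
      fix x
      have "\<bar>c (x + v) - c x\<bar> \<le> \<bar>\<eta>\<bar>" using \<delta>(3)[OF v, of x] \<eta>(1) by simp
      then have "(c (x + v) - c x)\<^sup>2 \<le> \<eta>\<^sup>2" by (rule abs_le_square_iff[THEN iffD1])
      moreover have "c (x + v) = 0" "c x = 0" if "x \<notin> K'"
      proof -
        have "y + z \<in> K'" if "y \<in> K" "norm z \<le> 1" for y z unfolding K'_def using that by auto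
        from this[of x 0] this[of "x + v" "- v"] that v \<delta>(2) show "c (x + v) = 0" "c x = 0"
          by (auto intro!: c(3))
      qed
      ultimately show "ennreal ((c (x + v) - c x)\<^sup>2) \<le> ennreal (\<eta>\<^sup>2) * indicator K' x"
        by (cases "x \<in> K'") (auto intro: ennreal_leI)
    qed
    also have "\<dots> = ennreal (\<eta>\<^sup>2 * m)"
      using K' m by (subst nn_integral_cmult_indicator) (auto simp: em ennreal_mult borel_compact)
    also have "\<dots> \<le> ennreal (\<omega> / 9)" using \<eta>(2) by (rule ennreal_leI)
    finally have cc: "L2_distance2 (\<lambda>x. c (x + v)) c \<le> ennreal (\<omega> / 9)" .
    have "L2_distance2 (\<lambda>x. g (x + v)) g =
        (\<integral>\<^sup>+x. ennreal (((g (x + v) - c (x + v)) + (c (x + v) - c x) + (c x - g x))\<^sup>2) \<partial>lborel)" by simp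
    also have "\<dots> \<le> 3 * (L2_distance2 (\<lambda>x. g (x + v)) (\<lambda>x. c (x + v)) +
        L2_distance2 (\<lambda>x. c (x + v)) c + L2_distance2 c g)"
      by (intro nn_integral_square_sum3) measurable
    also have "L2_distance2 (\<lambda>x. g (x + v)) (\<lambda>x. c (x + v)) = L2_distance2 g c"
      using nn_integral_translate[of "\<lambda>x. ennreal ((g x - c x)\<^sup>2)" v] by simp
    also have "L2_distance2 c g = L2_distance2 g c" by (simp add: power2_commute)
    also have "3 * (L2_distance2 g c + L2_distance2 (\<lambda>x. c (x + v)) c + L2_distance2 g c) \<le>
        3 * (ennreal (\<omega> / 9) + ennreal (\<omega> / 9) + ennreal (\<omega> / 9))"
      by (intro mult_left_mono add_mono c(4) cc) auto
    also have "\<dots> = ennreal \<omega>"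
      using \<open>\<omega> > 0\<close> by (simp add: ennreal_plus[symmetric] ennreal_mult[symmetric] flip: ennreal_numeral del: ennreal_plus)
    finally show "L2_distance2 (\<lambda>x. g (x + v)) g \<le> ennreal \<omega>" .
  qed
qed

text \<open>A mollification averages translates; so by Jensen's inequality it is as close to the function
  as the translates are. The pointwise Jensen inequality is a hypothesis, to cover both the square
  and the absolute value as \<open>\<psi>\<close>.\<close>

lemma mollification_error_aux:
  fixes g \<rho> :: "'a::euclidean_space \<Rightarrow> real" and \<psi> :: "real \<Rightarrow> real"
  assumes \<rho>: "mollifier \<epsilon> \<rho>" and [measurable]: "g \<in> borel_measurable borel" "\<psi> \<in> borel_measurable borel"
    and jensen: "\<And>x. ennreal (\<psi> (\<integral>z. \<rho> z * (g (x + s - z) - g x) \<partial>lborel)) \<le>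
        (\<integral>\<^sup>+z. ennreal (\<rho> z) * ennreal (\<psi> (g (x + s - z) - g x)) \<partial>lborel)"
    and int: "\<And>x. integrable lborel (\<lambda>z. \<rho> z * g (x - z))"
    and close: "\<And>v. norm v \<le> norm s + \<epsilon> \<Longrightarrow> (\<integral>\<^sup>+x. ennreal (\<psi> (g (x + v) - g x)) \<partial>lborel) \<le> \<omega>"
  shows "(\<integral>\<^sup>+x. ennreal (\<psi> (convolution \<rho> g (x + s) - g x)) \<partial>lborel) \<le> \<omega>"
proof -
  have [measurable]: "\<rho> \<in> borel_measurable borel"
    using test_functions_borel[OF mollifierD(1)[OF \<rho>]] .
  have "convolution \<rho> g (x + s) - g x = (\<integral>z. \<rho> z * (g (x + s - z) - g x) \<partial>lborel)" for x
    using int mollifierD(6)[OF \<rho>] mollifierD(5)[OF \<rho>]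
    by (simp add: convolution_mollifier_eq right_diff_distrib)
  then have "(\<integral>\<^sup>+x. ennreal (\<psi> (convolution \<rho> g (x + s) - g x)) \<partial>lborel) \<le>
      (\<integral>\<^sup>+x. (\<integral>\<^sup>+z. ennreal (\<rho> z) * ennreal (\<psi> (g (x + s - z) - g x)) \<partial>lborel) \<partial>lborel)"
    using jensen by (intro nn_integral_mono) simp
  also have "\<dots> = (\<integral>\<^sup>+z. (\<integral>\<^sup>+x. ennreal (\<rho> z) * ennreal (\<psi> (g (x + s - z) - g x)) \<partial>lborel) \<partial>lborel)"
    by (rule lborel_pair.Fubini') measurable
  also have "\<dots> \<le> (\<integral>\<^sup>+z. ennreal (\<rho> z) * \<omega> \<partial>lborel)"
  proof (rule nn_integral_mono)
    fix z
    show "(\<integral>\<^sup>+x. ennreal (\<rho> z) * ennreal (\<psi> (g (x + s - z) - g x)) \<partial>lborel) \<le> ennreal (\<rho> z) * \<omega>"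
    proof (cases "\<rho> z = 0")
      case False
      have "norm (s - z) \<le> norm s + \<epsilon>"
        using norm_triangle_ineq4[of s z] mollifierD(4)[OF \<rho> False] by linarith
      from close[OF this] show ?thesis
        by (simp add: nn_integral_cmult add_diff_eq mult_left_mono)
    qed simp
  qed
  also have "\<dots> = \<omega>"
    using nn_integral_eq_integral[OF mollifierD(6)[OF \<rho>]] mollifierD(2,5)[OF \<rho>]
    by (simp add: nn_integral_multc)
  finally show ?thesis .
qed

lemma L1_mollification_error:
  fixes g \<rho> :: "'a::euclidean_space \<Rightarrow> real"
  assumes \<rho>: "mollifier \<epsilon> \<rho>" and g: "integrable lborel g"
    and close: "\<And>v. norm v \<le> \<epsilon> \<Longrightarrow> (\<integral>\<^sup>+x. ennreal \<bar>g (x + v) - g x\<bar> \<partial>lborel) \<le> \<omega>"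
  shows "(\<integral>\<^sup>+x. ennreal \<bar>convolution \<rho> g x - g x\<bar> \<partial>lborel) \<le> \<omega>"
proof -
  have gm[measurable]: "g \<in> borel_measurable borel" using borel_measurable_integrable[OF g] by simp
  have \<rho>m[measurable]: "\<rho> \<in> borel_measurable borel" by (rule test_functions_borel[OF mollifierD(1)[OF \<rho>]])
  obtain B where B: "\<And>x. norm (\<rho> x) \<le> B" using test_functions_bounded[OF mollifierD(1)[OF \<rho>]] by metis
  have int: "integrable lborel (\<lambda>z. \<rho> z * g (x - z))" for x
    using integrable_translate(2)[OF convolution_integrable[OF \<rho>m B g, of x], of x]
    by (simp add: mult.commute)
  have "(\<integral>\<^sup>+x. ennreal \<bar>convolution \<rho> g (x + 0) - g x\<bar> \<partial>lborel) \<le> \<omega>"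
  proof (rule mollification_error_aux[OF \<rho> gm _ _ int])
    fix x
    have "integrable lborel (\<lambda>z. \<rho> z * (g (x + 0 - z) - g x))"
      using int mollifierD(6)[OF \<rho>] by (simp add: right_diff_distrib)
    from integral_norm_bound_ennreal[OF this]
    show "ennreal \<bar>\<integral>z. \<rho> z * (g (x + 0 - z) - g x) \<partial>lborel\<bar> \<le>
        (\<integral>\<^sup>+z. ennreal (\<rho> z) * ennreal \<bar>g (x + 0 - z) - g x\<bar> \<partial>lborel)"
      using mollifierD(2)[OF \<rho>] by (simp add: abs_mult ennreal_mult')
  qed (use close in auto)
  then show ?thesis by simp
qed

text \<open>The variance of \<open>a\<close> under the probability density \<open>\<rho>\<close> is nonnegative.\<close>

lemma square_integral_le:
  fixes a \<rho> :: "'a \<Rightarrow> real"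
  assumes "integrable M \<rho>" "integrable M (\<lambda>z. \<rho> z * a z)" "integrable M (\<lambda>z. \<rho> z * (a z)\<^sup>2)"
    and "\<And>z. 0 \<le> \<rho> z" "(\<integral>z. \<rho> z \<partial>M) = 1"
  shows "(\<integral>z. \<rho> z * a z \<partial>M)\<^sup>2 \<le> (\<integral>z. \<rho> z * (a z)\<^sup>2 \<partial>M)"
proof -
  define m where "m = (\<integral>z. \<rho> z * a z \<partial>M)"
  have "0 \<le> (\<integral>z. \<rho> z * (a z - m)\<^sup>2 \<partial>M)" using assms(4) by (intro integral_nonneg_AE) simp
  also have "\<dots> = (\<integral>z. \<rho> z * (a z)\<^sup>2 - 2 * m * (\<rho> z * a z) + m\<^sup>2 * \<rho> z \<partial>M)"
    by (intro Bochner_Integration.integral_cong refl) (simp add: power2_eq_square algebra_simps)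
  also have "\<dots> = (\<integral>z. \<rho> z * (a z)\<^sup>2 \<partial>M) - 2 * m * m + m\<^sup>2"
    using assms by (simp add: m_def)
  finally show ?thesis by (simp add: m_def power2_eq_square)
qed

lemma L2_mollification_error:
  fixes g \<rho> :: "'a::euclidean_space \<Rightarrow> real"
  assumes \<rho>: "mollifier \<epsilon> \<rho>" and g: "integrable lborel g" and g2: "integrable lborel (\<lambda>x. (g x)\<^sup>2)"
    and close: "\<And>v. norm v \<le> norm s + \<epsilon> \<Longrightarrow> L2_distance2 (\<lambda>x. g (x + v)) g \<le> \<omega>"
  shows "L2_distance2 (\<lambda>x. convolution \<rho> g (x + s)) g \<le> \<omega>"
proof -
  have gm[measurable]: "g \<in> borel_measurable borel" using borel_measurable_integrable[OF g] by simp
  have \<rho>m[measurable]: "\<rho> \<in> borel_measurable borel" by (rule test_functions_borel[OF mollifierD(1)[OF \<rho>]])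
  obtain B where B: "\<And>x. norm (\<rho> x) \<le> B" using test_functions_bounded[OF mollifierD(1)[OF \<rho>]] by metis
  have int: "integrable lborel (\<lambda>z. \<rho> z * g (x - z))" "integrable lborel (\<lambda>z. \<rho> z * (g (x - z))\<^sup>2)" for x
    using integrable_translate(2)[OF convolution_integrable[OF \<rho>m B g, of x], of x]
      integrable_translate(2)[OF convolution_integrable[OF \<rho>m B g2, of x], of x]
    by (simp_all add: mult.commute)
  show ?thesis
  proof (rule mollification_error_aux[OF \<rho> gm _ _ int(1)])
    fix x
    have i1: "integrable lborel (\<lambda>z. \<rho> z * (g (x + s - z) - g x))"
      using int mollifierD(6)[OF \<rho>] by (simp add: right_diff_distrib)
    have "integrable lborel (\<lambda>z. \<rho> z * (g (x + s - z))\<^sup>2 - 2 * g x * (\<rho> z * g (x + s - z)) + (g x)\<^sup>2 * \<rho> z)"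
      by (intro Bochner_Integration.integrable_add Bochner_Integration.integrable_diff integrable_mult_right int mollifierD(6)[OF \<rho>])
    then have i2: "integrable lborel (\<lambda>z. \<rho> z * (g (x + s - z) - g x)\<^sup>2)"
      by (rule back_subst[of "integrable lborel"]) (simp add: power2_eq_square algebra_simps)
    have "ennreal ((\<integral>z. \<rho> z * (g (x + s - z) - g x) \<partial>lborel)\<^sup>2) \<le>
        ennreal (\<integral>z. \<rho> z * (g (x + s - z) - g x)\<^sup>2 \<partial>lborel)"
      by (intro ennreal_leI square_integral_le i1 i2 mollifierD[OF \<rho>])
    also have "\<dots> = (\<integral>\<^sup>+z. ennreal (\<rho> z * (g (x + s - z) - g x)\<^sup>2) \<partial>lborel)"
      using mollifierD(2)[OF \<rho>] by (intro nn_integral_eq_integral[symmetric] i2) auto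
    also have "\<dots> = (\<integral>\<^sup>+z. ennreal (\<rho> z) * ennreal ((g (x + s - z) - g x)\<^sup>2) \<partial>lborel)"
      using mollifierD(2)[OF \<rho>] by (simp add: ennreal_mult)
    finally show "ennreal ((\<integral>z. \<rho> z * (g (x + s - z) - g x) \<partial>lborel)\<^sup>2) \<le> \<dots>" .
  qed (use close in auto)
qed

section \<open>Integration by parts\<close>

lemma lebesgue_on_open:
  fixes \<Omega> :: "'a::euclidean_space set"
  assumes "open \<Omega>"
  shows nn_integral_lebesgue_on: "(\<integral>\<^sup>+x. h x \<partial>lebesgue_on \<Omega>) = (\<integral>\<^sup>+x. h x * indicator \<Omega> x \<partial>lborel)"
    and integral_lebesgue_on: "(f :: 'a \<Rightarrow> 'b::{banach, second_countable_topology}) \<in> borel_measurable borel \<Longrightarrow>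
      (\<integral>x. f x \<partial>lebesgue_on \<Omega>) = (\<integral>x. indicator \<Omega> x *\<^sub>R f x \<partial>lborel)"
    and integrable_lebesgue_on: "(f :: 'a \<Rightarrow> 'b) \<in> borel_measurable borel \<Longrightarrow>
      integrable (lebesgue_on \<Omega>) f \<longleftrightarrow> integrable lborel (\<lambda>x. indicator \<Omega> x *\<^sub>R f x)"
    and AE_lebesgue_on: "(AE x in lebesgue_on \<Omega>. P x) \<longleftrightarrow> (AE x in lborel. x \<in> \<Omega> \<longrightarrow> P x)"
proof -
  have [measurable]: "\<Omega> \<in> sets borel" using assms by simp
  show "(\<integral>\<^sup>+x. h x \<partial>lebesgue_on \<Omega>) = (\<integral>\<^sup>+x. h x * indicator \<Omega> x \<partial>lborel)"
    by (simp add: nn_integral_restrict_space nn_integral_completion)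
  show "(AE x in lebesgue_on \<Omega>. P x) \<longleftrightarrow> (AE x in lborel. x \<in> \<Omega> \<longrightarrow> P x)"
    by (simp add: AE_restrict_space_iff AE_completion_iff)
  assume [measurable]: "f \<in> borel_measurable borel"
  show "(\<integral>x. f x \<partial>lebesgue_on \<Omega>) = (\<integral>x. indicator \<Omega> x *\<^sub>R f x \<partial>lborel)"
    by (simp add: integral_restrict_space integral_completion)
  show "integrable (lebesgue_on \<Omega>) f \<longleftrightarrow> integrable lborel (\<lambda>x. indicator \<Omega> x *\<^sub>R f x)"
    by (simp add: integrable_restrict_space integrable_completion)
qed

lemma lebesgue_on_measurable:
  fixes h :: "'a::euclidean_space \<Rightarrow> 'b::topological_space"
  shows "h \<in> borel_measurable borel \<Longrightarrow> h \<in> borel_measurable (lebesgue_on \<Omega>)"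
  by (intro measurable_restrict_space1 measurable_completion) simp

lemma test_functions_eq_0:
  assumes "f \<in> test_functions \<Omega>" "x \<notin> \<Omega>"
  shows "f x = 0"
  by (rule test_functionsE[OF assms(1)]) (use assms(2) in blast)

lemma integrable_mult_bounded:
  fixes u f :: "'a \<Rightarrow> real"
  assumes u: "integrable M u" and f: "f \<in> borel_measurable M" "\<And>x. \<bar>f x\<bar> \<le> B"
  shows "integrable M (\<lambda>x. u x * f x)"
proof (rule Bochner_Integration.integrable_bound)
  show "integrable M (\<lambda>x. B * u x)" using u by simp
  show "(\<lambda>x. u x * f x) \<in> borel_measurable M"
    by (intro borel_measurable_times borel_measurable_integrable[OF u] f)
  show "AE x in M. norm (u x * f x) \<le> norm (B * u x)"
    using f(2) order_trans[OF abs_ge_zero f(2)] by (auto simp: abs_mult mult.commute[of B] intro!: mult_left_mono)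
qed

lemma integrable_mult_test_function:
  fixes u f :: "'a::euclidean_space \<Rightarrow> real"
  assumes f: "f \<in> test_functions S"
  shows "integrable lborel u \<Longrightarrow> integrable lborel (\<lambda>x. u x * f x)"
    and "integrable (lebesgue_on \<Omega>) u \<Longrightarrow> integrable (lebesgue_on \<Omega>) (\<lambda>x. u x * f x)"
proof -
  obtain B where B: "\<And>x. norm (f x) \<le> B" using test_functions_bounded[OF f] by metis
  show "integrable lborel u \<Longrightarrow> integrable lborel (\<lambda>x. u x * f x)"
    using B test_functions_borel[OF f] by (intro integrable_mult_bounded[of _ _ _ B]) auto
  show "integrable (lebesgue_on \<Omega>) u \<Longrightarrow> integrable (lebesgue_on \<Omega>) (\<lambda>x. u x * f x)"
    using B lebesgue_on_measurable[OF test_functions_borel[OF f]] by (intro integrable_mult_bounded[of _ _ _ B]) auto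
qed

lemma integral_lebesgue_on_supported:
  fixes f :: "'a::euclidean_space \<Rightarrow> 'b::{banach, second_countable_topology}"
  assumes "open \<Omega>" "f \<in> borel_measurable borel" "\<And>x. x \<notin> \<Omega> \<Longrightarrow> f x = 0"
  shows "(\<integral>x. f x \<partial>lebesgue_on \<Omega>) = (\<integral>x. f x \<partial>lborel)"
proof -
  have "(\<lambda>x. indicator \<Omega> x *\<^sub>R f x) = f" using assms(3) by (auto simp: indicator_def)
  then show ?thesis using assms by (simp add: integral_lebesgue_on)
qed

text \<open>The convolution of \<open>f\<close> with the indicator of a large ball is constant near the origin, and its
  derivative there is the integral of the derivative of \<open>f\<close>.\<close>

lemma integral_directional_eq_0:
  fixes f :: "'a::euclidean_space \<Rightarrow> 'b::euclidean_space"
  assumes f: "f \<in> test_functions \<Omega>"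
  shows "(\<integral>x. \<partial> v f x \<partial>lborel) = 0"
proof -
  obtain K where K: "compact K" "\<And>x. x \<notin> K \<Longrightarrow> f x = 0" "\<And>x v. x \<notin> K \<Longrightarrow> \<partial> v f x = 0"
    using test_functionsE[OF f] by metis
  obtain R where R: "\<And>x. x \<in> K \<Longrightarrow> norm x < R" using compact_imp_bounded[OF K(1)] bounded_iff
    by (metis gt_ex le_less_trans)
  define g where "g = (indicator (ball (0::'a) (R + 1)) :: 'a \<Rightarrow> real)"
  have g: "integrable lborel g" unfolding g_def
    using emeasure_lborel_ball_finite[of "0::'a" "R + 1"] by (intro integrable_real_indicator) auto
  have conv: "convolution h g x = (\<integral>y. h y \<partial>lborel)"
    if h: "h \<in> borel_measurable borel" "\<And>x. x \<notin> K \<Longrightarrow> h x = 0" and x: "norm x < 1" for h :: "'a \<Rightarrow> 'b" and x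
  proof -
    have "g y *\<^sub>R h (x - y) = h (x - y)" for y
    proof (cases "x - y \<in> K")
      case True
      have "norm y < R + 1" using R[OF True] x norm_triangle_sub[of y x] by (simp add: norm_minus_commute)
      then show ?thesis by (simp add: g_def)
    qed (use h in simp)
    then show ?thesis using integral_reflect[OF h(1), of x] by (simp add: convolution_def)
  qed
  have "((\<lambda>x. \<integral>y. f y \<partial>lborel) has_derivative (\<lambda>_. 0)) (at 0)" by simp
  then have "(convolution f g has_derivative (\<lambda>_. 0)) (at 0)"
    by (rule has_derivative_transform_within_open[of _ _ _ _ "ball 0 1"])
      (use conv[OF test_functions_borel[OF f] K(2)] in auto)
  from has_derivative_unique[OF this convolution_has_derivative[OF f g]]
  have "convolution (\<partial> v f) g 0 = 0" by metis
  with conv[OF test_functions_borel[OF test_functions_directional[OF f]] K(3), of 0] show ?thesis by simp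
qed

definition gradient :: "('a::euclidean_space \<Rightarrow> real) \<Rightarrow> 'a \<Rightarrow> 'a" where
  "gradient w x = (\<Sum>b\<in>Basis. \<partial> b w x *\<^sub>R b)"

lemma smooth_gradient: "smooth w \<Longrightarrow> smooth (gradient w)"
  unfolding gradient_def by (intro smooth_sum smooth_scaleR smooth_directional smooth_const)

lemma test_functions_gradient:
  fixes w :: "'a::euclidean_space \<Rightarrow> real"
  assumes "w \<in> test_functions S"
  shows "gradient w \<in> test_functions S"
  by (rule test_functionsE[OF assms], rule test_functionsI[OF smooth_gradient[OF test_functions_smooth[OF assms]]])
    (auto simp: gradient_def)

lemma gradient_inner_Basis: "b \<in> Basis \<Longrightarrow> gradient w x \<bullet> b = \<partial> b w x"
  by (simp add: gradient_def inner_sum_left inner_Basis if_distrib cong: if_cong)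

lemma gradient_inner: "gradient w x \<bullet> v = (\<Sum>b\<in>Basis. \<partial> b w x * (v \<bullet> b))"
  by (simp add: gradient_def inner_sum_left inner_commute[of v])

lemma directional_scaleR:
  assumes "smooth w" "smooth F"
  shows "\<partial> v (\<lambda>x. w x *\<^sub>R F x) x = w x *\<^sub>R \<partial> v F x + \<partial> v w x *\<^sub>R F x"
  using frechet_derivative_at[OF bounded_bilinear.FDERIV[OF bounded_bilinear_scaleR
        smooth_has_derivative[OF assms(1)] smooth_has_derivative[OF assms(2)]], symmetric]
  by simp

lemma directional_mult:
  fixes w F :: "'a::euclidean_space \<Rightarrow> real"
  shows "smooth w \<Longrightarrow> smooth F \<Longrightarrow> \<partial> v (\<lambda>x. w x * F x) x = w x * \<partial> v F x + \<partial> v w x * F x"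
  using directional_scaleR[of w F] by simp

lemma gradient_mult:
  "smooth w \<Longrightarrow> smooth F \<Longrightarrow> gradient (\<lambda>x. w x * F x) x = w x *\<^sub>R gradient F x + F x *\<^sub>R gradient w x"
  by (simp add: gradient_def directional_mult scaleR_add_left sum.distrib scaleR_sum_right mult.commute)

lemma divergence_scaleR:
  assumes "smooth w" "smooth F"
  shows "divergence (\<lambda>x. w x *\<^sub>R F x) x = w x * divergence F x + gradient w x \<bullet> F x"
  unfolding divergence_def gradient_inner directional_scaleR[OF assms]
  by (simp add: inner_add_left sum.distrib sum_distrib_left)

lemma smooth_divergence: "smooth F \<Longrightarrow> smooth (divergence F)"
  unfolding divergence_def[abs_def] by (intro smooth_sum smooth_inner smooth_directional smooth_const)

lemma test_functions_divergence:
  assumes "F \<in> test_functions \<Omega>"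
  shows "divergence F \<in> test_functions \<Omega>"
  by (rule test_functionsE[OF assms], rule test_functionsI[OF smooth_divergence[OF test_functions_smooth[OF assms]]])
    (auto simp: divergence_def)

lemma integral_divergence_eq_0:
  assumes "F \<in> test_functions \<Omega>"
  shows "(\<integral>x. divergence F x \<partial>lborel) = 0"
proof -
  have "integrable lborel (\<partial> b F)" for b
    by (rule test_functions_integrable[OF test_functions_directional[OF assms]])
  then show ?thesis
    unfolding divergence_def by (simp add: integral_directional_eq_0[OF assms])
qed

lemma test_functions_scaleR:
  assumes "F \<in> test_functions \<Omega>" "smooth w"
  shows "(\<lambda>x. w x *\<^sub>R F x) \<in> test_functions \<Omega>"
  by (rule test_functions_supported_mult[OF assms(1) smooth_scaleR[OF assms(2) test_functions_smooth[OF assms(1)]]])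
    simp

lemma test_functions_scaleR_left:
  assumes "w \<in> test_functions \<Omega>" "smooth F"
  shows "(\<lambda>x. w x *\<^sub>R F x) \<in> test_functions \<Omega>"
  by (rule test_functions_supported_mult[OF assms(1) smooth_scaleR[OF test_functions_smooth[OF assms(1)] assms(2)]])
    simp

lemma integration_by_parts:
  assumes \<phi>: "\<phi> \<in> test_functions \<Omega>" and w: "smooth w"
  shows "(\<integral>x. w x * divergence \<phi> x \<partial>lborel) = - (\<integral>x. gradient w x \<bullet> \<phi> x \<partial>lborel)"
proof -
  have "(\<lambda>x. w x * divergence \<phi> x) \<in> test_functions \<Omega>" "(\<lambda>x. gradient w x \<bullet> \<phi> x) \<in> test_functions \<Omega>"
    using test_functions_scaleR[OF test_functions_divergence[OF \<phi>] w]
    by (auto intro!: test_functions_supported_mult[OF \<phi>] smooth_inner smooth_gradient w test_functions_smooth[OF \<phi>])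
  note this[THEN test_functions_integrable]
  moreover have "(\<integral>x. w x * divergence \<phi> x + gradient w x \<bullet> \<phi> x \<partial>lborel) = 0"
    using integral_divergence_eq_0[OF test_functions_scaleR[OF \<phi> w]]
    by (simp add: divergence_scaleR[OF w test_functions_smooth[OF \<phi>]])
  ultimately show ?thesis by simp
qed

lemma test_functions_add:
  assumes "f \<in> test_functions \<Omega>" "g \<in> test_functions \<Omega>"
  shows "(\<lambda>x. f x + g x) \<in> test_functions \<Omega>"
proof -
  obtain K L where "compact K" "K \<subseteq> \<Omega>" "\<And>x. x \<notin> K \<Longrightarrow> f x = 0" "compact L" "L \<subseteq> \<Omega>" "\<And>x. x \<notin> L \<Longrightarrow> g x = 0"
    using test_functionsE[OF assms(1)] test_functionsE[OF assms(2)] by metis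
  then show ?thesis
    using assms[THEN test_functions_smooth]
    by (intro test_functionsI[of _ "K \<union> L"] smooth_add compact_Un) auto
qed

lemma test_functions_sum:
  "(\<And>i. i \<in> I \<Longrightarrow> f i \<in> test_functions \<Omega>) \<Longrightarrow> (\<lambda>x. \<Sum>i\<in>I. f i x) \<in> test_functions \<Omega>"
proof (induction I rule: infinite_finite_induct)
  case (insert i I)
  then show ?case by (simp add: test_functions_add)
qed (auto intro!: test_functionsI[of _ "{}"] smooth_const)

section \<open>Partitions of unity and exhaustion by test functions\<close>

text \<open>The partial sums are \<open>1 - (\<Prod>i<n. 1 - \<theta> i)\<close>. They reach 1 wherever one of the \<open>\<theta> i\<close> is 1, so
  their increments \<open>partition_part\<close> form a partition of unity without any division.\<close>

primrec partition_sum :: "(nat \<Rightarrow> 'a \<Rightarrow> real) \<Rightarrow> nat \<Rightarrow> 'a \<Rightarrow> real" where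
  "partition_sum \<theta> 0 x = 0"
| "partition_sum \<theta> (Suc n) x = partition_sum \<theta> n x + (1 - partition_sum \<theta> n x) * \<theta> n x"

definition partition_part :: "(nat \<Rightarrow> 'a \<Rightarrow> real) \<Rightarrow> nat \<Rightarrow> 'a \<Rightarrow> real" where
  "partition_part \<theta> n x = (1 - partition_sum \<theta> n x) * \<theta> n x"

lemma partition_sum_eq: "partition_sum \<theta> n x = (\<Sum>i<n. partition_part \<theta> i x)"
  by (induction n) (auto simp: partition_part_def)

lemma partition_sum_bounds:
  assumes "\<And>i. 0 \<le> \<theta> i x" "\<And>i. \<theta> i x \<le> 1"
  shows "0 \<le> partition_sum \<theta> n x" "partition_sum \<theta> n x \<le> 1"
    "i < n \<Longrightarrow> \<theta> i x = 1 \<Longrightarrow> partition_sum \<theta> n x = 1"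
proof -
  have b: "0 \<le> partition_sum \<theta> n x \<and> partition_sum \<theta> n x \<le> 1" for n
  proof (induction n)
    case (Suc n)
    have "0 \<le> (1 - partition_sum \<theta> n x) * \<theta> n x" "(1 - partition_sum \<theta> n x) * \<theta> n x \<le> (1 - partition_sum \<theta> n x) * 1"
      using Suc assms by (intro mult_nonneg_nonneg mult_left_mono; simp)+
    with Suc show ?case by simp
  qed simp
  then show "0 \<le> partition_sum \<theta> n x" "partition_sum \<theta> n x \<le> 1" by auto
  show "i < n \<Longrightarrow> \<theta> i x = 1 \<Longrightarrow> partition_sum \<theta> n x = 1"
    by (induction n) (auto simp: less_Suc_eq)
qed

lemma partition_part_nonneg:
  assumes "\<And>i. 0 \<le> \<theta> i x" "\<And>i. \<theta> i x \<le> 1"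
  shows "0 \<le> partition_part \<theta> i x"
  using partition_sum_bounds(2)[of \<theta> x i] assms by (simp add: partition_part_def)

lemma smooth_partition_sum: "(\<And>i. smooth (\<theta> i)) \<Longrightarrow> smooth (partition_sum \<theta> n)"
proof (induction n)
  case 0
  then show ?case using smooth_const[of "0::real"] by (simp add: partition_sum.simps(1)[abs_def])
next
  case (Suc n)
  then show ?case
    unfolding partition_sum.simps(2)[abs_def]
    by (intro smooth_add smooth_mult smooth_diff smooth_const Suc.IH Suc.prems)
qed

lemma partition_part_test:
  assumes "\<And>i. smooth (\<theta> i)" "\<theta> i \<in> test_functions \<Omega>"
  shows "partition_part \<theta> i \<in> test_functions \<Omega>"
  unfolding partition_part_def[abs_def]
  using test_functions_scaleR[OF assms(2) smooth_diff[OF smooth_const smooth_partition_sum[OF assms(1)]], of 1]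
  by simp

text \<open>Countably many balls cover \<open>U\<close> and have slightly larger concentric balls inside \<open>U\<close>; the
  functions are the partial unions of the corresponding bumps.\<close>

lemma test_functions_exhaustion:
  fixes U :: "'a::euclidean_space set"
  assumes "open U"
  obtains \<zeta> :: "nat \<Rightarrow> 'a \<Rightarrow> real" where "\<And>n. \<zeta> n \<in> test_functions U" "\<And>n x. 0 \<le> \<zeta> n x" "\<And>n x. \<zeta> n x \<le> 1"
    "\<And>x. x \<in> U \<Longrightarrow> \<forall>\<^sub>F n in sequentially. \<zeta> n x = 1"
proof (cases "U = {}")
  case True
  show ?thesis
    by (rule that[of "\<lambda>_ _. 0"]) (auto simp: True intro!: test_functionsI[of _ "{}"] smooth_const)
next
  case False
  define \<F> where "\<F> = {ball c r | c r. r > 0 \<and> cball c (3/2 * r) \<subseteq> U}"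
  have "\<Union>\<F> = U"
  proof (intro set_eqI iffI)
    fix x assume "x \<in> U"
    with assms obtain e where "e > 0" "cball x e \<subseteq> U" using open_contains_cball by blast
    then have "ball x (2/3 * e) \<in> \<F>" unfolding \<F>_def by (intro CollectI exI[of _ x] exI[of _ "2/3*e"]) auto
    then show "x \<in> \<Union>\<F>" using \<open>e > 0\<close> by (intro UnionI[of "ball x (2/3 * e)"]) auto
  qed (fastforce simp: \<F>_def)
  moreover obtain \<F>' where F': "\<F>' \<subseteq> \<F>" "countable \<F>'" "\<Union>\<F>' = \<Union>\<F>"
    by (rule Lindelof[of \<F>]) (auto simp: \<F>_def)
  ultimately have cov: "\<Union>\<F>' = U" by simp
  then have "\<F>' \<noteq> {}" using False by auto
  define B where "B = from_nat_into \<F>'"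
  have B: "range B = \<F>'" unfolding B_def using \<open>\<F>' \<noteq> {}\<close> F'(2) by (rule range_from_nat_into)
  have "\<exists>c r. B n = ball c r \<and> r > 0 \<and> cball c (3/2 * r) \<subseteq> U" for n
    using B F'(1) unfolding \<F>_def by blast
  then obtain c r where cr: "\<And>n. B n = ball (c n) (r n)" "\<And>n. r n > 0" "\<And>n. cball (c n) (3/2 * r n) \<subseteq> U"
    by metis
  define \<theta> where "\<theta> n = bump (c n) (r n)" for n
  have \<theta>: "\<theta> n \<in> test_functions U" "0 \<le> \<theta> n x" "\<theta> n x \<le> 1" for n x
    unfolding \<theta>_def by (rule test_functions_bump[OF cr(2,3)] bump_facts)+
  show ?thesis
  proof (rule that[of "partition_sum \<theta>"])
    have "(\<lambda>x. \<Sum>i<n. partition_part \<theta> i x) \<in> test_functions U" for n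
      by (intro test_functions_sum partition_part_test test_functions_smooth[OF \<theta>(1)] \<theta>(1))
    then show "partition_sum \<theta> n \<in> test_functions U" for n
      by (simp add: partition_sum_eq[abs_def])
    show "0 \<le> partition_sum \<theta> n x" "partition_sum \<theta> n x \<le> 1" for n x
      by (intro partition_sum_bounds \<theta>)+
    fix x assume "x \<in> U"
    then obtain i where "x \<in> B i" using cov B by blast
    then have "\<theta> i x = 1" unfolding \<theta>_def using cr by (intro bump_facts) (auto simp: dist_norm norm_minus_commute)
    then show "\<forall>\<^sub>F n in sequentially. partition_sum \<theta> n x = 1"
      using partition_sum_bounds(3)[where \<theta>=\<theta>, OF \<theta>(2,3)]
      by (intro eventually_sequentiallyI[of "Suc i"]) (metis Suc_le_eq)
  qed
qed

section \<open>Weak gradients and total variation\<close>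

text \<open>The optimal test field is the normalised gradient. It is made smooth by adding \<open>1 / (n + 1)\<close> to
  the squared norm, and compactly supported by an exhausting sequence of cut-offs; Fatou's lemma
  recovers the integral in the limit.\<close>

lemma gradient_norm_le_variation:
  fixes w :: "'a::euclidean_space \<Rightarrow> real"
  assumes \<Omega>: "open \<Omega>" and w: "smooth w"
    and B: "\<And>\<phi>. \<phi> \<in> test_functions \<Omega> \<Longrightarrow> (\<And>x. norm (\<phi> x) \<le> 1) \<Longrightarrow> - (\<integral>x. w x * divergence \<phi> x \<partial>lborel) \<le> B"
  shows "(\<integral>\<^sup>+x. ennreal (norm (gradient w x)) \<partial>lebesgue_on \<Omega>) \<le> ennreal B"
proof -
  obtain \<zeta> :: "nat \<Rightarrow> 'a \<Rightarrow> real" where \<zeta>: "\<And>n. \<zeta> n \<in> test_functions \<Omega>" "\<And>n x. 0 \<le> \<zeta> n x" "\<And>n x. \<zeta> n x \<le> 1"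
    "\<And>x. x \<in> \<Omega> \<Longrightarrow> \<forall>\<^sub>F n in sequentially. \<zeta> n x = 1"
    using test_functions_exhaustion[OF \<Omega>] by metis
  define N where "N n x = gradient w x \<bullet> gradient w x + 1 / real (Suc n)" for n x
  have N: "N n x > 0" for n x unfolding N_def by (intro add_nonneg_pos) auto
  have smN: "smooth (N n)" for n
    unfolding N_def by (intro smooth_add smooth_inner smooth_gradient w smooth_const)
  define q where "q n x = \<zeta> n x * N n x powr (-1/2)" for n x
  have q: "q n x \<ge> 0" "q n x * (norm (gradient w x))\<^sup>2 \<le> norm (gradient w x)" "q n x * norm (gradient w x) \<le> 1" for n x
  proof -
    show "q n x \<ge> 0" using \<zeta> by (simp add: q_def)
    have "(norm (gradient w x))\<^sup>2 \<le> N n x" by (simp add: N_def power2_norm_eq_inner)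
    then have "norm (gradient w x) \<le> N n x powr (1/2)"
      using N[of n x] by (simp add: powr_half_sqrt real_le_rsqrt)
    then have "N n x powr (-1/2) * norm (gradient w x) \<le> N n x powr (-1/2) * N n x powr (1/2)"
      by (intro mult_left_mono) auto
    also have "\<dots> = 1" using N[of n x] by (simp add: powr_add[symmetric])
    finally have "\<zeta> n x * (N n x powr (-1/2) * norm (gradient w x)) \<le> 1 * 1"
      using \<zeta> by (intro mult_mono) auto
    then show le: "q n x * norm (gradient w x) \<le> 1" by (simp add: q_def mult.assoc)
    show "q n x * (norm (gradient w x))\<^sup>2 \<le> norm (gradient w x)"
      using mult_right_mono[OF le norm_ge_zero[of "gradient w x"]] by (simp add: power2_eq_square)
  qed
  have smq: "smooth (q n)" for n unfolding q_def
    by (intro smooth_mult smooth_powr smN N test_functions_smooth[OF \<zeta>(1)])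
  have le: "(\<integral>\<^sup>+x. ennreal (q n x * (norm (gradient w x))\<^sup>2) * indicator \<Omega> x \<partial>lborel) \<le> ennreal B" for n
  proof -
    have q_test: "q n \<in> test_functions \<Omega>"
      by (rule test_functions_supported_mult[OF \<zeta>(1)[of n] smq]) (simp add: q_def)
    then have \<phi>: "(\<lambda>x. q n x *\<^sub>R gradient w x) \<in> test_functions \<Omega>"
      by (intro test_functions_scaleR_left smooth_gradient w)
    have "(\<lambda>x. q n x *\<^sub>R (norm (gradient w x))\<^sup>2) \<in> test_functions \<Omega>"
      unfolding power2_norm_eq_inner by (intro test_functions_scaleR_left q_test smooth_inner smooth_gradient w)
    then have int: "integrable lborel (\<lambda>x. q n x * (norm (gradient w x))\<^sup>2)"
      using test_functions_integrable by auto
    have "(\<integral>\<^sup>+x. ennreal (q n x * (norm (gradient w x))\<^sup>2) * indicator \<Omega> x \<partial>lborel)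
        \<le> (\<integral>\<^sup>+x. ennreal (q n x * (norm (gradient w x))\<^sup>2) \<partial>lborel)"
      by (intro nn_integral_mono) (auto simp: indicator_def)
    also have "\<dots> = ennreal (\<integral>x. q n x * (norm (gradient w x))\<^sup>2 \<partial>lborel)"
      by (intro nn_integral_eq_integral int) (auto simp: q(1))
    also have "(\<integral>x. q n x * (norm (gradient w x))\<^sup>2 \<partial>lborel) = (\<integral>x. gradient w x \<bullet> (q n x *\<^sub>R gradient w x) \<partial>lborel)"
      by (simp add: power2_norm_eq_inner)
    also have "\<dots> = - (\<integral>x. w x * divergence (\<lambda>x. q n x *\<^sub>R gradient w x) x \<partial>lborel)"
      using integration_by_parts[OF \<phi> w] by simp
    also have "ennreal \<dots> \<le> ennreal B"
      using q by (intro ennreal_leI B[OF \<phi>]) simp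
    finally show ?thesis .
  qed
  have [measurable]: "q n \<in> borel_measurable borel" "gradient w \<in> borel_measurable borel" for n
    by (intro smooth_borel smq smooth_gradient w)+
  have [measurable]: "\<Omega> \<in> sets borel" using \<Omega> by simp
  have lim: "(\<lambda>n. q n x * (norm (gradient w x))\<^sup>2) \<longlonglongrightarrow> norm (gradient w x)" if x: "x \<in> \<Omega>" for x
  proof (cases "gradient w x = 0")
    case False
    define s where "s = norm (gradient w x)"
    have s: "s > 0" using False by (simp add: s_def)
    have "(\<lambda>n. N n x) \<longlonglongrightarrow> s\<^sup>2 + 0"
      unfolding N_def s_def power2_norm_eq_inner by (intro tendsto_intros LIMSEQ_Suc[OF lim_1_over_n])
    then have "(\<lambda>n. N n x powr (-1/2) * s\<^sup>2) \<longlonglongrightarrow> (s\<^sup>2) powr (-1/2) * s\<^sup>2"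
      using s by (intro tendsto_intros) auto
    also have "(s\<^sup>2) powr (-1/2) * s\<^sup>2 = s"
      using s by (simp add: powr_minus powr_half_sqrt power2_eq_square)
    finally show ?thesis
      unfolding s_def by (rule Lim_transform_eventually) (use \<zeta>(4)[OF x] in eventually_elim, simp add: q_def s_def)
  qed simp
  have "(\<integral>\<^sup>+x. ennreal (norm (gradient w x)) * indicator \<Omega> x \<partial>lborel)
      \<le> (\<integral>\<^sup>+x. liminf (\<lambda>n. ennreal (q n x * (norm (gradient w x))\<^sup>2) * indicator \<Omega> x) \<partial>lborel)"
  proof (rule nn_integral_mono)
    fix x
    show "ennreal (norm (gradient w x)) * indicator \<Omega> x \<le> liminf (\<lambda>n. ennreal (q n x * (norm (gradient w x))\<^sup>2) * indicator \<Omega> x)"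
    proof (cases "x \<in> \<Omega>")
      case True
      have "(\<lambda>n. ennreal (q n x * (norm (gradient w x))\<^sup>2)) \<longlonglongrightarrow> ennreal (norm (gradient w x))"
        by (intro tendsto_ennrealI lim True)
      from lim_imp_Liminf[OF trivial_limit_sequentially this] show ?thesis using True by simp
    qed simp
  qed
  also have "\<dots> \<le> liminf (\<lambda>n. \<integral>\<^sup>+x. ennreal (q n x * (norm (gradient w x))\<^sup>2) * indicator \<Omega> x \<partial>lborel)"
    by (rule nn_integral_liminf) measurable
  also have "\<dots> \<le> limsup (\<lambda>n. \<integral>\<^sup>+x. ennreal (q n x * (norm (gradient w x))\<^sup>2) * indicator \<Omega> x \<partial>lborel)"
    by (rule Liminf_le_Limsup) simp
  also have "\<dots> \<le> ennreal B" by (intro Limsup_bounded always_eventually allI le)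
  finally show ?thesis using \<Omega> by (simp add: nn_integral_lebesgue_on)
qed

text \<open>The exhausting test functions of an open set \<open>U\<close> converge to its indicator, so \<open>h\<close> has integral 0
  over open subsets and, taking complements, over compact subsets. If \<open>h\<close> had a strict sign on a set of
  positive measure, it would have one on a compact set of positive measure.\<close>

lemma fundamental_lemma:
  fixes h :: "'a::euclidean_space \<Rightarrow> real"
  assumes \<Omega>: "open \<Omega>" "bounded \<Omega>" and h: "integrable (lebesgue_on \<Omega>) h"
    and zero: "\<And>\<phi>. \<phi> \<in> test_functions \<Omega> \<Longrightarrow> (\<integral>x. h x * \<phi> x \<partial>lebesgue_on \<Omega>) = 0"
  shows "AE x in lebesgue_on \<Omega>. h x = 0"
proof -
  have \<Omega>l[simp]: "\<Omega> \<in> sets lebesgue" using \<Omega> by (simp add: lebesgue_openin borel_open)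
  have hm[measurable]: "h \<in> borel_measurable (lebesgue_on \<Omega>)" using h by simp
  have openU: "(\<integral>x. h x * indicator U x \<partial>lebesgue_on \<Omega>) = 0" if U: "open U" "U \<subseteq> \<Omega>" for U
  proof -
    obtain \<zeta> :: "nat \<Rightarrow> 'a \<Rightarrow> real" where \<zeta>: "\<And>n. \<zeta> n \<in> test_functions U" "\<And>n x. 0 \<le> \<zeta> n x" "\<And>n x. \<zeta> n x \<le> 1"
      "\<And>x. x \<in> U \<Longrightarrow> \<forall>\<^sub>F n in sequentially. \<zeta> n x = 1"
      using test_functions_exhaustion[OF U(1)] by metis
    have [measurable]: "\<zeta> n \<in> borel_measurable (lebesgue_on \<Omega>)" for n
      by (rule lebesgue_on_measurable[OF test_functions_borel[OF \<zeta>(1)]])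
    have [measurable]: "(indicator U :: 'a \<Rightarrow> real) \<in> borel_measurable (lebesgue_on \<Omega>)"
      using U by (intro lebesgue_on_measurable) simp
    have "(\<lambda>n. \<integral>x. h x * \<zeta> n x \<partial>lebesgue_on \<Omega>) \<longlonglongrightarrow> (\<integral>x. h x * indicator U x \<partial>lebesgue_on \<Omega>)"
    proof (rule integral_dominated_convergence[where w="\<lambda>x. norm (h x)"])
      show "AE x in lebesgue_on \<Omega>. (\<lambda>n. h x * \<zeta> n x) \<longlonglongrightarrow> h x * indicator U x"
      proof (intro AE_I2 tendsto_mult tendsto_const tendsto_eventually)
        fix x
        show "\<forall>\<^sub>F n in sequentially. \<zeta> n x = indicator U x"
        proof (cases "x \<in> U")
          case True
          from \<zeta>(4)[OF True] True show ?thesis by simp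
        next
          case False
          have "\<zeta> n x = 0" for n by (rule test_functions_eq_0[OF \<zeta>(1) False])
          then show ?thesis using False by simp
        qed
      qed
      show "AE x in lebesgue_on \<Omega>. norm (h x * \<zeta> n x) \<le> norm (h x)" for n
        using \<zeta> by (auto simp: abs_mult intro!: mult_left_le)
    qed (use h in auto)
    moreover have "(\<integral>x. h x * \<zeta> n x \<partial>lebesgue_on \<Omega>) = 0" for n
      by (intro zero test_functions_mono[OF \<zeta>(1) U(2)])
    ultimately show ?thesis by (simp add: LIMSEQ_const_iff)
  qed
  have compactK: "(\<integral>x. h x * indicator K x \<partial>lebesgue_on \<Omega>) = 0" if K: "compact K" "K \<subseteq> \<Omega>" for K
  proof -
    have [measurable]: "(indicator (\<Omega> - K) :: 'a \<Rightarrow> real) \<in> borel_measurable (lebesgue_on \<Omega>)"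
      using K \<Omega> by (intro lebesgue_on_measurable borel_measurable_indicator)
        (simp add: borel_compact sets.Diff)
    have "integrable (lebesgue_on \<Omega>) (\<lambda>x. h x * indicator (\<Omega> - K) x)"
    proof (rule Bochner_Integration.integrable_bound[OF h])
      show "(\<lambda>x. h x * indicator (\<Omega> - K) x) \<in> borel_measurable (lebesgue_on \<Omega>)" by measurable
    qed (auto simp: indicator_def)
    moreover have "(\<integral>x. h x * indicator K x \<partial>lebesgue_on \<Omega>) = (\<integral>x. h x - h x * indicator (\<Omega> - K) x \<partial>lebesgue_on \<Omega>)"
      using K by (intro Bochner_Integration.integral_cong refl) (auto simp: indicator_def)
    moreover have "(\<integral>x. h x \<partial>lebesgue_on \<Omega>) = (\<integral>x. h x * indicator \<Omega> x \<partial>lebesgue_on \<Omega>)"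
      by (intro Bochner_Integration.integral_cong refl) (auto simp: indicator_def)
    ultimately show ?thesis
      using openU[of "\<Omega> - K"] openU[of \<Omega>] \<Omega> K h by (simp add: open_Diff compact_imp_closed)
  qed
  have null: "{x \<in> \<Omega>. s * h x > 0} \<in> null_sets lebesgue" for s :: real
  proof -
    define S where "S = {x \<in> \<Omega>. s * h x > 0}"
    have "{x \<in> space (lebesgue_on \<Omega>). s * h x > 0} \<in> sets (lebesgue_on \<Omega>)" by measurable
    then have S: "S \<in> sets lebesgue" by (simp add: S_def sets_restrict_space_iff)
    have small: "emeasure lebesgue S \<le> ennreal e" if "e > 0" for e :: real
    proof -
      obtain T where T: "closed T" "T \<subseteq> S" "emeasure lebesgue (S - T) < ennreal e"
        using sets_lebesgue_inner_closed[OF S \<open>e > 0\<close>] by metis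
      have "compact T" using T \<Omega>(2) bounded_subset[of \<Omega> T] by (auto simp: compact_eq_bounded_closed S_def)
      have Tl: "T \<in> sets lebesgue" using T(1) by (simp add: borel_closed)
      have [measurable]: "(indicator T :: 'a \<Rightarrow> real) \<in> borel_measurable (lebesgue_on \<Omega>)"
        using T by (intro lebesgue_on_measurable) simp
      have int: "integrable (lebesgue_on \<Omega>) (\<lambda>x. s * (h x * indicator T x))"
      proof (intro integrable_mult_right Bochner_Integration.integrable_bound[OF h])
        show "(\<lambda>x. h x * indicator T x) \<in> borel_measurable (lebesgue_on \<Omega>)" by measurable
      qed (auto simp: indicator_def)
      have "(\<integral>x. s * (h x * indicator T x) \<partial>lebesgue_on \<Omega>) = 0"
        using compactK[OF \<open>compact T\<close>] T(2) by (auto simp: S_def)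
      then have "AE x in lebesgue_on \<Omega>. s * (h x * indicator T x) = 0"
        using T(2) by (subst (asm) integral_nonneg_eq_0_iff_AE[OF int])
          (auto simp: S_def indicator_def less_imp_le intro!: AE_I2)
      then have "AE x in lebesgue. x \<in> \<Omega> \<longrightarrow> s * (h x * indicator T x) = 0"
        by (subst (asm) AE_restrict_space_iff) (simp_all only: \<Omega>l space_completion space_lborel space_borel Int_UNIV_right)
      then have "AE x in lebesgue. x \<notin> T"
        by eventually_elim (use T(2) in \<open>auto simp: S_def\<close>)
      then have "T \<in> null_sets lebesgue" using Tl by (simp add: AE_iff_null_sets)
      then have "emeasure lebesgue T = 0" by auto
      moreover have "emeasure lebesgue S \<le> emeasure lebesgue (S - T) + emeasure lebesgue T"
        using emeasure_subadditive[of "S - T" lebesgue T] S Tl T(2) by (simp add: Un_absorb2)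
      ultimately show ?thesis using T(3) by simp
    qed
    have "emeasure lebesgue S \<le> 0"
    proof (rule ennreal_le_epsilon)
      fix e :: real assume "0 < e"
      from small[OF this] show "emeasure lebesgue S \<le> 0 + ennreal e" by (simp only: add_0_left)
    qed
    then have "emeasure lebesgue S = 0" by (simp only: le_zero_eq)
    then have "S \<in> null_sets lebesgue" using S by (rule null_setsI)
    then show ?thesis by (simp only: S_def)
  qed
  have "AE x in lebesgue. x \<notin> {x \<in> \<Omega>. 1 * h x > 0}" "AE x in lebesgue. x \<notin> {x \<in> \<Omega>. (-1) * h x > 0}"
    by (intro AE_not_in null)+
  then have "AE x in lebesgue. x \<in> \<Omega> \<longrightarrow> h x = 0" by eventually_elim auto
  then show ?thesis by (simp add: AE_restrict_space_iff)
qed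

lemma weak_gradient_unique:
  fixes \<Omega> :: "'a::euclidean_space set"
  assumes \<Omega>: "open \<Omega>" "bounded \<Omega>" and G: "is_weak_gradient \<Omega> u G" and H: "is_weak_gradient \<Omega> u H"
  shows "AE x in lebesgue_on \<Omega>. G x = H x"
proof -
  have int: "integrable (lebesgue_on \<Omega>) G" "integrable (lebesgue_on \<Omega>) H"
    using G H by (auto simp: is_weak_gradient_def)
  have "AE x in lebesgue_on \<Omega>. (G x - H x) \<bullet> b = 0" if b: "b \<in> Basis" for b
  proof (rule fundamental_lemma[OF \<Omega>])
    show "integrable (lebesgue_on \<Omega>) (\<lambda>x. (G x - H x) \<bullet> b)" using int by simp
    fix \<phi> :: "'a \<Rightarrow> real" assume \<phi>: "\<phi> \<in> test_functions \<Omega>"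
    have "integrable (lebesgue_on \<Omega>) (\<lambda>x. (F x \<bullet> b) * \<phi> x)" if "integrable (lebesgue_on \<Omega>) F" for F
      using that by (intro integrable_mult_test_function[OF \<phi>]) simp
    note this[OF int(1)] this[OF int(2)]
    moreover have "(\<integral>x. (G x \<bullet> b) * \<phi> x \<partial>lebesgue_on \<Omega>) = (\<integral>x. (H x \<bullet> b) * \<phi> x \<partial>lebesgue_on \<Omega>)"
      using G H \<phi> b by (auto simp: is_weak_gradient_def)
    ultimately show "(\<integral>x. ((G x - H x) \<bullet> b) * \<phi> x \<partial>lebesgue_on \<Omega>) = 0"
      by (simp add: inner_diff_left left_diff_distrib)
  qed
  then have "AE x in lebesgue_on \<Omega>. \<forall>b\<in>Basis. (G x - H x) \<bullet> b = 0"
    by (subst AE_ball_countable) (auto simp: countable_finite)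
  then show ?thesis by eventually_elim (auto intro: euclidean_eqI simp: inner_diff_left)
qed

lemma smooth_is_weak_gradient:
  assumes \<Omega>: "open \<Omega>" and w: "w \<in> test_functions UNIV"
  shows "is_weak_gradient \<Omega> w (gradient w)"
  unfolding is_weak_gradient_def
proof (intro conjI ballI)
  have sm: "smooth w" using w test_functions_smooth by blast
  have [measurable]: "\<Omega> \<in> sets borel" using \<Omega> by simp
  have gint: "integrable lborel (gradient w)"
    by (rule test_functions_integrable[OF test_functions_gradient[OF w]])
  have gm[measurable]: "gradient w \<in> borel_measurable borel" by (intro smooth_borel smooth_gradient sm)
  have "integrable lborel (\<lambda>x. indicator \<Omega> x *\<^sub>R gradient w x)"
    by (rule integrable_mult_indicator[OF _ gint]) simp
  then show "integrable (lebesgue_on \<Omega>) (gradient w)" using \<Omega> by (simp add: integrable_lebesgue_on gm)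
  fix \<phi> :: "'a \<Rightarrow> real" and b :: 'a assume \<phi>: "\<phi> \<in> test_functions \<Omega>" and b: "b \<in> Basis"
  have smp: "smooth \<phi>" using \<phi> test_functions_smooth by blast
  have "(\<integral>x. w x * \<partial> b \<phi> x + \<partial> b w x * \<phi> x \<partial>lborel) = 0"
    using integral_directional_eq_0[OF test_functions_scaleR[OF \<phi> sm], of b] by (simp add: directional_mult[OF sm smp])
  moreover have "(\<lambda>x. w x *\<^sub>R \<partial> b \<phi> x) \<in> test_functions \<Omega>" "(\<lambda>x. \<partial> b w x *\<^sub>R \<phi> x) \<in> test_functions \<Omega>"
    by (intro test_functions_scaleR test_functions_directional \<phi> sm smooth_directional)+
  note t = this
  ultimately have "(\<integral>x. w x * \<partial> b \<phi> x \<partial>lborel) = - (\<integral>x. (gradient w x \<bullet> b) * \<phi> x \<partial>lborel)"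
    using t[THEN test_functions_integrable] b by (simp add: gradient_inner_Basis)
  moreover note test_functions_eq_0[OF t(1)] test_functions_eq_0[OF t(2)]
  ultimately show "(\<integral>x. w x * frechet_derivative \<phi> (at x) b \<partial>lebesgue_on \<Omega>) = - (\<integral>x. (gradient w x \<bullet> b) * \<phi> x \<partial>lebesgue_on \<Omega>)"
    using b \<Omega> test_functions_borel[OF t(1)] test_functions_borel[OF t(2)]
    by (subst (1 2) integral_lebesgue_on_supported) (auto simp: gradient_inner_Basis)
qed

section \<open>Lipschitz charts\<close>

text \<open>At a boundary point, a shift by \<open>t\<close> along \<open>e\<close> raises a point of the domain by \<open>t\<close> above the
  graph, while a perturbation \<open>z\<close> costs at most \<open>(1 + L) * norm z\<close>; so \<open>c = 1 / (1 + L)\<close> works. At an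
  interior point a small ball inside the domain serves with \<open>e = 0\<close>.\<close>

lemma lipschitz_domain_chart:
  fixes \<Omega> :: "'a::euclidean_space set"
  assumes dom: "bounded_lipschitz_domain \<Omega>" and p: "p \<in> closure \<Omega>"
  shows "\<exists>r e c \<delta>. r > 0 \<and> norm e \<le> 1 \<and> 0 < c \<and> c \<le> 1 \<and> \<delta> > 0 \<and>
    (\<forall>x\<in>\<Omega>. \<forall>z t. 0 < t \<longrightarrow> t < \<delta> \<longrightarrow> norm z \<le> c * t \<longrightarrow> x + z + t *\<^sub>R e \<in> cball p r \<longrightarrow> x + z + t *\<^sub>R e \<in> \<Omega>)"
proof (cases "p \<in> \<Omega>")
  case True
  have "open \<Omega>" using dom by (simp add: bounded_lipschitz_domain_def)
  with True obtain r where "r > 0" "cball p r \<subseteq> \<Omega>" using open_contains_cball by blast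
  then show ?thesis
    by (intro exI[of _ r] exI[of _ "0::'a"] exI[of _ "1::real"] exI[of _ "1::real"]) auto
next
  case False
  have "open \<Omega>" using dom by (simp add: bounded_lipschitz_domain_def)
  with False p have "p \<in> frontier \<Omega>" by (simp add: frontier_def interior_open)
  moreover have "lipschitz_boundary \<Omega>" using dom by (simp add: bounded_lipschitz_domain_def)
  ultimately obtain R e g L where R: "R > 0" "norm e = 1" "L-lipschitz_on {y. y \<bullet> e = 0} g"
    "\<Omega> \<inter> ball p R = {x \<in> ball p R. g (x - (x \<bullet> e) *\<^sub>R e) < x \<bullet> e}"
    unfolding lipschitz_boundary_def by blast
  have L: "L \<ge> 0" using R(3) by (rule lipschitz_on_nonneg)
  have ee: "e \<bullet> e = 1" using R(2) by (simp add: norm_eq_1)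
  show ?thesis
  proof (rule exI[of _ "R/3"], rule exI[of _ e], rule exI[of _ "1 / (1 + L)"], rule exI[of _ "R/3"],
      intro conjI ballI allI impI)
    fix x z t assume x: "x \<in> \<Omega>" and t: "0 < t" "t < R/3" and z: "norm z \<le> 1 / (1 + L) * t"
      and y: "x + z + t *\<^sub>R e \<in> cball p (R/3)"
    let ?y = "x + z + t *\<^sub>R e"
    have zt: "norm z * (1 + L) \<le> t" using z L by (simp add: field_simps)
    then have "norm z \<le> t" using L mult_left_mono[of 1 "1 + L" "norm z"] by simp
    have "dist p x \<le> dist p ?y + dist ?y x" by (rule dist_triangle)
    also have "dist ?y x \<le> norm z + t"
      using norm_triangle_ineq[of z "t *\<^sub>R e"] t R(2) by (simp add: dist_norm)
    finally have "x \<in> ball p R" using y t \<open>norm z \<le> t\<close> by simp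
    then have gx: "g (x - (x \<bullet> e) *\<^sub>R e) < x \<bullet> e" using R(4) x by blast
    define q where "q v = v - (v \<bullet> e) *\<^sub>R e" for v
    have q0: "q v \<bullet> e = 0" for v by (simp add: q_def inner_diff_left ee)
    have "q ?y - q x = q z" by (simp add: q_def algebra_simps inner_add_left ee)
    moreover have "norm (q z) \<le> norm z"
    proof -
      have "(norm (q z))\<^sup>2 = (norm z)\<^sup>2 - (z \<bullet> e)\<^sup>2"
        unfolding power2_norm_eq_inner q_def
        by (simp add: inner_diff_left inner_diff_right ee inner_commute power2_eq_square)
      then have "(norm (q z))\<^sup>2 \<le> (norm z)\<^sup>2" by simp
      then show ?thesis by (rule power2_le_imp_le) simp
    qed
    ultimately have "dist (q ?y) (q x) \<le> norm z" by (simp add: dist_norm)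
    then have "L * dist (q ?y) (q x) \<le> L * norm z" using L by (rule mult_left_mono)
    moreover have "dist (g (q ?y)) (g (q x)) \<le> L * dist (q ?y) (q x)"
      by (rule lipschitz_onD[OF R(3)]) (auto simp: q0)
    ultimately have "g (q ?y) \<le> g (q x) + L * norm z" by (auto simp: dist_real_def)
    also have "\<dots> < x \<bullet> e + L * norm z" using gx by (simp add: q_def)
    also have "\<dots> \<le> ?y \<bullet> e"
    proof -
      have "- norm z \<le> z \<bullet> e" using Cauchy_Schwarz_ineq2[of z e] R(2) by auto
      then show ?thesis using zt by (simp add: inner_add_left ee algebra_simps)
    qed
    finally have "?y \<in> {x \<in> ball p R. g (x - (x \<bullet> e) *\<^sub>R e) < x \<bullet> e}"
      using y R(1) by (simp add: q_def)
    then show "?y \<in> \<Omega>" using R(4) by blast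
  qed (use R L in \<open>auto simp: field_simps\<close>)
qed

text \<open>A finite subcover of the closed domain makes the constants of the charts uniform. The sets \<open>K i\<close>
  contain the supports of the parts; being compact, they later confine the supports of test fields.\<close>

lemma inward_partition_of_unity:
  fixes \<Omega> :: "'a::euclidean_space set"
  assumes dom: "bounded_lipschitz_domain \<Omega>"
  obtains c \<delta> :: real and \<zeta> :: "nat \<Rightarrow> 'a \<Rightarrow> real" and n :: nat and e :: "nat \<Rightarrow> 'a" and K :: "nat \<Rightarrow> 'a set"
  where "0 < c" "c \<le> 1" "0 < \<delta>"
    "\<And>i. \<zeta> i \<in> test_functions UNIV" "\<And>i x. 0 \<le> \<zeta> i x"
    "\<And>x. (\<Sum>i<n. \<zeta> i x) \<le> 1" "\<And>x. x \<in> \<Omega> \<Longrightarrow> (\<Sum>i<n. \<zeta> i x) = 1"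
    "\<And>i. norm (e i) \<le> 1" "\<And>i. compact (K i)" "\<And>i x. x \<notin> K i \<Longrightarrow> \<zeta> i x = 0"
    "\<And>i x z t. x \<in> \<Omega> \<Longrightarrow> 0 < t \<Longrightarrow> t < \<delta> \<Longrightarrow> norm z \<le> c * t \<Longrightarrow> x + z + t *\<^sub>R e i \<in> K i \<Longrightarrow> x + z + t *\<^sub>R e i \<in> \<Omega>"
proof -
  have "\<forall>p\<in>closure \<Omega>. \<exists>r e c \<delta>. r > 0 \<and> norm e \<le> 1 \<and> 0 < c \<and> c \<le> 1 \<and> \<delta> > 0 \<and>
    (\<forall>x\<in>\<Omega>. \<forall>z t. 0 < t \<longrightarrow> t < \<delta> \<longrightarrow> norm z \<le> c * t \<longrightarrow> x + z + t *\<^sub>R e \<in> cball p r \<longrightarrow> x + z + t *\<^sub>R e \<in> \<Omega>)"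
    using lipschitz_domain_chart[OF dom] by blast
  then obtain r e c \<delta> where ch: "\<And>p. p \<in> closure \<Omega> \<Longrightarrow> r p > 0 \<and> norm (e p) \<le> 1 \<and> 0 < c p \<and> c p \<le> 1 \<and> \<delta> p > 0 \<and>
    (\<forall>x\<in>\<Omega>. \<forall>z t. 0 < t \<longrightarrow> t < \<delta> p \<longrightarrow> norm z \<le> c p * t \<longrightarrow> x + z + t *\<^sub>R e p \<in> cball p (r p) \<longrightarrow> x + z + t *\<^sub>R e p \<in> \<Omega>)"
    unfolding bchoice_iff by blast
  have ne: "closure \<Omega> \<noteq> {}" using dom by (simp add: bounded_lipschitz_domain_def)
  have cpt: "compact (closure \<Omega>)" using dom by (simp add: bounded_lipschitz_domain_def compact_closure)
  have "\<And>p. p \<in> closure \<Omega> \<Longrightarrow> open (ball p (2/3 * r p))" "closure \<Omega> \<subseteq> (\<Union>p\<in>closure \<Omega>. ball p (2/3 * r p))"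
    using ch by (auto intro!: bexI)
  from compactE_image[OF cpt this] obtain C where C: "C \<subseteq> closure \<Omega>" "finite C" "closure \<Omega> \<subseteq> (\<Union>p\<in>C. ball p (2/3 * r p))"
    by metis
  have "C \<noteq> {}" using C(3) ne by auto
  then obtain p0 where p0: "p0 \<in> C" by blast
  obtain n :: nat and q where q: "q ` {..<n} = C"
    using finite_imp_nat_seg_image_inj_on[OF C(2)] by (auto simp: lessThan_def)
  define P where "P i = (if i < n then q i else p0)" for i
  have PC: "P i \<in> C" for i using q p0 by (auto simp: P_def)
  then have P: "P i \<in> closure \<Omega>" for i using C(1) by blast
  define c' where "c' = Min (c ` C)"
  define \<delta>' where "\<delta>' = Min (\<delta> ` C)"
  have c': "c' \<le> c (P i)" "\<delta>' \<le> \<delta> (P i)" for i unfolding c'_def \<delta>'_def using C(2) PC by auto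
  have pos: "c' > 0" "\<delta>' > 0" unfolding c'_def \<delta>'_def using C(2) \<open>C \<noteq> {}\<close> ch C(1) by (auto simp: Min_gr_iff)
  define \<theta> where "\<theta> i = bump (P i) (2/3 * r (P i))" for i
  have \<theta>t: "\<theta> i \<in> test_functions UNIV" for i unfolding \<theta>_def using ch[OF P] by (intro test_functions_bump) auto
  have \<theta>b: "0 \<le> \<theta> i x" "\<theta> i x \<le> 1" for i x unfolding \<theta>_def by (simp_all add: bump_facts)
  show ?thesis
  proof (rule that[of c' \<delta>' "partition_part \<theta>" n "\<lambda>i. e (P i)" "\<lambda>i. cball (P i) (r (P i))"])
    show "0 < c'" "0 < \<delta>'" by (fact pos)+
    show "c' \<le> 1" using c'(1)[of 0] ch[OF P, of 0] by linarith
    show "partition_part \<theta> i \<in> test_functions UNIV" for i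
      by (intro partition_part_test test_functions_smooth[OF \<theta>t] \<theta>t)
    show "0 \<le> partition_part \<theta> i x" for i x by (intro partition_part_nonneg \<theta>b)
    show "(\<Sum>i<n. partition_part \<theta> i x) \<le> 1" for x
      using partition_sum_bounds(2)[where \<theta>=\<theta>, OF \<theta>b] by (simp add: partition_sum_eq)
    show "(\<Sum>i<n. partition_part \<theta> i x) = 1" if "x \<in> \<Omega>" for x
    proof -
      from that C(3) closure_subset obtain p where "p \<in> C" "x \<in> ball p (2/3 * r p)" by blast
      then obtain i where i: "i < n" "p = P i" using q by (auto simp: P_def)
      have "\<theta> i x = 1" unfolding \<theta>_def using \<open>x \<in> ball p _\<close> ch[OF P, of i] i
        by (intro bump_facts) (auto simp: dist_norm norm_minus_commute)
      then show ?thesis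
        using partition_sum_bounds(3)[where \<theta>=\<theta>, OF \<theta>b i(1)] by (simp add: partition_sum_eq)
    qed
    show "norm (e (P i)) \<le> 1" for i using ch[OF P] by blast
    show "compact (cball (P i) (r (P i)))" for i by simp
    show "partition_part \<theta> i x = 0" if "x \<notin> cball (P i) (r (P i))" for i x
    proof -
      have "\<theta> i x = 0"
        using bump_facts(4)[of "2/3 * r (P i)" "P i" x] that ch[OF P, of i]
        by (auto simp: \<theta>_def dist_norm norm_minus_commute)
      then show ?thesis by (simp add: partition_part_def)
    qed
    show "x + z + t *\<^sub>R e (P i) \<in> \<Omega>"
      if "x \<in> \<Omega>" "0 < t" "t < \<delta>'" "norm z \<le> c' * t" "x + z + t *\<^sub>R e (P i) \<in> cball (P i) (r (P i))" for i x z t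
    proof -
      have "norm z \<le> c (P i) * t" using that(2,4) c'(1)[of i] by (meson less_imp_le mult_right_mono order_trans)
      moreover have "t < \<delta> (P i)" using that(3) c'(2)[of i] by simp
      ultimately show ?thesis using that ch[OF P, of i] by blast
    qed
  qed
qed

lemma L2_translation_continuous_finite:
  fixes F :: "('a::euclidean_space \<Rightarrow> real) set"
  assumes "finite F" "\<And>g. g \<in> F \<Longrightarrow> g \<in> borel_measurable borel \<and> integrable lborel (\<lambda>x. (g x)\<^sup>2)" "\<omega> > 0"
  shows "\<exists>\<delta>>0. \<forall>g\<in>F. \<forall>v. norm v < \<delta> \<longrightarrow> L2_distance2 (\<lambda>x. g (x + v)) g \<le> ennreal \<omega>"
  using assms(1,2)
proof (induction F rule: finite_induct)
  case (insert g F)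
  then obtain \<delta>1 where "\<delta>1 > 0" "\<forall>g\<in>F. \<forall>v. norm v < \<delta>1 \<longrightarrow> L2_distance2 (\<lambda>x. g (x + v)) g \<le> ennreal \<omega>"
    by auto
  moreover obtain \<delta>2 where "\<delta>2 > 0" "\<And>v. norm v < \<delta>2 \<Longrightarrow> L2_distance2 (\<lambda>x. g (x + v)) g \<le> ennreal \<omega>"
    using L2_translation_continuous[of g \<omega>] insert.prems \<open>\<omega> > 0\<close> by auto
  ultimately show ?case by (intro exI[of _ "min \<delta>1 \<delta>2"]) auto
qed (auto intro: exI[of _ 1])

lemma integrable_mult_test_function_square:
  fixes u f :: "'a::euclidean_space \<Rightarrow> real"
  assumes u: "integrable lborel (\<lambda>x. (u x)\<^sup>2)" and f: "f \<in> test_functions S"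
  shows "integrable lborel (\<lambda>x. (u x * f x)\<^sup>2)"
proof -
  have "(\<lambda>x. f x *\<^sub>R f x) \<in> test_functions S" by (rule test_functions_scaleR[OF f test_functions_smooth[OF f]])
  from integrable_mult_test_function(1)[OF this u] show ?thesis
    by (simp add: power2_eq_square algebra_simps)
qed

text \<open>The inequality between the arithmetic and the geometric mean stands in for the Cauchy-Schwarz
  inequality: if one factor is bounded and the other is small in \<open>L\<^sup>2\<close>, then a suitable weight \<open>\<mu>\<close> makes
  the product small in \<open>L\<^sup>1\<close>.\<close>

lemma nn_integral_abs_mult_le:
  fixes a b :: "'a \<Rightarrow> real"
  assumes [measurable]: "a \<in> borel_measurable M" "b \<in> borel_measurable M"
    and A: "(\<integral>\<^sup>+x. ennreal ((a x)\<^sup>2) \<partial>M) \<le> ennreal A" "A \<ge> 0"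
    and B: "(\<integral>\<^sup>+x. ennreal ((b x)\<^sup>2) \<partial>M) \<le> ennreal B" "B \<ge> 0" and "\<mu> > 0"
  shows "(\<integral>\<^sup>+x. ennreal \<bar>a x * b x\<bar> \<partial>M) \<le> ennreal (\<mu> / 2 * A + B / (2 * \<mu>))"
proof -
  have "(\<integral>\<^sup>+x. ennreal \<bar>a x * b x\<bar> \<partial>M) \<le>
      (\<integral>\<^sup>+x. ennreal (\<mu> / 2) * ennreal ((a x)\<^sup>2) + ennreal (1 / (2 * \<mu>)) * ennreal ((b x)\<^sup>2) \<partial>M)"
  proof (rule nn_integral_mono)
    fix x
    have "2 * (\<mu> * \<bar>a x\<bar>) * \<bar>b x\<bar> \<le> (\<mu> * \<bar>a x\<bar>)\<^sup>2 + \<bar>b x\<bar>\<^sup>2" by (rule sum_squares_bound)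
    then have "\<bar>a x * b x\<bar> \<le> \<mu> / 2 * (a x)\<^sup>2 + 1 / (2 * \<mu>) * (b x)\<^sup>2"
      using \<open>\<mu> > 0\<close> by (simp add: abs_mult power_mult_distrib field_simps power2_eq_square)
    then have "ennreal \<bar>a x * b x\<bar> \<le> ennreal (\<mu> / 2 * (a x)\<^sup>2 + 1 / (2 * \<mu>) * (b x)\<^sup>2)" by (rule ennreal_leI)
    also have "\<dots> = ennreal (\<mu> / 2) * ennreal ((a x)\<^sup>2) + ennreal (1 / (2 * \<mu>)) * ennreal ((b x)\<^sup>2)"
      using \<open>\<mu> > 0\<close> by (simp add: ennreal_mult[symmetric] ennreal_plus[symmetric] del: ennreal_plus)
    finally show "ennreal \<bar>a x * b x\<bar> \<le> \<dots>" .
  qed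
  also have "\<dots> = ennreal (\<mu> / 2) * (\<integral>\<^sup>+x. ennreal ((a x)\<^sup>2) \<partial>M) + ennreal (1 / (2 * \<mu>)) * (\<integral>\<^sup>+x. ennreal ((b x)\<^sup>2) \<partial>M)"
    by (simp add: nn_integral_add nn_integral_cmult)
  also have "\<dots> \<le> ennreal (\<mu> / 2) * ennreal A + ennreal (1 / (2 * \<mu>)) * ennreal B"
    by (intro add_mono mult_left_mono A B) auto
  also have "\<dots> = ennreal (\<mu> / 2 * A + B / (2 * \<mu>))"
    using assms by (simp add: ennreal_mult[symmetric] ennreal_plus[symmetric] del: ennreal_plus)
  finally show ?thesis .
qed

lemma nn_integral_abs_le_square:
  fixes d :: "'a \<Rightarrow> real"
  assumes "d \<in> borel_measurable M" "emeasure M (space M) \<le> ennreal m" "m \<ge> 0"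
    "(\<integral>\<^sup>+x. ennreal ((d x)\<^sup>2) \<partial>M) \<le> ennreal \<omega>" "\<omega> \<ge> 0" "\<mu> > 0"
  shows "(\<integral>\<^sup>+x. ennreal \<bar>d x\<bar> \<partial>M) \<le> ennreal (\<mu> / 2 * m + \<omega> / (2 * \<mu>))"
  using nn_integral_abs_mult_le[of "\<lambda>_. 1" M d m \<omega> \<mu>] assms by simp

lemma divergence_sum:
  assumes "\<And>i. i \<in> I \<Longrightarrow> smooth (F i)"
  shows "divergence (\<lambda>x. \<Sum>i\<in>I. F i x) x = (\<Sum>i\<in>I. divergence (F i) x)"
proof -
  have "\<partial> v (\<lambda>x. \<Sum>i\<in>I. F i x) x = (\<Sum>i\<in>I. \<partial> v (F i) x)" for v
  proof -
    have "((\<lambda>x. \<Sum>i\<in>I. F i x) has_derivative (\<lambda>v. \<Sum>i\<in>I. \<partial> v (F i) x)) (at x)"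
      by (intro has_derivative_sum smooth_has_derivative assms)
    from frechet_derivative_at[OF this, symmetric] show ?thesis by simp
  qed
  then show ?thesis
    unfolding divergence_def by (simp add: inner_sum_left sum.swap[of _ I])
qed

lemma directional_translate:
  assumes "smooth F"
  shows "\<partial> v (\<lambda>y. F (y - s)) y = \<partial> v F (y - s)"
proof -
  have "((\<lambda>y. F (y - s)) has_derivative (\<lambda>v. frechet_derivative F (at (y - s)) v)) (at y)"
    by (rule has_derivative_compose[OF _ smooth_has_derivative[OF assms]]) (auto intro!: derivative_eq_intros)
  from frechet_derivative_at[OF this, symmetric] show ?thesis by simp
qed

lemma smooth_translate: "smooth F \<Longrightarrow> smooth (\<lambda>y. F (y + s))"
  using smooth_affine_comp[of F s 1] by (simp add: add.commute)

lemma convolution_inner: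
  fixes f :: "'a::euclidean_space \<Rightarrow> 'b::euclidean_space"
  assumes "f \<in> test_functions S" "integrable lborel g"
  shows "convolution f g x \<bullet> b = convolution (\<lambda>x. f x \<bullet> b) g x"
  unfolding convolution_def
  using integral_inner_left[OF convolution_test_integrable[OF assms]] by simp

lemma divergence_shifted_convolution:
  fixes \<phi> :: "'a::euclidean_space \<Rightarrow> 'a"
  assumes \<phi>: "\<phi> \<in> test_functions S" and \<rho>: "integrable lborel \<rho>"
  shows "divergence (\<lambda>y. convolution \<phi> \<rho> (y - s)) y = convolution (divergence \<phi>) \<rho> (y - s)"
proof -
  have d: "\<partial> b \<phi> \<in> test_functions S" for b by (rule test_functions_directional[OF \<phi>])
  have t: "(\<lambda>x. \<partial> b \<phi> x \<bullet> b) \<in> test_functions S" for b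
    by (rule test_functions_supported_mult[OF d[of b] smooth_inner[OF test_functions_smooth[OF d] smooth_const]]) simp
  have "divergence (\<lambda>y. convolution \<phi> \<rho> (y - s)) y = (\<Sum>b\<in>Basis. convolution (\<lambda>x. \<partial> b \<phi> x \<bullet> b) \<rho> (y - s))"
    unfolding divergence_def
    by (simp add: directional_translate[OF smooth_convolution[OF \<phi> \<rho>]] fun_cong[OF directional_convolution[OF \<phi> \<rho>]]
        convolution_inner[OF d \<rho>])
  also have "\<dots> = convolution (divergence \<phi>) \<rho> (y - s)"
    using convolution_test_integrable[OF t \<rho>]
    by (simp add: convolution_def divergence_def sum_distrib_left)
  finally show ?thesis .
qed

section \<open>Strict approximation by smooth functions\<close>

lemma shifted_convolution_test:
  fixes f :: "'a::euclidean_space \<Rightarrow> 'b::euclidean_space"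
  assumes f: "f \<in> test_functions UNIV" and g: "integrable lborel g" and K: "compact K" "\<And>y. y \<notin> K \<Longrightarrow> g y = 0"
  shows "(\<lambda>x. convolution f g (x + s)) \<in> test_functions UNIV"
proof -
  obtain L where L: "compact L" "\<And>x. x \<notin> L \<Longrightarrow> f x = 0" using test_functionsE[OF f] by metis
  have cpt: "compact ((\<lambda>z. z - s) ` {x + y | x y. x \<in> L \<and> y \<in> K})"
    by (intro compact_continuous_image compact_sums L K continuous_intros)
  show ?thesis
  proof (rule test_functionsI[OF smooth_translate[OF smooth_convolution[OF f g]] cpt])
    fix x assume x: "x \<notin> (\<lambda>z. z - s) ` {x + y | x y. x \<in> L \<and> y \<in> K}"
    show "convolution f g (x + s) = 0"
    proof (rule convolution_eq_0)
      fix a b assume ab: "f a \<noteq> 0" "g b \<noteq> 0"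
      show "a + b \<noteq> x + s"
      proof
        assume "a + b = x + s"
        then have "x = (a + b) - s" by simp
        with ab L(2) K(2) have "x \<in> (\<lambda>z. z - s) ` {x + y | x y. x \<in> L \<and> y \<in> K}" by blast
        with x show False by simp
      qed
    qed
  qed simp
qed

text \<open>Smooth functions are dense in energy: the strict approximation theorem for functions of bounded
  variation on a Lipschitz domain. The piece \<open>\<zeta>\<^sub>i u\<close> is shifted out of the domain by \<open>t\<close>
  along its chart direction, and then mollified at a scale that is a fixed fraction of \<open>t\<close>. By
  duality this turns a test field \<open>\<phi>\<close> into the field \<open>\<psi> = \<Sum> \<zeta>\<^sub>i \<Phi>\<^sub>i\<close>, where \<open>\<Phi>\<^sub>i\<close> is \<open>\<phi>\<close>
  mollified and shifted into the domain, so \<open>\<psi>\<close> is again an admissible test field on \<open>\<Omega>\<close>. The error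
  comes from the derivatives of the \<open>\<zeta>\<^sub>i\<close>, and it is small because these add up to 0 on \<open>\<Omega>\<close>.\<close>

lemma smooth_strict_approximation:
  fixes \<Omega> :: "'a::euclidean_space set" and u :: "'a \<Rightarrow> real"
  assumes dom: "bounded_lipschitz_domain \<Omega>" and um[measurable]: "u \<in> borel_measurable borel"
    and u0: "\<And>x. x \<notin> \<Omega> \<Longrightarrow> u x = 0"
    and u1: "integrable lborel u" and u2: "integrable lborel (\<lambda>x. (u x)\<^sup>2)"
    and V: "\<And>\<phi>. \<phi> \<in> test_functions \<Omega> \<Longrightarrow> (\<And>x. norm (\<phi> x) \<le> 1) \<Longrightarrow> - (\<integral>x. u x * divergence \<phi> x \<partial>lborel) \<le> V"
    and \<eta>: "\<eta> > 0"
  obtains w where "w \<in> test_functions UNIV" "L2_distance2 w u \<le> ennreal \<eta>"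
    "(\<integral>\<^sup>+x. ennreal (norm (gradient w x)) \<partial>lebesgue_on \<Omega>) \<le> ennreal (V + \<eta>)"
proof -
  have \<Omega>: "open \<Omega>" "bounded \<Omega>" using dom by (auto simp: bounded_lipschitz_domain_def)
  have [measurable]: "\<Omega> \<in> sets borel" using \<Omega> by simp
  define m where "m = measure lborel \<Omega>"
  have m: "emeasure lborel \<Omega> \<le> ennreal m" "m \<ge> 0"
    using emeasure_bounded_finite[OF \<Omega>(2)] by (auto simp: m_def emeasure_eq_ennreal_measure)
  obtain c \<delta> \<zeta> n e K where part: "0 < c" "c \<le> 1" "0 < (\<delta>::real)"
    "\<And>i. \<zeta> i \<in> test_functions UNIV" "\<And>i x. 0 \<le> \<zeta> i x"
    "\<And>x. (\<Sum>i<n. \<zeta> i x) \<le> 1" "\<And>x. x \<in> \<Omega> \<Longrightarrow> (\<Sum>i<n::nat. \<zeta> i x) = (1::real)"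
    "\<And>i. norm (e i) \<le> 1" "\<And>i. compact (K i)" "\<And>i x. x \<notin> K i \<Longrightarrow> \<zeta> i x = 0"
    "\<And>i x z t. x \<in> \<Omega> \<Longrightarrow> 0 < t \<Longrightarrow> t < \<delta> \<Longrightarrow> norm z \<le> c * t \<Longrightarrow> x + z + t *\<^sub>R e i \<in> K i \<Longrightarrow> x + z + t *\<^sub>R e i \<in> \<Omega>"
    by (rule inward_partition_of_unity[OF dom], rule that) assumption+
  have sm\<zeta>: "smooth (\<zeta> i)" for i by (rule test_functions_smooth[OF part(4)])
  have d\<zeta>: "\<partial> b (\<zeta> i) \<in> test_functions UNIV" for i b by (rule test_functions_directional[OF part(4)])
  define g where "g i x = u x * \<zeta> i x" for i x
  define H where "H i b x = u x * \<partial> b (\<zeta> i) x" for i b x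
  have g: "integrable lborel (g i)" "integrable lborel (\<lambda>x. (g i x)\<^sup>2)" for i
    unfolding g_def by (rule integrable_mult_test_function(1)[OF part(4) u1] integrable_mult_test_function_square[OF u2 part(4)])+
  have H: "integrable lborel (H i b)" "integrable lborel (\<lambda>x. (H i b x)\<^sup>2)" for i b
    unfolding H_def by (rule integrable_mult_test_function(1)[OF d\<zeta> u1] integrable_mult_test_function_square[OF u2 d\<zeta>])+
  have gm[measurable]: "g i \<in> borel_measurable borel" for i using borel_measurable_integrable[OF g(1)] by simp
  have Hm[measurable]: "H i b \<in> borel_measurable borel" for i b using borel_measurable_integrable[OF H(1)] by simp
  have g_sum: "(\<Sum>i<n. g i x) = u x" for x
    using part(7)[of x] u0[of x] by (cases "x \<in> \<Omega>") (simp_all add: g_def sum_distrib_left[symmetric])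
  \<comment> \<open>\<open>\<tau>\<close> is the admissible \<open>L\<^sup>1\<close> error for each of the \<open>n DIM('a)\<close> functions \<open>H i b\<close>.\<close>
  define \<tau> where "\<tau> = \<eta> / (real n * DIM('a) + 1)"
  have \<tau>: "\<tau> > 0" "real n * DIM('a) * \<tau> \<le> \<eta>"
  proof -
    have p: "real n * DIM('a) + 1 > 0" by (intro add_nonneg_pos) auto
    then show "\<tau> > 0" using \<eta> by (simp add: \<tau>_def)
    show "real n * DIM('a) * \<tau> \<le> \<eta>" unfolding \<tau>_def using p \<eta> by (simp add: field_simps)
  qed
  define \<mu> where "\<mu> = \<tau> / (m + 1)"
  have \<mu>: "\<mu> > 0" "\<mu> / 2 * m + \<tau> * \<mu> / (2 * \<mu>) \<le> \<tau>"
  proof -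
    show "\<mu> > 0" using \<tau> m by (simp add: \<mu>_def)
    have "\<mu> * m = \<tau> * (m / (m + 1))" by (simp add: \<mu>_def)
    also have "\<dots> \<le> \<tau> * 1" using \<tau> m by (intro mult_left_mono) auto
    finally show "\<mu> / 2 * m + \<tau> * \<mu> / (2 * \<mu>) \<le> \<tau>" using \<open>\<mu> > 0\<close> by simp
  qed
  define \<omega> where "\<omega> = min (\<eta> / (real n * real n + 1)) (\<tau> * \<mu>)"
  have \<omega>: "\<omega> > 0" "\<omega> \<le> \<tau> * \<mu>" "real n * (real n * \<omega>) \<le> \<eta>"
  proof -
    have p: "real n * real n + 1 > 0" by (intro add_nonneg_pos) auto
    then show "\<omega> > 0" "\<omega> \<le> \<tau> * \<mu>" using \<eta> \<tau> \<mu> by (auto simp: \<omega>_def)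
    have "real n * real n * \<omega> \<le> real n * real n * (\<eta> / (real n * real n + 1))"
      by (intro mult_left_mono) (auto simp: \<omega>_def)
    also have "\<dots> \<le> \<eta>" using p \<eta> by (simp add: field_simps)
    finally show "real n * (real n * \<omega>) \<le> \<eta>" by (simp add: mult.assoc)
  qed
  define F where "F = g ` {..<n} \<union> (\<lambda>(i, b). H i b) ` ({..<n} \<times> Basis)"
  have "\<exists>\<delta>>0. \<forall>f\<in>F. \<forall>v. norm v < \<delta> \<longrightarrow> L2_distance2 (\<lambda>x. f (x + v)) f \<le> ennreal \<omega>"
    by (rule L2_translation_continuous_finite[OF _ _ \<omega>(1)]) (auto simp: F_def g H)
  then obtain \<delta>0 where \<delta>0: "\<delta>0 > 0" "\<And>f v. f \<in> F \<Longrightarrow> norm v < \<delta>0 \<Longrightarrow> L2_distance2 (\<lambda>x. f (x + v)) f \<le> ennreal \<omega>"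
    by blast
  define t where "t = min (\<delta> / 2) (\<delta>0 / 3)"
  have t: "0 < t" "t < \<delta>" "t + c * t < \<delta>0"
  proof -
    show "0 < t" "t < \<delta>" using part(3) \<delta>0(1) by (auto simp: t_def)
    have "c * t \<le> 1 * t" using part(2) \<open>0 < t\<close> by (intro mult_right_mono) auto
    moreover have "t \<le> \<delta>0 / 3" by (simp add: t_def)
    ultimately show "t + c * t < \<delta>0" using \<delta>0(1) by linarith
  qed
  have "c * t > 0" using part(1) t(1) by simp
  then obtain \<rho> :: "'a \<Rightarrow> real" where \<rho>: "mollifier (c * t) \<rho>" using mollifier_exists by blast
  have \<rho>t: "\<rho> \<in> test_functions UNIV" and \<rho>i: "integrable lborel \<rho>" using mollifierD[OF \<rho>] by auto
  have \<rho>m[measurable]: "\<rho> \<in> borel_measurable borel" by (rule test_functions_borel[OF \<rho>t])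
  have err: "L2_distance2 (\<lambda>x. convolution \<rho> f (x + t *\<^sub>R e i)) f \<le> ennreal \<omega>"
    if "f \<in> F" "integrable lborel f" "integrable lborel (\<lambda>x. (f x)\<^sup>2)" for f i
  proof (rule L2_mollification_error[OF \<rho> that(2,3)])
    fix v :: 'a assume "norm v \<le> norm (t *\<^sub>R e i) + c * t"
    moreover have "norm (t *\<^sub>R e i) \<le> t" using part(8)[of i] t(1) by (simp add: mult_left_le)
    ultimately show "L2_distance2 (\<lambda>x. f (x + v)) f \<le> ennreal \<omega>"
      using t(3) by (intro \<delta>0(2) that(1)) linarith
  qed
  define w where "w x = (\<Sum>i<n. convolution \<rho> (g i) (x + t *\<^sub>R e i))" for x
  have conv_test: "(\<lambda>x. convolution \<rho> (g i) (x + t *\<^sub>R e i)) \<in> test_functions UNIV" for i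
    by (rule shifted_convolution_test[OF \<rho>t g(1) part(9)[of i]]) (simp add: g_def part(10))
  have wt: "w \<in> test_functions UNIV"
    unfolding w_def[abs_def] by (intro test_functions_sum conv_test)
  have cm[measurable]: "(\<lambda>x. convolution \<rho> (g i) (x + t *\<^sub>R e i)) \<in> borel_measurable borel" for i
    by (rule test_functions_borel[OF conv_test])
  have L2w: "L2_distance2 w u \<le> ennreal \<eta>"
  proof -
    have "L2_distance2 w u \<le> (\<integral>\<^sup>+x. (\<Sum>i<n. ennreal (real n) * ennreal ((convolution \<rho> (g i) (x + t *\<^sub>R e i) - g i x)\<^sup>2)) \<partial>lborel)"
    proof (rule nn_integral_mono)
      fix x
      have "w x - u x = (\<Sum>i<n. convolution \<rho> (g i) (x + t *\<^sub>R e i) - g i x)"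
        by (simp add: w_def sum_subtractf g_sum)
      then have "(w x - u x)\<^sup>2 \<le> (\<Sum>i<n. real n * (convolution \<rho> (g i) (x + t *\<^sub>R e i) - g i x)\<^sup>2)"
        using sum_squared_le_sum_of_squares[of "\<lambda>i. convolution \<rho> (g i) (x + t *\<^sub>R e i) - g i x" "{..<n}"]
        by (simp add: sum_distrib_left[symmetric] mult.commute)
      then have "ennreal ((w x - u x)\<^sup>2) \<le> ennreal (\<Sum>i<n. real n * (convolution \<rho> (g i) (x + t *\<^sub>R e i) - g i x)\<^sup>2)"
        by (rule ennreal_leI)
      also have "\<dots> = (\<Sum>i<n. ennreal (real n) * ennreal ((convolution \<rho> (g i) (x + t *\<^sub>R e i) - g i x)\<^sup>2))"
        by (subst sum_ennreal[symmetric]) (auto simp: ennreal_mult)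
      finally show "ennreal ((w x - u x)\<^sup>2) \<le> \<dots>" .
    qed
    also have "\<dots> = (\<Sum>i<n. ennreal (real n) * L2_distance2 (\<lambda>x. convolution \<rho> (g i) (x + t *\<^sub>R e i)) (g i))"
      by (simp add: nn_integral_sum nn_integral_cmult)
    also have "\<dots> \<le> (\<Sum>i<n. ennreal (real n) * ennreal \<omega>)"
      by (intro sum_mono mult_left_mono err g) (auto simp: F_def)
    also have "\<dots> = ennreal (real n * (real n * \<omega>))"
      using \<omega>(1) by (simp add: ennreal_mult ennreal_of_nat_eq_real_of_nat)
    also have "\<dots> \<le> ennreal \<eta>" using \<omega>(3) by (rule ennreal_leI)
    finally show ?thesis .
  qed
  have bound: "- (\<integral>x. w x * divergence \<phi> x \<partial>lborel) \<le> V + \<eta>"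
    if \<phi>: "\<phi> \<in> test_functions \<Omega>" and \<phi>1: "\<And>x. norm (\<phi> x) \<le> 1" for \<phi>
  proof -
    define h where "h = divergence \<phi>"
    have ht: "h \<in> test_functions \<Omega>" unfolding h_def by (rule test_functions_divergence[OF \<phi>])
    have hi: "integrable lborel h" by (rule test_functions_integrable[OF ht])
    define \<Phi> where "\<Phi> i y = convolution \<phi> \<rho> (y - t *\<^sub>R e i)" for i y
    have sm\<Phi>: "smooth (\<Phi> i)" for i
      using smooth_translate[OF smooth_convolution[OF \<phi> \<rho>i], of "- t *\<^sub>R e i"] by (simp add: \<Phi>_def[abs_def])
    have div\<Phi>: "divergence (\<Phi> i) y = convolution h \<rho> (y - t *\<^sub>R e i)" for i y
      unfolding \<Phi>_def[abs_def] h_def by (rule divergence_shifted_convolution[OF \<phi> \<rho>i])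
    define \<psi> where "\<psi> x = (\<Sum>i<n. \<zeta> i x *\<^sub>R \<Phi> i x)" for x
    have \<psi>i: "(\<lambda>x. \<zeta> i x *\<^sub>R \<Phi> i x) \<in> test_functions \<Omega>" for i
    proof -
      obtain S where S: "compact S" "S \<subseteq> \<Omega>" "\<And>x. x \<notin> S \<Longrightarrow> \<phi> x = 0" using test_functionsE[OF \<phi>] by metis
      define S' where "S' = (\<lambda>z. z + t *\<^sub>R e i) ` {x + y | x y. x \<in> S \<and> y \<in> cball (0::'a) (c * t)}"
      have "compact S'" unfolding S'_def
        by (intro compact_continuous_image compact_plus_cball S continuous_intros)
      then have cpt: "compact (K i \<inter> S')" using part(9) by (intro compact_Int)
      show ?thesis
      proof (rule test_functionsI[OF smooth_scaleR[OF sm\<zeta> sm\<Phi>] cpt])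
        show "K i \<inter> S' \<subseteq> \<Omega>"
        proof
          fix y assume y: "y \<in> K i \<inter> S'"
          then obtain x z where xz: "y = x + z + t *\<^sub>R e i" "x \<in> S" "norm z \<le> c * t" by (auto simp: S'_def)
          have "x + z + t *\<^sub>R e i \<in> \<Omega>" using y xz S(2) by (intro part(11)[OF _ t(1,2) xz(3)]) auto
          then show "y \<in> \<Omega>" using xz(1) by simp
        qed
        fix y assume y: "y \<notin> K i \<inter> S'"
        show "\<zeta> i y *\<^sub>R \<Phi> i y = 0"
        proof (cases "y \<in> K i")
          case True
          with y have "y \<notin> S'" by blast
          have "convolution \<phi> \<rho> (y - t *\<^sub>R e i) = 0"
          proof (rule convolution_eq_0)
            fix a b assume ab: "\<phi> a \<noteq> 0" "\<rho> b \<noteq> 0"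
            have a: "a \<in> S" using ab S(3) by blast
            have b: "b \<in> cball 0 (c * t)" using mollifierD(4)[OF \<rho> ab(2)] by simp
            show "a + b \<noteq> y - t *\<^sub>R e i"
            proof
              assume "a + b = y - t *\<^sub>R e i"
              then have "y = (a + b) + t *\<^sub>R e i" by simp
              with a b have "y \<in> S'" unfolding S'_def by blast
              with \<open>y \<notin> S'\<close> show False by simp
            qed
          qed
          then show ?thesis by (simp add: \<Phi>_def)
        qed (simp add: part(10))
      qed
    qed
    have \<psi>t: "\<psi> \<in> test_functions \<Omega>" unfolding \<psi>_def[abs_def] by (intro test_functions_sum \<psi>i)
    have \<psi>1: "norm (\<psi> x) \<le> 1" for x
    proof -
      have "norm (\<Phi> i x) \<le> 1" for i
        unfolding \<Phi>_def by (rule norm_mollification_le[OF test_functions_borel[OF \<phi>] \<phi>1 \<rho>])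
      then have "norm (\<zeta> i x *\<^sub>R \<Phi> i x) \<le> \<zeta> i x" for i
        using part(5)[of i x] by (simp add: mult_left_le)
      then have "norm (\<psi> x) \<le> (\<Sum>i<n. \<zeta> i x)" unfolding \<psi>_def by (intro sum_norm_le)
      then show ?thesis using part(6)[of x] by linarith
    qed
    have \<phi>b: "(\<lambda>x. \<phi> x \<bullet> b) \<in> test_functions \<Omega>" for b
      by (rule test_functions_supported_mult[OF \<phi> smooth_inner[OF test_functions_smooth[OF \<phi>] smooth_const]]) simp
    have div\<psi>: "u x * divergence \<psi> x = (\<Sum>i<n. g i x * convolution h \<rho> (x - t *\<^sub>R e i)) +
        (\<Sum>i<n. \<Sum>b\<in>Basis. H i b x * convolution (\<lambda>x. \<phi> x \<bullet> b) \<rho> (x - t *\<^sub>R e i))" for x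
    proof -
      have "divergence \<psi> x = (\<Sum>i<n. \<zeta> i x * divergence (\<Phi> i) x + gradient (\<zeta> i) x \<bullet> \<Phi> i x)"
        unfolding \<psi>_def[abs_def]
        by (simp add: divergence_sum[OF smooth_scaleR[OF sm\<zeta> sm\<Phi>]] divergence_scaleR[OF sm\<zeta> sm\<Phi>])
      then show ?thesis
        by (simp add: sum.distrib distrib_left sum_distrib_left gradient_inner div\<Phi> g_def H_def \<Phi>_def
            convolution_inner[OF \<phi> \<rho>i] mult.assoc)
    qed
    have i1: "integrable lborel (\<lambda>x. g i x * convolution h \<rho> (x - t *\<^sub>R e i))" for i
    proof -
      have "smooth (\<lambda>x. convolution h \<rho> (x - t *\<^sub>R e i))"
        using smooth_translate[OF smooth_convolution[OF ht \<rho>i], of "- t *\<^sub>R e i"] by simp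
      from integrable_mult_test_function(1)[OF test_functions_scaleR_left[OF part(4) this] u1]
      show ?thesis by (simp add: g_def mult.assoc)
    qed
    have i2: "integrable lborel (\<lambda>x. H i b x * convolution (\<lambda>x. \<phi> x \<bullet> b) \<rho> (x - t *\<^sub>R e i))" for i b
    proof -
      have "smooth (\<lambda>x. convolution (\<lambda>x. \<phi> x \<bullet> b) \<rho> (x - t *\<^sub>R e i))"
        using smooth_translate[OF smooth_convolution[OF \<phi>b \<rho>i], where s="- t *\<^sub>R e i"] by simp
      from integrable_mult_test_function(1)[OF test_functions_scaleR_left[OF d\<zeta> this] u1]
      show ?thesis by (simp add: H_def mult.assoc)
    qed
    have "(\<integral>x. w x * h x \<partial>lborel) = (\<Sum>i<n. \<integral>x. convolution \<rho> (g i) (x + t *\<^sub>R e i) * h x \<partial>lborel)"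
    proof -
      have "integrable lborel (\<lambda>x. convolution \<rho> (g i) (x + t *\<^sub>R e i) * h x)" for i
        using test_functions_integrable[OF test_functions_scaleR[OF ht test_functions_smooth[OF conv_test]]] by simp
      then show ?thesis by (simp add: w_def sum_distrib_right)
    qed
    also have "\<dots> = (\<Sum>i<n. \<integral>y. g i y * convolution h \<rho> (y - t *\<^sub>R e i) \<partial>lborel)"
      by (intro sum.cong refl convolution_adjoint[OF \<rho> g(1) hi])
    finally have wh: "(\<integral>x. w x * h x \<partial>lborel) = (\<Sum>i<n. \<integral>y. g i y * convolution h \<rho> (y - t *\<^sub>R e i) \<partial>lborel)" .
    have udiv: "(\<integral>x. u x * divergence \<psi> x \<partial>lborel) = (\<integral>x. w x * h x \<partial>lborel) +
        (\<Sum>i<n. \<Sum>b\<in>Basis. \<integral>y. H i b y * convolution (\<lambda>x. \<phi> x \<bullet> b) \<rho> (y - t *\<^sub>R e i) \<partial>lborel)"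
      unfolding div\<psi> wh using i1 i2 by (simp add: Bochner_Integration.integral_sum)
    have adj: "(\<integral>y. H i b y * convolution (\<lambda>x. \<phi> x \<bullet> b) \<rho> (y - t *\<^sub>R e i) \<partial>lborel) =
        (\<integral>x. convolution \<rho> (H i b) (x + t *\<^sub>R e i) * (\<phi> x \<bullet> b) \<partial>lborel)" for i b
      by (rule convolution_adjoint[OF \<rho> H(1) test_functions_integrable[OF \<phi>b], symmetric])
    have j1: "integrable lborel (\<lambda>x. convolution \<rho> (H i b) (x + t *\<^sub>R e i) * (\<phi> x \<bullet> b))" for i b
      using test_functions_integrable[OF test_functions_scaleR[OF \<phi>b smooth_translate[OF smooth_convolution[OF \<rho>t H(1)]]]] by simp
    have j2: "integrable lborel (\<lambda>x. H i b x * (\<phi> x \<bullet> b))" for i b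
      by (rule integrable_mult_test_function(1)[OF \<phi>b H(1)])
    have H0: "(\<Sum>i<n. H i b x) = 0" for b x
    proof (cases "x \<in> \<Omega>")
      case True
      have "((\<lambda>_. 1) has_derivative (\<lambda>_. 0)) (at x)" by simp
      then have "((\<lambda>x. \<Sum>i<n. \<zeta> i x) has_derivative (\<lambda>_. 0)) (at x)"
        by (rule has_derivative_transform_within_open[OF _ \<Omega>(1) True]) (simp add: part(7))
      moreover have "((\<lambda>x. \<Sum>i<n. \<zeta> i x) has_derivative (\<lambda>v. \<Sum>i<n. \<partial> v (\<zeta> i) x)) (at x)"
        by (intro has_derivative_sum smooth_has_derivative sm\<zeta>)
      ultimately have "(\<lambda>_. 0) = (\<lambda>v. \<Sum>i<n. \<partial> v (\<zeta> i) x)" by (rule has_derivative_unique)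
      then have "(\<Sum>i<n. \<partial> b (\<zeta> i) x) = 0" by (rule fun_cong[symmetric])
      then show ?thesis by (simp add: H_def sum_distrib_left[symmetric])
    qed (simp add: H_def u0)
    have "(\<Sum>i<n. \<integral>x. H i b x * (\<phi> x \<bullet> b) \<partial>lborel) = 0" for b
    proof -
      have "(\<Sum>i<n. \<integral>x. H i b x * (\<phi> x \<bullet> b) \<partial>lborel) = (\<integral>x. (\<Sum>i<n. H i b x) * (\<phi> x \<bullet> b) \<partial>lborel)"
        using j2 by (simp add: sum_distrib_right Bochner_Integration.integral_sum)
      then show ?thesis by (simp add: H0)
    qed
    then have zero: "(\<Sum>i<n. \<Sum>b\<in>Basis. \<integral>x. H i b x * (\<phi> x \<bullet> b) \<partial>lborel) = 0"
      by (subst sum.swap) simp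
    have small: "(\<integral>x. convolution \<rho> (H i b) (x + t *\<^sub>R e i) * (\<phi> x \<bullet> b) \<partial>lborel) - (\<integral>x. H i b x * (\<phi> x \<bullet> b) \<partial>lborel) \<le> \<tau>"
      if "i < n" "b \<in> Basis" for i b
    proof -
      define d where "d x = convolution \<rho> (H i b) (x + t *\<^sub>R e i) - H i b x" for x
      have [measurable]: "d \<in> borel_measurable borel"
        unfolding d_def[abs_def]
        using smooth_borel[OF smooth_translate[OF smooth_convolution[OF \<rho>t H(1)]]] by measurable
      have int: "integrable lborel (\<lambda>x. d x * (\<phi> x \<bullet> b))" unfolding d_def left_diff_distrib
        by (intro Bochner_Integration.integrable_diff j1 j2)
      have "(\<integral>\<^sup>+x. ennreal ((d x)\<^sup>2) \<partial>lebesgue_on \<Omega>) \<le> L2_distance2 (\<lambda>x. convolution \<rho> (H i b) (x + t *\<^sub>R e i)) (H i b)"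
        unfolding d_def nn_integral_lebesgue_on[OF \<Omega>(1)] by (intro nn_integral_mono) (auto simp: indicator_def)
      also have "\<dots> \<le> ennreal \<omega>" by (intro err H) (use that in \<open>auto simp: F_def\<close>)
      also have "\<dots> \<le> ennreal (\<tau> * \<mu>)" using \<omega>(2) by (rule ennreal_leI)
      finally have d2: "(\<integral>\<^sup>+x. ennreal ((d x)\<^sup>2) \<partial>lebesgue_on \<Omega>) \<le> ennreal (\<tau> * \<mu>)" .
      have "ennreal (\<integral>x. d x * (\<phi> x \<bullet> b) \<partial>lborel) \<le> ennreal \<bar>\<integral>x. d x * (\<phi> x \<bullet> b) \<partial>lborel\<bar>" by (intro ennreal_leI) simp
      also have "\<dots> \<le> (\<integral>\<^sup>+x. ennreal (norm (d x * (\<phi> x \<bullet> b))) \<partial>lborel)"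
        using integral_norm_bound_ennreal[OF int] by simp
      also have "\<dots> \<le> (\<integral>\<^sup>+x. ennreal \<bar>d x\<bar> * indicator \<Omega> x \<partial>lborel)"
      proof (rule nn_integral_mono)
        fix x
        show "ennreal (norm (d x * (\<phi> x \<bullet> b))) \<le> ennreal \<bar>d x\<bar> * indicator \<Omega> x"
        proof (cases "x \<in> \<Omega>")
          case True
          have "\<bar>\<phi> x \<bullet> b\<bar> \<le> 1" using Basis_le_norm[OF that(2), of "\<phi> x"] \<phi>1[of x] by linarith
          then show ?thesis using True by (auto simp: abs_mult intro!: ennreal_leI mult_left_le)
        next
          case False
          then have "\<phi> x = 0" by (rule test_functions_eq_0[OF \<phi>])
          then show ?thesis by simp
        qed
      qed
      also have "\<dots> \<le> ennreal (\<mu> / 2 * m + \<tau> * \<mu> / (2 * \<mu>))"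
        unfolding nn_integral_lebesgue_on[OF \<Omega>(1), symmetric]
      proof (rule nn_integral_abs_le_square[OF _ _ m(2) d2])
        show "d \<in> borel_measurable (lebesgue_on \<Omega>)"
          by (intro lebesgue_on_measurable) simp
        show "emeasure (lebesgue_on \<Omega>) (space (lebesgue_on \<Omega>)) \<le> ennreal m"
          using m(1) by (simp add: emeasure_restrict_space)
      qed (use \<tau> \<mu> in auto)
      also have "\<dots> \<le> ennreal \<tau>" using \<mu>(2) by (rule ennreal_leI)
      finally have "(\<integral>x. d x * (\<phi> x \<bullet> b) \<partial>lborel) \<le> \<tau>" using \<tau>(1) by simp
      then show ?thesis using j1 j2 by (simp add: d_def left_diff_distrib)
    qed
    have "(\<Sum>i<n. \<Sum>b\<in>Basis. \<integral>y. H i b y * convolution (\<lambda>x. \<phi> x \<bullet> b) \<rho> (y - t *\<^sub>R e i) \<partial>lborel)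
        = (\<Sum>i<n. \<Sum>b\<in>Basis. (\<integral>x. convolution \<rho> (H i b) (x + t *\<^sub>R e i) * (\<phi> x \<bullet> b) \<partial>lborel) - (\<integral>x. H i b x * (\<phi> x \<bullet> b) \<partial>lborel))"
      using zero by (simp add: adj sum_subtractf)
    also have "\<dots> \<le> (\<Sum>i<n. \<Sum>b\<in>(Basis::'a set). \<tau>)" by (intro sum_mono small) auto
    also have "\<dots> \<le> \<eta>" using \<tau>(2) by (simp add: mult.assoc)
    finally show ?thesis
      using udiv V[OF \<psi>t \<psi>1] by (simp add: h_def)
  qed
  have "(\<integral>\<^sup>+x. ennreal (norm (gradient w x)) \<partial>lebesgue_on \<Omega>) \<le> ennreal (V + \<eta>)"
    by (rule gradient_norm_le_variation[OF \<Omega>(1) test_functions_smooth[OF wt] bound])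
  with wt L2w show ?thesis by (rule that)
qed

section \<open>Lower semicontinuity of the limit functional\<close>

lemma total_variation_le_weak_gradient:
  fixes u :: "'a::euclidean_space \<Rightarrow> real"
  assumes u: "u \<in> L1 \<Omega>" and G: "is_weak_gradient \<Omega> u G"
  shows "total_variation \<Omega> u \<le> (\<integral>\<^sup>+x. ennreal (norm (G x)) \<partial>lebesgue_on \<Omega>)"
  unfolding total_variation_def
proof (rule SUP_least)
  fix \<phi> :: "'a \<Rightarrow> 'a" assume "\<phi> \<in> {\<phi> \<in> test_functions \<Omega>. \<forall>x. norm (\<phi> x) \<le> 1}"
  then have \<phi>: "\<phi> \<in> test_functions \<Omega>" "\<And>x. norm (\<phi> x) \<le> 1" by auto
  have sm: "smooth \<phi>" by (rule test_functions_smooth[OF \<phi>(1)])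
  have Gi: "integrable (lebesgue_on \<Omega>) G" using G by (simp add: is_weak_gradient_def)
  have ui: "integrable (lebesgue_on \<Omega>) u" using u by (simp add: L1_def)
  have \<phi>b: "(\<lambda>x. \<phi> x \<bullet> b) \<in> test_functions \<Omega>" for b
    by (rule test_functions_supported_mult[OF \<phi>(1) smooth_inner[OF sm smooth_const]]) simp
  have d: "\<partial> b (\<lambda>x. \<phi> x \<bullet> b) x = \<partial> b \<phi> x \<bullet> b" for b x
    using frechet_derivative_at[OF has_derivative_inner_left[OF smooth_has_derivative[OF sm]], symmetric] by simp
  have "(\<integral>x. u x * divergence \<phi> x \<partial>lebesgue_on \<Omega>) = (\<Sum>b\<in>Basis. \<integral>x. u x * \<partial> b (\<lambda>x. \<phi> x \<bullet> b) x \<partial>lebesgue_on \<Omega>)"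
  proof -
    have "integrable (lebesgue_on \<Omega>) (\<lambda>x. u x * \<partial> b (\<lambda>x. \<phi> x \<bullet> b) x)" for b
      by (rule integrable_mult_test_function(2)[OF test_functions_directional[OF \<phi>b] ui])
    then show ?thesis
      unfolding divergence_def d[symmetric] sum_distrib_left by (simp add: Bochner_Integration.integral_sum)
  qed
  also have "\<dots> = (\<Sum>b\<in>Basis. - (\<integral>x. (G x \<bullet> b) * (\<phi> x \<bullet> b) \<partial>lebesgue_on \<Omega>))"
    using G \<phi>b by (intro sum.cong refl) (simp add: is_weak_gradient_def)
  also have "\<dots> = - (\<integral>x. G x \<bullet> \<phi> x \<partial>lebesgue_on \<Omega>)"
  proof -
    have "integrable (lebesgue_on \<Omega>) (\<lambda>x. (G x \<bullet> b) * (\<phi> x \<bullet> b))" for b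
      using Gi by (intro integrable_mult_test_function(2)[OF \<phi>b]) simp
    moreover have "G x \<bullet> \<phi> x = (\<Sum>b\<in>Basis. (G x \<bullet> b) * (\<phi> x \<bullet> b))" for x by (rule euclidean_inner)
    ultimately show ?thesis by (simp add: Bochner_Integration.integral_sum sum_negf)
  qed
  finally have "distr_derivative \<Omega> u \<phi> = (\<integral>x. G x \<bullet> \<phi> x \<partial>lebesgue_on \<Omega>)" by (simp add: distr_derivative_def)
  also have "ennreal \<dots> \<le> ennreal (\<integral>x. norm (G x) \<partial>lebesgue_on \<Omega>)"
  proof (intro ennreal_leI integral_mono_AE')
    show "integrable (lebesgue_on \<Omega>) (\<lambda>x. norm (G x))" using Gi by simp
    have "G x \<bullet> \<phi> x \<le> norm (G x)" for x
      using norm_cauchy_schwarz[of "G x" "\<phi> x"] mult_left_mono[OF \<phi>(2)[of x] norm_ge_zero[of "G x"]] by simp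
    then show "AE x in lebesgue_on \<Omega>. G x \<bullet> \<phi> x \<le> norm (G x)" by simp
  qed simp
  also have "\<dots> = (\<integral>\<^sup>+x. ennreal (norm (G x)) \<partial>lebesgue_on \<Omega>)"
    using Gi by (intro nn_integral_eq_integral[symmetric]) auto
  finally show "ennreal (distr_derivative \<Omega> u \<phi>) \<le> (\<integral>\<^sup>+x. ennreal (norm (G x)) \<partial>lebesgue_on \<Omega>)" .
qed

text \<open>An integral with values in \<open>[0, \<infinity>]\<close> takes the place of the square of \<^const>\<open>L2_norm\<close>: for
  \<open>f \<in> L\<^sup>2\<close> it is infinite unless \<open>u\<close> belongs to \<open>L\<^sup>2\<close>, so \<^const>\<open>F_ROF\<close> becomes a plain sum on all
  of \<open>L\<^sup>1\<close>.\<close>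

definition fidelity :: "'a::euclidean_space set \<Rightarrow> ('a \<Rightarrow> real) \<Rightarrow> ('a \<Rightarrow> real) \<Rightarrow> ennreal" where
  "fidelity \<Omega> f u = (\<integral>\<^sup>+x. ennreal (1/2 * (u x - f x)\<^sup>2) \<partial>lebesgue_on \<Omega>)"

lemma square_diff_le: "((a::real) - b)\<^sup>2 \<le> 2 * a\<^sup>2 + 2 * b\<^sup>2"
  using sum_squares_bound[of a "- b"] by (simp add: power2_eq_square algebra_simps)

lemma L2_diff_integrable:
  assumes "u \<in> L2 \<Omega>" "f \<in> L2 \<Omega>"
  shows "integrable (lebesgue_on \<Omega>) (\<lambda>x. (u x - f x)\<^sup>2)"
proof (rule Bochner_Integration.integrable_bound)
  show "integrable (lebesgue_on \<Omega>) (\<lambda>x. 2 * (u x)\<^sup>2 + 2 * (f x)\<^sup>2)" using assms by (simp add: L2_def)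
  have [measurable]: "u \<in> borel_measurable (lebesgue_on \<Omega>)" "f \<in> borel_measurable (lebesgue_on \<Omega>)"
    using assms by (auto simp: L2_def)
  show "(\<lambda>x. (u x - f x)\<^sup>2) \<in> borel_measurable (lebesgue_on \<Omega>)" by measurable
  show "AE x in lebesgue_on \<Omega>. norm ((u x - f x)\<^sup>2) \<le> norm (2 * (u x)\<^sup>2 + 2 * (f x)\<^sup>2)"
    using square_diff_le[of "u _" "f _"] by simp
qed

lemma fidelity_L2:
  assumes "u \<in> L2 \<Omega>" "f \<in> L2 \<Omega>"
  shows "fidelity \<Omega> f u = ennreal (1/2 * (L2_norm \<Omega> (\<lambda>x. u x - f x))\<^sup>2)"
proof -
  have "fidelity \<Omega> f u = ennreal (\<integral>x. 1/2 * (u x - f x)\<^sup>2 \<partial>lebesgue_on \<Omega>)"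
    unfolding fidelity_def using L2_diff_integrable[OF assms] by (intro nn_integral_eq_integral) auto
  then show ?thesis by (simp add: L2_norm_def)
qed

lemma fidelity_finite_imp_L2:
  assumes u: "u \<in> borel_measurable (lebesgue_on \<Omega>)" and f: "f \<in> L2 \<Omega>" and fin: "fidelity \<Omega> f u < \<infinity>"
  shows "u \<in> L2 \<Omega>"
proof -
  have [measurable]: "u \<in> borel_measurable (lebesgue_on \<Omega>)" "f \<in> borel_measurable (lebesgue_on \<Omega>)"
    using u f by (auto simp: L2_def)
  have "integrable (lebesgue_on \<Omega>) (\<lambda>x. 1/2 * (u x - f x)\<^sup>2)"
    using fin unfolding fidelity_def by (intro integrableI_nonneg) auto
  then have "integrable (lebesgue_on \<Omega>) (\<lambda>x. 2 * (1/2 * (u x - f x)\<^sup>2))" by (rule integrable_mult_right)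
  then have "integrable (lebesgue_on \<Omega>) (\<lambda>x. 2 * (u x - f x)\<^sup>2 + 2 * (f x)\<^sup>2)"
    using f by (simp add: L2_def)
  then have "integrable (lebesgue_on \<Omega>) (\<lambda>x. (u x)\<^sup>2)"
  proof (rule Bochner_Integration.integrable_bound)
    have "(u x)\<^sup>2 \<le> 2 * (u x - f x)\<^sup>2 + 2 * (f x)\<^sup>2" for x
      using square_diff_le[of "u x - f x" "- f x"] by simp
    then show "AE x in lebesgue_on \<Omega>. norm ((u x)\<^sup>2) \<le> norm (2 * (u x - f x)\<^sup>2 + 2 * (f x)\<^sup>2)" by simp
  qed measurable
  then show ?thesis using u by (simp add: L2_def)
qed

lemma F_ROF_eq:
  assumes "u \<in> L1 \<Omega>" "f \<in> L2 \<Omega>" "\<alpha> > 0"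
  shows "F_ROF \<Omega> f \<alpha> u = fidelity \<Omega> f u + ennreal \<alpha> * total_variation \<Omega> u"
proof (cases "u \<in> BV \<Omega> \<inter> L2 \<Omega>")
  case True
  then show ?thesis using assms by (simp add: F_ROF_def fidelity_L2)
next
  case False
  have um: "u \<in> borel_measurable (lebesgue_on \<Omega>)" using assms(1) by (simp add: L1_def)
  have "fidelity \<Omega> f u = \<infinity> \<or> total_variation \<Omega> u = \<infinity>"
  proof (rule ccontr)
    assume "\<not> (fidelity \<Omega> f u = \<infinity> \<or> total_variation \<Omega> u = \<infinity>)"
    then have "fidelity \<Omega> f u < \<infinity>" "total_variation \<Omega> u < \<infinity>" by (auto simp: less_top)
    then show False using False assms(1) fidelity_finite_imp_L2[OF um assms(2)] by (simp add: BV_def)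
  qed
  then show ?thesis using False \<open>\<alpha> > 0\<close> by (auto simp: F_ROF_def ennreal_mult_top)
qed

lemma F_ROF_finite_imp: "F_ROF \<Omega> f \<alpha> u < \<infinity> \<Longrightarrow> u \<in> BV \<Omega> \<inter> L2 \<Omega>"
  by (auto simp: F_ROF_def split: if_splits)

text \<open>The logarithmic term is nonnegative, and the total variation of a Sobolev function is at most the
  integral of the norm of its gradient.\<close>

lemma F_ROF_le_F_gamma:
  assumes u: "u \<in> L1 \<Omega>" and f: "f \<in> L2 \<Omega>" and "\<alpha> > 0" "\<gamma> > 0"
  shows "F_ROF \<Omega> f \<alpha> u \<le> F_gamma \<Omega> f \<alpha> \<kappa> \<gamma> u"
proof (cases "u \<in> X_space \<Omega> \<alpha> \<kappa> \<gamma>")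
  case True
  then have uL2: "u \<in> L2 \<Omega>" and "u \<in> W11 \<Omega>" by (auto simp: X_space_def)
  then obtain G where "is_weak_gradient \<Omega> u G" by (auto simp: W11_def)
  then have G: "is_weak_gradient \<Omega> u (weak_gradient \<Omega> u)"
    unfolding weak_gradient_def by (rule someI[of "is_weak_gradient \<Omega> u" G])
  have Gm: "(\<lambda>x. norm (weak_gradient \<Omega> u x)) \<in> borel_measurable (lebesgue_on \<Omega>)"
    using G by (auto simp: is_weak_gradient_def)
  have "ennreal \<alpha> * total_variation \<Omega> u \<le> ennreal \<alpha> * (\<integral>\<^sup>+x. ennreal (norm (weak_gradient \<Omega> u x)) \<partial>lebesgue_on \<Omega>)"
    by (intro mult_left_mono total_variation_le_weak_gradient u G) simp
  also have "\<dots> = (\<integral>\<^sup>+x. ennreal \<alpha> * ennreal (norm (weak_gradient \<Omega> u x)) \<partial>lebesgue_on \<Omega>)"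
    using Gm by (intro nn_integral_cmult[symmetric]) simp
  also have "\<dots> \<le> gradient_energy \<Omega> \<alpha> \<kappa> \<gamma> u"
    unfolding gradient_energy_def
  proof (rule nn_integral_mono)
    fix x
    let ?t = "norm (weak_gradient \<Omega> u x)"
    have "0 \<le> log_plus r" for r by (simp add: log_plus_def)
    then have "\<alpha> * ?t * 1 \<le> phi \<alpha> \<kappa> \<gamma> x ?t"
      unfolding phi_def using assms by (intro mult_left_mono) auto
    then show "ennreal \<alpha> * ennreal ?t \<le> ennreal (phi \<alpha> \<kappa> \<gamma> x ?t)"
      using \<open>\<alpha> > 0\<close> by (simp add: ennreal_mult[symmetric] ennreal_leI)
  qed
  finally show ?thesis
    using True uL2 f by (simp add: F_ROF_eq[OF u f \<open>\<alpha> > 0\<close>] F_gamma_def fidelity_L2 add_left_mono)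
qed (simp add: F_gamma_def)

lemma liminf_add_ennreal:
  fixes a b :: "nat \<Rightarrow> ennreal"
  shows "liminf a + liminf b \<le> liminf (\<lambda>n. a n + b n)"
proof -
  have inc: "incseq (\<lambda>n. INF m\<in>{n..}. c m)" for c :: "nat \<Rightarrow> ennreal"
    by (intro incseq_SucI INF_superset_mono) auto
  have "liminf a + liminf b = (SUP n. (INF m\<in>{n..}. a m) + (INF m\<in>{n..}. b m))"
    unfolding liminf_SUP_INF by (rule ennreal_SUP_add[OF inc inc, symmetric])
  also have "\<dots> \<le> (SUP n. INF m\<in>{n..}. a m + b m)"
    by (intro SUP_mono') (auto intro!: INF_greatest add_mono INF_lower)
  finally show ?thesis unfolding liminf_SUP_INF .
qed

lemma L1_diff_integrable: "u \<in> L1 \<Omega> \<Longrightarrow> v \<in> L1 \<Omega> \<Longrightarrow> integrable (lebesgue_on \<Omega>) (\<lambda>x. u x - v x)"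
  by (simp add: L1_def)

text \<open>For a fixed test field the functional \<^const>\<open>distr_derivative\<close> is continuous in \<open>L\<^sup>1\<close>, and a
  supremum of continuous functionals is lower semicontinuous.\<close>

lemma total_variation_lsc:
  fixes u :: "'a::euclidean_space \<Rightarrow> real"
  assumes u: "u \<in> L1 \<Omega>" and v: "\<And>n. v n \<in> L1 \<Omega>" "(\<lambda>n. L1_dist \<Omega> (v n) u) \<longlonglongrightarrow> 0" and "\<alpha> \<ge> 0"
  shows "ennreal \<alpha> * total_variation \<Omega> u \<le> liminf (\<lambda>n. ennreal \<alpha> * total_variation \<Omega> (v n))"
  unfolding total_variation_def[of \<Omega> u] SUP_mult_left_ennreal
proof (rule SUP_least)
  fix \<phi> :: "'a \<Rightarrow> 'a" assume \<phi>: "\<phi> \<in> {\<phi> \<in> test_functions \<Omega>. \<forall>x. norm (\<phi> x) \<le> 1}"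
  then have dt: "divergence \<phi> \<in> test_functions \<Omega>" by (intro test_functions_divergence) auto
  obtain B where B: "B \<ge> 0" "\<And>x. norm (divergence \<phi> x) \<le> B" using test_functions_bounded[OF dt] by metis
  have "(\<lambda>n. distr_derivative \<Omega> (v n) \<phi>) \<longlonglongrightarrow> distr_derivative \<Omega> u \<phi>"
  proof (rule LIM_zero_cancel, rule Lim_null_comparison)
    show "(\<lambda>n. B * L1_dist \<Omega> (v n) u) \<longlonglongrightarrow> 0" using tendsto_mult_right_zero[OF v(2)] .
    show "\<forall>\<^sub>F n in sequentially. norm (distr_derivative \<Omega> (v n) \<phi> - distr_derivative \<Omega> u \<phi>) \<le> B * L1_dist \<Omega> (v n) u"
    proof (intro always_eventually allI)
      fix n
      have i: "integrable (lebesgue_on \<Omega>) (\<lambda>x. v n x * divergence \<phi> x)" "integrable (lebesgue_on \<Omega>) (\<lambda>x. u x * divergence \<phi> x)"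
        using u v(1)[of n] by (auto intro!: integrable_mult_test_function(2)[OF dt] simp: L1_def)
      have "norm (distr_derivative \<Omega> (v n) \<phi> - distr_derivative \<Omega> u \<phi>) = \<bar>\<integral>x. (v n x - u x) * divergence \<phi> x \<partial>lebesgue_on \<Omega>\<bar>"
        using i by (simp add: distr_derivative_def left_diff_distrib)
      also have "\<dots> \<le> (\<integral>x. \<bar>(v n x - u x) * divergence \<phi> x\<bar> \<partial>lebesgue_on \<Omega>)" by (rule integral_abs_bound)
      also have "\<dots> \<le> (\<integral>x. B * \<bar>v n x - u x\<bar> \<partial>lebesgue_on \<Omega>)"
      proof (rule integral_mono)
        show "integrable (lebesgue_on \<Omega>) (\<lambda>x. \<bar>(v n x - u x) * divergence \<phi> x\<bar>)"
          using i by (intro integrable_abs) (simp add: left_diff_distrib)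
        show "integrable (lebesgue_on \<Omega>) (\<lambda>x. B * \<bar>v n x - u x\<bar>)" using L1_diff_integrable[OF v(1) u] by simp
        show "\<bar>(v n x - u x) * divergence \<phi> x\<bar> \<le> B * \<bar>v n x - u x\<bar>" for x
          using B(2)[of x] by (simp add: abs_mult mult.commute[of B] mult_left_mono)
      qed
      finally show "norm (distr_derivative \<Omega> (v n) \<phi> - distr_derivative \<Omega> u \<phi>) \<le> B * L1_dist \<Omega> (v n) u"
        by (simp add: L1_dist_def)
    qed
  qed
  then have "(\<lambda>n. ennreal \<alpha> * ennreal (distr_derivative \<Omega> (v n) \<phi>)) \<longlonglongrightarrow> ennreal \<alpha> * ennreal (distr_derivative \<Omega> u \<phi>)"
    by (intro ennreal_tendsto_cmult tendsto_ennrealI) auto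
  from lim_imp_Liminf[OF trivial_limit_sequentially this]
  have "ennreal \<alpha> * ennreal (distr_derivative \<Omega> u \<phi>) = liminf (\<lambda>n. ennreal \<alpha> * ennreal (distr_derivative \<Omega> (v n) \<phi>))" by simp
  also have "\<dots> \<le> liminf (\<lambda>n. ennreal \<alpha> * total_variation \<Omega> (v n))"
    unfolding total_variation_def by (intro Liminf_mono always_eventually allI mult_left_mono SUP_upper \<phi>) simp
  finally show "ennreal \<alpha> * ennreal (distr_derivative \<Omega> u \<phi>) \<le> \<dots>" .
qed

text \<open>Along a subsequence that realises the limit inferior and converges almost everywhere, this is
  Fatou's lemma.\<close>

lemma fidelity_lsc:
  fixes u :: "'a::euclidean_space \<Rightarrow> real"
  assumes u: "u \<in> L1 \<Omega>" and v: "\<And>n. v n \<in> L1 \<Omega>" "(\<lambda>n. L1_dist \<Omega> (v n) u) \<longlonglongrightarrow> 0" and f: "f \<in> L2 \<Omega>"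
  shows "fidelity \<Omega> f u \<le> liminf (\<lambda>n. fidelity \<Omega> f (v n))"
proof -
  obtain r where r: "strict_mono r" "((\<lambda>n. fidelity \<Omega> f (v n)) \<circ> r) \<longlonglongrightarrow> liminf (\<lambda>n. fidelity \<Omega> f (v n))"
    using liminf_subseq_lim by blast
  have "(\<lambda>n. \<integral>x. norm (v (r n) x - u x) \<partial>lebesgue_on \<Omega>) \<longlonglongrightarrow> 0"
    using LIMSEQ_subseq_LIMSEQ[OF v(2) r(1)] by (simp add: L1_dist_def o_def)
  from tendsto_L1_AE_subseq[OF L1_diff_integrable[OF v(1) u] this]
  obtain s where s: "strict_mono s" "AE x in lebesgue_on \<Omega>. (\<lambda>n. v (r (s n)) x - u x) \<longlonglongrightarrow> 0" by blast
  have [measurable]: "f \<in> borel_measurable (lebesgue_on \<Omega>)" "v n \<in> borel_measurable (lebesgue_on \<Omega>)" for n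
    using f v(1)[of n] by (auto simp: L2_def L1_def)
  have "fidelity \<Omega> f u \<le> (\<integral>\<^sup>+x. liminf (\<lambda>n. ennreal (1/2 * (v (r (s n)) x - f x)\<^sup>2)) \<partial>lebesgue_on \<Omega>)"
    unfolding fidelity_def
  proof (rule nn_integral_mono_AE)
    show "AE x in lebesgue_on \<Omega>. ennreal (1/2 * (u x - f x)\<^sup>2) \<le> liminf (\<lambda>n. ennreal (1/2 * (v (r (s n)) x - f x)\<^sup>2))"
      using s(2)
    proof eventually_elim
      case (elim x)
      have "(\<lambda>n. (v (r (s n)) x - u x) + (u x - f x)) \<longlonglongrightarrow> 0 + (u x - f x)" by (intro tendsto_intros elim)
      moreover have "(\<lambda>n. (v (r (s n)) x - u x) + (u x - f x)) = (\<lambda>n. v (r (s n)) x - f x)" by auto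
      ultimately have "(\<lambda>n. v (r (s n)) x - f x) \<longlonglongrightarrow> u x - f x" by (simp only: add_0_left)
      then have "(\<lambda>n. ennreal (1/2 * (v (r (s n)) x - f x)\<^sup>2)) \<longlonglongrightarrow> ennreal (1/2 * (u x - f x)\<^sup>2)"
        by (intro tendsto_ennrealI tendsto_mult[OF tendsto_const] tendsto_power)
      from lim_imp_Liminf[OF trivial_limit_sequentially this] show ?case by simp
    qed
  qed
  also have "\<dots> \<le> liminf (\<lambda>n. fidelity \<Omega> f (v (r (s n))))"
    unfolding fidelity_def by (rule nn_integral_liminf) measurable
  also have "\<dots> = liminf (\<lambda>n. fidelity \<Omega> f (v n))"
    using lim_imp_Liminf[OF trivial_limit_sequentially LIMSEQ_subseq_LIMSEQ[OF r(2) s(1)]] by (simp add: o_def)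
  finally show ?thesis .
qed

lemma F_ROF_lsc:
  assumes u: "u \<in> L1 \<Omega>" and v: "\<And>n. v n \<in> L1 \<Omega>" "(\<lambda>n. L1_dist \<Omega> (v n) u) \<longlonglongrightarrow> 0"
    and f: "f \<in> L2 \<Omega>" and "\<alpha> > 0"
  shows "F_ROF \<Omega> f \<alpha> u \<le> liminf (\<lambda>n. F_ROF \<Omega> f \<alpha> (v n))"
proof -
  have "F_ROF \<Omega> f \<alpha> u \<le> liminf (\<lambda>n. fidelity \<Omega> f (v n)) + liminf (\<lambda>n. ennreal \<alpha> * total_variation \<Omega> (v n))"
    unfolding F_ROF_eq[OF u f \<open>\<alpha> > 0\<close>] using \<open>\<alpha> > 0\<close>
    by (intro add_mono fidelity_lsc total_variation_lsc u v f) simp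
  also have "\<dots> \<le> liminf (\<lambda>n. fidelity \<Omega> f (v n) + ennreal \<alpha> * total_variation \<Omega> (v n))"
    by (rule liminf_add_ennreal)
  finally show ?thesis unfolding F_ROF_eq[OF v(1) f \<open>\<alpha> > 0\<close>] .
qed

text \<open>Fubini's theorem is applied to \<open>u (x - y)\<close>. For a Borel function \<open>u\<close> this is measurable with
  respect to the product measure, so a Lebesgue measurable \<open>u\<close> is first modified on a null set.\<close>

lemma borel_representative:
  fixes u :: "'a::euclidean_space \<Rightarrow> real"
  assumes \<Omega>: "open \<Omega>" and u: "u \<in> borel_measurable (lebesgue_on \<Omega>)"
  obtains u' where "u' \<in> borel_measurable borel" "\<And>x. x \<notin> \<Omega> \<Longrightarrow> u' x = 0" "AE x in lebesgue_on \<Omega>. u x = u' x"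
proof -
  have b[measurable]: "\<Omega> \<in> sets borel" using \<Omega> by simp
  then have l: "\<Omega> \<in> sets lebesgue" by simp
  have "(\<lambda>x. indicator \<Omega> x *\<^sub>R u x) \<in> borel_measurable lebesgue"
    using u l by (subst (asm) borel_measurable_restrict_space_iff) auto
  from completion_ex_borel_measurable_real[OF this[simplified]]
  obtain g where g: "g \<in> borel_measurable lborel" "AE x in lborel. indicator \<Omega> x * u x = g x" by auto
  have [measurable]: "g \<in> borel_measurable borel" using g by simp
  show ?thesis
  proof (rule that[of "\<lambda>x. indicator \<Omega> x * g x"])
    show "AE x in lebesgue_on \<Omega>. u x = indicator \<Omega> x * g x"
      unfolding AE_lebesgue_on[OF \<Omega>] using g(2) by eventually_elim (auto simp: indicator_def)
  qed (auto simp: indicator_def)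
qed

text \<open>The strict approximation theorem, transferred to functions that are only given up to null sets on
  \<open>\<Omega>\<close>.\<close>

lemma density_in_energy:
  fixes \<Omega> :: "'a::euclidean_space set" and u :: "'a \<Rightarrow> real"
  assumes dom: "bounded_lipschitz_domain \<Omega>" and u: "u \<in> BV \<Omega> \<inter> L2 \<Omega>" and \<eta>: "\<eta> > 0"
  obtains w where "w \<in> test_functions UNIV" "(\<integral>\<^sup>+x. ennreal ((w x - u x)\<^sup>2) \<partial>lebesgue_on \<Omega>) \<le> ennreal \<eta>"
    "(\<integral>\<^sup>+x. ennreal (norm (gradient w x)) \<partial>lebesgue_on \<Omega>) \<le> total_variation \<Omega> u + ennreal \<eta>"
proof -
  have \<Omega>: "open \<Omega>" "bounded \<Omega>" using dom by (auto simp: bounded_lipschitz_domain_def)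
  have ui: "integrable (lebesgue_on \<Omega>) u" "integrable (lebesgue_on \<Omega>) (\<lambda>x. (u x)\<^sup>2)"
    using u by (auto simp: BV_def L1_def L2_def)
  note um = borel_measurable_integrable[OF ui(1)]
  obtain u' where u'm[measurable]: "u' \<in> borel_measurable borel" and u'0: "\<And>x. x \<notin> \<Omega> \<Longrightarrow> u' x = 0"
    and eq: "AE x in lebesgue_on \<Omega>. u x = u' x"
    using borel_representative[OF \<Omega>(1) um] by metis
  have ind: "(\<lambda>x. indicator \<Omega> x *\<^sub>R u' x) = u'" "(\<lambda>x. indicator \<Omega> x *\<^sub>R (u' x)\<^sup>2) = (\<lambda>x. (u' x)\<^sup>2)"
    using u'0 by (auto simp: fun_eq_iff indicator_def)
  have "integrable (lebesgue_on \<Omega>) u'" "integrable (lebesgue_on \<Omega>) (\<lambda>x. (u' x)\<^sup>2)"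
  proof -
    show "integrable (lebesgue_on \<Omega>) u'"
      by (rule integrable_cong_AE_imp[OF ui(1) lebesgue_on_measurable[OF u'm]]) (use eq in eventually_elim, simp)
    show "integrable (lebesgue_on \<Omega>) (\<lambda>x. (u' x)\<^sup>2)"
      by (rule integrable_cong_AE_imp[OF ui(2) lebesgue_on_measurable]) (simp, use eq in eventually_elim, simp)
  qed
  then have u'i: "integrable lborel u'" "integrable lborel (\<lambda>x. (u' x)\<^sup>2)"
    using integrable_lebesgue_on[OF \<Omega>(1), of u'] integrable_lebesgue_on[OF \<Omega>(1), of "\<lambda>x. (u' x)\<^sup>2"]
    unfolding ind by simp_all
  define V where "V = enn2real (total_variation \<Omega> u)"
  have V: "total_variation \<Omega> u = ennreal V" "V \<ge> 0" using u by (auto simp: V_def BV_def)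
  have bound: "- (\<integral>x. u' x * divergence \<phi> x \<partial>lborel) \<le> V"
    if \<phi>: "\<phi> \<in> test_functions \<Omega>" "\<And>x. norm (\<phi> x) \<le> 1" for \<phi>
  proof -
    have dm[measurable]: "divergence \<phi> \<in> borel_measurable borel"
      by (rule test_functions_borel[OF test_functions_divergence[OF \<phi>(1)]])
    have "(\<integral>x. u' x * divergence \<phi> x \<partial>lborel) = (\<integral>x. u' x * divergence \<phi> x \<partial>lebesgue_on \<Omega>)"
      by (rule integral_lebesgue_on_supported[OF \<Omega>(1), symmetric]) (auto simp: u'0)
    also have "\<dots> = (\<integral>x. u x * divergence \<phi> x \<partial>lebesgue_on \<Omega>)"
      using eq lebesgue_on_measurable[OF dm] um lebesgue_on_measurable[OF u'm] by (intro integral_cong_AE) auto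
    finally have "ennreal (- (\<integral>x. u' x * divergence \<phi> x \<partial>lborel)) = ennreal (distr_derivative \<Omega> u \<phi>)"
      by (simp add: distr_derivative_def)
    also have "\<dots> \<le> ennreal V"
      unfolding V(1)[symmetric] total_variation_def using \<phi> by (intro SUP_upper) auto
    finally show ?thesis using V(2) by simp
  qed
  obtain w where w: "w \<in> test_functions UNIV" "L2_distance2 w u' \<le> ennreal \<eta>"
    "(\<integral>\<^sup>+x. ennreal (norm (gradient w x)) \<partial>lebesgue_on \<Omega>) \<le> ennreal (V + \<eta>)"
    using smooth_strict_approximation[OF dom u'm u'0 u'i bound \<eta>] by metis
  show ?thesis
  proof (rule that[OF w(1)])
    have "(\<integral>\<^sup>+x. ennreal ((w x - u x)\<^sup>2) \<partial>lebesgue_on \<Omega>) = (\<integral>\<^sup>+x. ennreal ((w x - u' x)\<^sup>2) \<partial>lebesgue_on \<Omega>)"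
      using eq by (intro nn_integral_cong_AE) auto
    also have "\<dots> \<le> L2_distance2 w u'"
      unfolding nn_integral_lebesgue_on[OF \<Omega>(1)] by (intro nn_integral_mono) (auto simp: indicator_def)
    finally show "(\<integral>\<^sup>+x. ennreal ((w x - u x)\<^sup>2) \<partial>lebesgue_on \<Omega>) \<le> ennreal \<eta>" using w(2) by (rule order_trans)
    show "(\<integral>\<^sup>+x. ennreal (norm (gradient w x)) \<partial>lebesgue_on \<Omega>) \<le> total_variation \<Omega> u + ennreal \<eta>"
      using w(3) V \<eta> by simp
  qed
qed

section \<open>Completeness and diagonal arguments\<close>

lemma L1_distI:
  assumes "(\<integral>\<^sup>+x. ennreal \<bar>u x - v x\<bar> \<partial>lebesgue_on \<Omega>) \<le> ennreal r" "r \<ge> 0"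
  shows "L1_dist \<Omega> u v \<le> r"
  unfolding L1_dist_def using assms by (intro integral_real_bounded)

lemma L1_dist_nonneg: "0 \<le> L1_dist \<Omega> u v"
  by (simp add: L1_dist_def)

lemma L1_dist_commute: "L1_dist \<Omega> u v = L1_dist \<Omega> v u"
  by (simp add: L1_dist_def abs_minus_commute)

lemma L1_dist_triangle:
  assumes "u \<in> L1 \<Omega>" "v \<in> L1 \<Omega>" "w \<in> L1 \<Omega>"
  shows "L1_dist \<Omega> u w \<le> L1_dist \<Omega> u v + L1_dist \<Omega> v w"
proof -
  have i: "integrable (lebesgue_on \<Omega>) (\<lambda>x. \<bar>u x - v x\<bar>)" "integrable (lebesgue_on \<Omega>) (\<lambda>x. \<bar>v x - w x\<bar>)"
      "integrable (lebesgue_on \<Omega>) (\<lambda>x. \<bar>u x - w x\<bar>)"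
    using assms by (simp_all add: L1_diff_integrable)
  have "L1_dist \<Omega> u w \<le> (\<integral>x. \<bar>u x - v x\<bar> + \<bar>v x - w x\<bar> \<partial>lebesgue_on \<Omega>)"
    unfolding L1_dist_def using i by (intro integral_mono) auto
  then show ?thesis using i by (simp add: L1_dist_def)
qed

text \<open>A Cauchy sequence has a subsequence that converges almost everywhere; Fatou's lemma shows that the
  pointwise limit is the limit in \<open>L\<^sup>1\<close>.\<close>

lemma L1_complete:
  fixes u :: "nat \<Rightarrow> 'a::euclidean_space \<Rightarrow> real"
  assumes u: "\<And>n. u n \<in> L1 \<Omega>"
    and cauchy: "\<And>e. e > 0 \<Longrightarrow> \<exists>N. \<forall>i\<ge>N. \<forall>j\<ge>N. L1_dist \<Omega> (u i) (u j) < e"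
  obtains l where "l \<in> L1 \<Omega>" "(\<lambda>n. L1_dist \<Omega> (u n) l) \<longlonglongrightarrow> 0"
proof -
  have ui: "integrable (lebesgue_on \<Omega>) (u n)" for n using u by (simp add: L1_def)
  then have [measurable]: "u n \<in> borel_measurable (lebesgue_on \<Omega>)" for n by (rule borel_measurable_integrable)
  obtain r where r: "strict_mono r" "AE x in lebesgue_on \<Omega>. Cauchy (\<lambda>i. u (r i) x)"
  proof (rule cauchy_L1_AE_cauchy_subseq[where s=u, OF ui])
    show "\<exists>N. \<forall>i\<ge>N. \<forall>j\<ge>N. (\<integral>x. norm (u i x - u j x) \<partial>lebesgue_on \<Omega>) < e" if "e > 0" for e
      using cauchy[OF that] by (simp add: L1_dist_def)
  qed
  define l where "l x = lim (\<lambda>i. u (r i) x)" for x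
  have [measurable]: "l \<in> borel_measurable (lebesgue_on \<Omega>)" unfolding l_def[abs_def] by measurable
  have lim: "AE x in lebesgue_on \<Omega>. (\<lambda>i. u (r i) x) \<longlonglongrightarrow> l x"
    using r(2) by eventually_elim (simp add: l_def Cauchy_convergent_iff convergent_LIMSEQ_iff)
  have bound: "(\<integral>\<^sup>+x. ennreal \<bar>u n x - l x\<bar> \<partial>lebesgue_on \<Omega>) \<le> ennreal e"
    if N: "\<forall>i\<ge>N. \<forall>j\<ge>N. L1_dist \<Omega> (u i) (u j) < e" and "n \<ge> N" for N n e
  proof -
    have "(\<integral>\<^sup>+x. ennreal \<bar>u n x - l x\<bar> \<partial>lebesgue_on \<Omega>) \<le> (\<integral>\<^sup>+x. liminf (\<lambda>i. ennreal \<bar>u n x - u (r i) x\<bar>) \<partial>lebesgue_on \<Omega>)"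
    proof (rule nn_integral_mono_AE)
      show "AE x in lebesgue_on \<Omega>. ennreal \<bar>u n x - l x\<bar> \<le> liminf (\<lambda>i. ennreal \<bar>u n x - u (r i) x\<bar>)"
        using lim
      proof eventually_elim
        case (elim x)
        have "(\<lambda>i. ennreal \<bar>u n x - u (r i) x\<bar>) \<longlonglongrightarrow> ennreal \<bar>u n x - l x\<bar>"
          by (intro tendsto_ennrealI tendsto_rabs tendsto_diff tendsto_const elim)
        from lim_imp_Liminf[OF trivial_limit_sequentially this] show ?case by simp
      qed
    qed
    also have "\<dots> \<le> liminf (\<lambda>i. \<integral>\<^sup>+x. ennreal \<bar>u n x - u (r i) x\<bar> \<partial>lebesgue_on \<Omega>)"
      by (rule nn_integral_liminf) measurable
    also have "\<dots> \<le> limsup (\<lambda>i. \<integral>\<^sup>+x. ennreal \<bar>u n x - u (r i) x\<bar> \<partial>lebesgue_on \<Omega>)"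
      by (rule Liminf_le_Limsup) simp
    also have "\<dots> \<le> ennreal e"
    proof (rule Limsup_bounded, rule eventually_sequentiallyI[of N])
      fix i assume "N \<le> i"
      then have "N \<le> r i" using seq_suble[OF r(1), of i] by linarith
      have "(\<integral>\<^sup>+x. ennreal \<bar>u n x - u (r i) x\<bar> \<partial>lebesgue_on \<Omega>) = ennreal (L1_dist \<Omega> (u n) (u (r i)))"
        unfolding L1_dist_def using L1_diff_integrable[OF u u] by (intro nn_integral_eq_integral) auto
      also have "\<dots> \<le> ennreal e" using N \<open>n \<ge> N\<close> \<open>N \<le> r i\<close> by (intro ennreal_leI less_imp_le) blast
      finally show "(\<integral>\<^sup>+x. ennreal \<bar>u n x - u (r i) x\<bar> \<partial>lebesgue_on \<Omega>) \<le> ennreal e" .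
    qed
    finally show ?thesis .
  qed
  obtain N where N: "\<forall>i\<ge>N. \<forall>j\<ge>N. L1_dist \<Omega> (u i) (u j) < 1" using cauchy[of 1] by auto
  have "integrable (lebesgue_on \<Omega>) (\<lambda>x. u N x - l x)"
  proof (rule integrableI_bounded)
    show "(\<integral>\<^sup>+x. ennreal (norm (u N x - l x)) \<partial>lebesgue_on \<Omega>) < \<infinity>"
      unfolding real_norm_def infinity_ennreal_def
      by (rule le_less_trans[OF bound[OF N order_refl] ennreal_less_top])
  qed measurable
  from Bochner_Integration.integrable_diff[OF ui[of N] this] have l: "l \<in> L1 \<Omega>" by (simp add: L1_def)
  show ?thesis
  proof (rule that[OF l], rule LIMSEQ_I)
    fix e :: real assume "e > 0"
    then obtain N where N: "\<forall>i\<ge>N. \<forall>j\<ge>N. L1_dist \<Omega> (u i) (u j) < e / 2" using cauchy[of "e / 2"] by auto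
    have "L1_dist \<Omega> (u n) l \<le> e / 2" if "n \<ge> N" for n
      using bound[OF N that] \<open>e > 0\<close> by (intro L1_distI) auto
    then show "\<exists>N. \<forall>n\<ge>N. norm (L1_dist \<Omega> (u n) l - 0) < e"
      using \<open>e > 0\<close> L1_dist_nonneg[of \<Omega>] by (intro exI[of _ N]) (fastforce simp: abs_of_nonneg)
  qed
qed

text \<open>The diagonal of successive refinements for \<open>e = 1 / (n + 1)\<close>. Only the oscillation \<open>D\<close> of the
  sequence enters, so that the lemma applies to a pseudometric on functions.\<close>

lemma diagonal_Cauchy_subsequence:
  fixes D :: "nat \<Rightarrow> nat \<Rightarrow> real"
  assumes "\<And>e s. e > 0 \<Longrightarrow> strict_mono (s :: nat \<Rightarrow> nat) \<Longrightarrow>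
      \<exists>r :: nat \<Rightarrow> nat. strict_mono r \<and> (\<exists>N. \<forall>i\<ge>N. \<forall>j\<ge>N. D (s (r i)) (s (r j)) < e)"
  obtains q :: "nat \<Rightarrow> nat" where "strict_mono q" "\<And>e. e > 0 \<Longrightarrow> \<exists>N. \<forall>i\<ge>N. \<forall>j\<ge>N. D (q i) (q j) < e"
proof -
  define P where "P n s \<longleftrightarrow> (\<exists>N. \<forall>i\<ge>N. \<forall>j\<ge>N. D (s i) (s j) < 1 / real (Suc n))" for n and s :: "nat \<Rightarrow> nat"
  interpret subseqs P
  proof
    fix n and s :: "nat \<Rightarrow> nat" assume "strict_mono s"
    moreover have "0 < 1 / real (Suc n)" by simp
    ultimately show "\<exists>r'. strict_mono r' \<and> P n (s \<circ> r')"
      unfolding P_def o_def by (rule assms[rotated])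
  qed
  have stable: "P n (s \<circ> r)" if r: "strict_mono r" and P: "P n s" for r s n
  proof -
    obtain N where N: "\<forall>i\<ge>N. \<forall>j\<ge>N. D (s i) (s j) < 1 / real (Suc n)" using P unfolding P_def by blast
    have "N \<le> r i" if "N \<le> i" for i using seq_suble[OF r, of i] that by linarith
    then show ?thesis unfolding P_def using N by (intro exI[of _ N]) simp
  qed
  show ?thesis
  proof (rule that[OF subseq_diagseq])
    fix e :: real assume "e > 0"
    then obtain n where n: "1 / real (Suc n) < e" using nat_approx_posE by blast
    from diagseq_holds[of n] stable have "P n (diagseq \<circ> (+) (Suc n))" by blast
    then obtain N where N: "\<forall>i\<ge>N. \<forall>j\<ge>N. D (diagseq (Suc n + i)) (diagseq (Suc n + j)) < 1 / real (Suc n)"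
      unfolding P_def by auto
    have "D (diagseq i) (diagseq j) < e" if "i \<ge> Suc n + N" "j \<ge> Suc n + N" for i j
    proof -
      have "D (diagseq (Suc n + (i - Suc n))) (diagseq (Suc n + (j - Suc n))) < 1 / real (Suc n)"
        using that by (intro N[rule_format]) auto
      then show ?thesis using that n by simp
    qed
    then show "\<exists>N. \<forall>i\<ge>N. \<forall>j\<ge>N. D (diagseq i) (diagseq j) < e" by blast
  qed
qed

text \<open>Integrating the gradient along segments bounds the \<open>L\<^sup>1\<close> modulus of continuity.\<close>

lemma L1_translation_le_gradient:
  fixes z :: "'a::euclidean_space \<Rightarrow> real"
  assumes z: "smooth z"
  shows "(\<integral>\<^sup>+x. ennreal \<bar>z (x + v) - z x\<bar> \<partial>lborel) \<le> ennreal (norm v) * (\<integral>\<^sup>+x. ennreal (norm (gradient z x)) \<partial>lborel)"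
proof -
  have gm[measurable]: "gradient z \<in> borel_measurable borel" by (intro smooth_borel smooth_gradient z)
  have dir: "\<partial> v z y = gradient z y \<bullet> v" for y
    unfolding frechet_derivative_expansion[OF z, where v=v and x=y] gradient_inner by (simp add: mult.commute)
  have cont: "continuous_on S (\<lambda>s. gradient z (x + s *\<^sub>R v) \<bullet> v)" for x and S :: "real set"
    by (intro continuous_intros continuous_on_compose2[OF smooth_continuous[OF smooth_gradient[OF z], of UNIV]]) auto
  have "(\<integral>\<^sup>+x. ennreal \<bar>z (x + v) - z x\<bar> \<partial>lborel) \<le>
      (\<integral>\<^sup>+x. (\<integral>\<^sup>+s. ennreal (norm v) * (ennreal (norm (gradient z (x + s *\<^sub>R v))) * indicator {0..1::real} s) \<partial>lborel) \<partial>lborel)"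
  proof (rule nn_integral_mono)
    fix x
    have der: "((\<lambda>s. z (x + s *\<^sub>R v)) has_real_derivative gradient z (x + s *\<^sub>R v) \<bullet> v) (at s within A)" for s A
    proof -
      have "((\<lambda>s. z (x + s *\<^sub>R v)) has_derivative (\<lambda>h. frechet_derivative z (at (x + s *\<^sub>R v)) (h *\<^sub>R v))) (at s)"
        by (rule has_derivative_compose[OF _ smooth_has_derivative[OF z]]) (auto intro!: derivative_eq_intros)
      then have "((\<lambda>s. z (x + s *\<^sub>R v)) has_real_derivative gradient z (x + s *\<^sub>R v) \<bullet> v) (at s)"
        unfolding has_field_derivative_def
        by (rule has_derivative_eq_rhs)
          (auto simp: fun_eq_iff linear_cmul[OF linear_frechet_derivative[OF z]] dir)
      then show ?thesis by (rule has_field_derivative_at_within)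
    qed
    have FTC: "(\<integral>s. (gradient z (x + s *\<^sub>R v) \<bullet> v) * indicator {0..1} s \<partial>lborel) = z (x + 1 *\<^sub>R v) - z (x + 0 *\<^sub>R v)"
      by (rule integral_FTC_Icc_real)
        (use der cont[of UNIV] in \<open>auto simp: continuous_on_eq_continuous_at\<close>)
    have int: "integrable lborel (\<lambda>s. (gradient z (x + s *\<^sub>R v) \<bullet> v) * indicator {0..1} s)"
      using borel_integrable_atLeastAtMost[of 0 1 "\<lambda>s. gradient z (x + s *\<^sub>R v) \<bullet> v"] cont[of UNIV x]
      by (simp add: continuous_on_eq_continuous_at indicator_def of_bool_def if_distrib cong: if_cong)
    have "ennreal \<bar>z (x + v) - z x\<bar> \<le> (\<integral>\<^sup>+s. ennreal (norm ((gradient z (x + s *\<^sub>R v) \<bullet> v) * indicator {0..1} s)) \<partial>lborel)"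
      using integral_norm_bound_ennreal[OF int] FTC by simp
    also have "\<dots> \<le> (\<integral>\<^sup>+s. ennreal (norm v) * (ennreal (norm (gradient z (x + s *\<^sub>R v))) * indicator {0..1::real} s) \<partial>lborel)"
    proof (rule nn_integral_mono)
      fix s :: real
      have "\<bar>gradient z (x + s *\<^sub>R v) \<bullet> v\<bar> \<le> norm v * norm (gradient z (x + s *\<^sub>R v))"
        using Cauchy_Schwarz_ineq2[of "gradient z (x + s *\<^sub>R v)" v] by (simp add: mult.commute)
      then show "ennreal (norm ((gradient z (x + s *\<^sub>R v) \<bullet> v) * indicator {0..1} s)) \<le>
          ennreal (norm v) * (ennreal (norm (gradient z (x + s *\<^sub>R v))) * indicator {0..1} s)"
        by (cases "s \<in> {0..1}") (auto simp: ennreal_mult[symmetric] intro: ennreal_leI)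
    qed
    finally show "ennreal \<bar>z (x + v) - z x\<bar> \<le> \<dots>" .
  qed
  also have "\<dots> = (\<integral>\<^sup>+s. (\<integral>\<^sup>+x. ennreal (norm v) * (ennreal (norm (gradient z (x + s *\<^sub>R v))) * indicator {0..1::real} s) \<partial>lborel) \<partial>lborel)"
    by (rule lborel_pair.Fubini') measurable
  also have "\<dots> = (\<integral>\<^sup>+s. (ennreal (norm v) * (\<integral>\<^sup>+x. ennreal (norm (gradient z x)) \<partial>lborel)) * indicator {0..1::real} s \<partial>lborel)"
  proof (rule nn_integral_cong)
    fix s :: real
    have "(\<integral>\<^sup>+x. ennreal (norm (gradient z (x + s *\<^sub>R v))) \<partial>lborel) = (\<integral>\<^sup>+x. ennreal (norm (gradient z x)) \<partial>lborel)"
      by (rule nn_integral_translate) measurable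
    then show "(\<integral>\<^sup>+x. ennreal (norm v) * (ennreal (norm (gradient z (x + s *\<^sub>R v))) * indicator {0..1} s) \<partial>lborel) =
        (ennreal (norm v) * (\<integral>\<^sup>+x. ennreal (norm (gradient z x)) \<partial>lborel)) * indicator {0..1} s"
      by (simp add: nn_integral_cmult nn_integral_multc mult.assoc)
  qed
  also have "\<dots> = ennreal (norm v) * (\<integral>\<^sup>+x. ennreal (norm (gradient z x)) \<partial>lborel)"
    by (simp add: nn_integral_cmult)
  finally show ?thesis .
qed

text \<open>Mollifications at a fixed scale of functions bounded in \<open>L\<^sup>1\<close> are uniformly bounded and
  equicontinuous, so they have subsequences that converge uniformly on compact sets.\<close>

lemma mollified_subsequence:
  fixes z :: "nat \<Rightarrow> 'a::euclidean_space \<Rightarrow> real"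
  assumes \<rho>: "mollifier \<epsilon> \<rho>" and z: "\<And>n. integrable lborel (z n)" "\<And>n. (\<integral>x. \<bar>z n x\<bar> \<partial>lborel) \<le> C"
    and S: "compact S" and "e > 0"
  obtains r :: "nat \<Rightarrow> nat" and N where "strict_mono r"
    "\<And>i j x. i \<ge> N \<Longrightarrow> j \<ge> N \<Longrightarrow> x \<in> S \<Longrightarrow> \<bar>convolution \<rho> (z (r i)) x - convolution \<rho> (z (r j)) x\<bar> \<le> e"
proof -
  have \<rho>t: "\<rho> \<in> test_functions UNIV" using mollifierD[OF \<rho>] by blast
  have \<rho>m[measurable]: "\<rho> \<in> borel_measurable borel" by (rule test_functions_borel[OF \<rho>t])
  obtain B where B: "B \<ge> 0" "\<And>x. norm (\<rho> x) \<le> B" using test_functions_bounded[OF \<rho>t] by metis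
  obtain K where K: "compact K" "\<And>x. x \<notin> K \<Longrightarrow> \<rho> x = 0" using test_functionsE[OF \<rho>t] by metis
  have C: "C \<ge> 0" using order_trans[OF integral_nonneg_AE z(2)] by simp
  have bound: "norm (convolution \<rho> (z n) x) \<le> B * C" for n x
    using norm_convolution_le[OF \<rho>m B(2) z(1)] mult_left_mono[OF z(2) B(1)] by (rule order_trans)
  have equi: "\<exists>d>0. \<forall>n y. y \<in> S \<and> norm (x - y) < d \<longrightarrow> norm (convolution \<rho> (z n) x - convolution \<rho> (z n) y) < \<eta>"
    if "\<eta> > 0" for x \<eta>
  proof -
    define \<eta>' where "\<eta>' = \<eta> / (2 * (C + 1))"
    have \<eta>': "\<eta>' > 0" using \<open>\<eta> > 0\<close> C by (simp add: \<eta>'_def)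
    obtain d where d: "0 < d" "\<And>x h. norm h < d \<Longrightarrow> norm (\<rho> (x + h) - \<rho> x) \<le> \<eta>'"
      using compact_support_uniformly_continuous[OF smooth_continuous[OF test_functions_smooth[OF \<rho>t]] K \<eta>'] by metis
    show ?thesis
    proof (intro exI[of _ d] conjI d(1) allI impI)
      fix n y assume "y \<in> S \<and> norm (x - y) < d"
      then have h: "norm (x - y) < d" by simp
      have "convolution \<rho> (z n) x - convolution \<rho> (z n) y = convolution (\<lambda>a. \<rho> (a + (x - y)) - \<rho> a) (z n) y"
        unfolding convolution_def
        by (subst Bochner_Integration.integral_diff[symmetric, OF convolution_test_integrable[OF \<rho>t z(1)]
              convolution_test_integrable[OF \<rho>t z(1)]])
          (auto simp: right_diff_distrib intro!: Bochner_Integration.integral_cong arg_cong[where f="\<lambda>a. _ * \<rho> a"])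
      also have "norm \<dots> \<le> \<eta>' * (\<integral>x. \<bar>z n x\<bar> \<partial>lborel)"
        by (rule norm_convolution_le[OF _ d(2)[OF h] z(1)]) measurable
      also have "\<dots> \<le> \<eta>' * C" using \<eta>' z(2) by (intro mult_left_mono) auto
      also have "\<dots> < \<eta>"
      proof -
        have "\<eta>' * C \<le> \<eta>' * (C + 1)" using \<eta>' by (intro mult_left_mono) auto
        also have "\<dots> = \<eta> / 2" using C by (simp add: \<eta>'_def field_simps)
        finally show ?thesis using \<open>\<eta> > 0\<close> by simp
      qed
      finally show "norm (convolution \<rho> (z n) x - convolution \<rho> (z n) y) < \<eta>" .
    qed
  qed
  obtain g k where k: "strict_mono (k :: nat \<Rightarrow> nat)"
    "\<And>e. 0 < e \<Longrightarrow> \<exists>N. \<forall>n x. n \<ge> N \<and> x \<in> S \<longrightarrow> norm (convolution \<rho> (z (k n)) x - g x) < e"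
    by (rule Arzela_Ascoli[where \<F>="\<lambda>n. convolution \<rho> (z n)", OF S bound equi]) (assumption, rule that)
  obtain N where N: "\<And>n x. n \<ge> N \<Longrightarrow> x \<in> S \<Longrightarrow> norm (convolution \<rho> (z (k n)) x - g x) < e / 2"
    using k(2)[of "e / 2"] \<open>e > 0\<close> by auto
  show ?thesis
  proof (rule that[OF k(1)])
    fix i j x assume "i \<ge> N" "j \<ge> N" "x \<in> S"
    from N[OF this(1,3)] N[OF this(2,3)]
    show "\<bar>convolution \<rho> (z (k i)) x - convolution \<rho> (z (k j)) x\<bar> \<le> e"
      unfolding real_norm_def by linarith
  qed
qed

section \<open>Compactness in the interior\<close>

lemma emeasure_lebesgue_on_space:
  fixes \<Omega> :: "'a::euclidean_space set"
  assumes "open \<Omega>" "bounded \<Omega>"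
  obtains m where "emeasure (lebesgue_on \<Omega>) (space (lebesgue_on \<Omega>)) = ennreal m" "m \<ge> 0"
proof (rule that[of "measure lborel \<Omega>"])
  have "emeasure (lebesgue_on \<Omega>) (space (lebesgue_on \<Omega>)) = emeasure lborel \<Omega>"
    using assms(1) by (simp add: emeasure_restrict_space)
  also have "\<dots> = ennreal (measure lborel \<Omega>)"
    using emeasure_bounded_finite[OF assms(2)] by (intro emeasure_eq_ennreal_measure) simp
  finally show "emeasure (lebesgue_on \<Omega>) (space (lebesgue_on \<Omega>)) = ennreal (measure lborel \<Omega>)" .
qed simp

lemma test_functions_integrable_on:
  fixes w :: "'a::euclidean_space \<Rightarrow> 'b::{banach, second_countable_topology}"
  assumes "open \<Omega>" "w \<in> test_functions S"
  shows "integrable (lebesgue_on \<Omega>) w"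
  using integrable_mult_indicator[of \<Omega> lborel w] assms test_functions_integrable[OF assms(2)]
  by (simp add: integrable_lebesgue_on test_functions_borel)

lemma test_functions_L1_L2:
  fixes w :: "'a::euclidean_space \<Rightarrow> real"
  assumes "open \<Omega>" "w \<in> test_functions S"
  shows "w \<in> L1 \<Omega>" "w \<in> L2 \<Omega>"
proof -
  show "w \<in> L1 \<Omega>" using test_functions_integrable_on[OF assms] by (simp add: L1_def)
  have "(\<lambda>x. w x *\<^sub>R w x) \<in> test_functions S"
    by (rule test_functions_scaleR[OF assms(2) test_functions_smooth[OF assms(2)]])
  from test_functions_integrable_on[OF assms(1) this] show "w \<in> L2 \<Omega>"
    using test_functions_borel[OF assms(2)] by (simp add: L2_def lebesgue_on_measurable power2_eq_square)
qed

lemma nn_integral_lebesgue_on_supported: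
  fixes h :: "'a::euclidean_space \<Rightarrow> ennreal"
  assumes "open \<Omega>" "\<And>x. x \<notin> \<Omega> \<Longrightarrow> h x = 0"
  shows "(\<integral>\<^sup>+x. h x \<partial>lborel) = (\<integral>\<^sup>+x. h x \<partial>lebesgue_on \<Omega>)"
proof -
  have "(\<lambda>x. h x * indicator \<Omega> x) = h" using assms(2) by (auto simp: fun_eq_iff indicator_def)
  then show ?thesis using assms(1) by (simp add: nn_integral_lebesgue_on)
qed

text \<open>The bound in \<open>L\<^sup>2\<close> keeps mass away from the boundary: outside a large compact set, functions
  that are bounded in \<open>L\<^sup>2\<close> are uniformly small in \<open>L\<^sup>1\<close>. Hence a cut-off inside the domain
  suffices and no extension across the boundary is needed.\<close>

lemma cutoff_mollification:
  fixes w :: "nat \<Rightarrow> 'a::euclidean_space \<Rightarrow> real"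
  assumes \<Omega>: "open \<Omega>" "bounded \<Omega>" and w: "\<And>n. w n \<in> test_functions UNIV"
    and C1: "\<And>n. (\<integral>\<^sup>+x. ennreal \<bar>w n x\<bar> \<partial>lebesgue_on \<Omega>) \<le> ennreal C1" "C1 \<ge> 0"
    and C2: "\<And>n. (\<integral>\<^sup>+x. ennreal ((w n x)\<^sup>2) \<partial>lebesgue_on \<Omega>) \<le> ennreal C2" "C2 \<ge> 0"
    and G: "\<And>n. (\<integral>\<^sup>+x. ennreal (norm (gradient (w n) x)) \<partial>lebesgue_on \<Omega>) \<le> ennreal G" "G \<ge> 0"
    and e: "e > 0"
  obtains z \<epsilon> \<rho> where "mollifier \<epsilon> \<rho>" "\<And>n. z n \<in> test_functions UNIV"
    "\<And>n. (\<integral>x. \<bar>z n x\<bar> \<partial>lborel) \<le> C1" "\<And>n. L1_dist \<Omega> (w n) (convolution \<rho> (z n)) \<le> e"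
proof -
  obtain m where m: "emeasure (lebesgue_on \<Omega>) (space (lebesgue_on \<Omega>)) = ennreal m" "m \<ge> 0"
    using emeasure_lebesgue_on_space[OF \<Omega>] by metis
  obtain \<zeta>' :: "nat \<Rightarrow> 'a \<Rightarrow> real" where \<zeta>': "\<And>n. \<zeta>' n \<in> test_functions \<Omega>" "\<And>n x. 0 \<le> \<zeta>' n x" "\<And>n x. \<zeta>' n x \<le> 1"
    "\<And>x. x \<in> \<Omega> \<Longrightarrow> \<forall>\<^sub>F n in sequentially. \<zeta>' n x = 1"
    using test_functions_exhaustion[OF \<Omega>(1)] by metis
  have \<zeta>'m[measurable]: "\<zeta>' n \<in> borel_measurable (lebesgue_on \<Omega>)" for n
    by (intro lebesgue_on_measurable test_functions_borel[OF \<zeta>'(1)])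
  have sq: "(1 - \<zeta>' n x)\<^sup>2 \<le> 1" for n x
    using \<zeta>'(2,3)[of n x] by (simp add: power_le_one)
  have one: "integrable (lebesgue_on \<Omega>) (\<lambda>x. 1::real)"
    using m by (intro integrableI_bounded) auto
  have "(\<lambda>n. \<integral>x. (1 - \<zeta>' n x)\<^sup>2 \<partial>lebesgue_on \<Omega>) \<longlonglongrightarrow> (\<integral>x. (0::real) \<partial>lebesgue_on \<Omega>)"
  proof (rule integral_dominated_convergence[OF _ _ one])
    show "AE x in lebesgue_on \<Omega>. (\<lambda>n. (1 - \<zeta>' n x)\<^sup>2) \<longlonglongrightarrow> 0"
    proof (rule AE_I2)
      fix x assume "x \<in> space (lebesgue_on \<Omega>)"
      then have "\<forall>\<^sub>F n in sequentially. \<zeta>' n x = 1" by (intro \<zeta>') simp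
      then have "\<forall>\<^sub>F n in sequentially. (1 - \<zeta>' n x)\<^sup>2 = 0" by eventually_elim simp
      then show "(\<lambda>n. (1 - \<zeta>' n x)\<^sup>2) \<longlonglongrightarrow> 0" by (rule tendsto_eventually)
    qed
  qed (use sq in auto)
  then have lim: "(\<lambda>n. \<integral>x. (1 - \<zeta>' n x)\<^sup>2 \<partial>lebesgue_on \<Omega>) \<longlonglongrightarrow> 0" by simp
  define \<mu> where "\<mu> = e / (2 * (C2 + 1))"
  have \<mu>: "\<mu> > 0" "\<mu> / 2 * C2 + (\<mu> * e / 2) / (2 * \<mu>) \<le> e / 2"
  proof -
    show "\<mu> > 0" using e C2(2) by (simp add: \<mu>_def)
    have "\<mu> * C2 \<le> \<mu> * (C2 + 1)" using \<open>\<mu> > 0\<close> by (intro mult_left_mono) auto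
    also have "\<dots> = e / 2" using C2(2) by (simp add: \<mu>_def field_simps)
    finally show "\<mu> / 2 * C2 + (\<mu> * e / 2) / (2 * \<mu>) \<le> e / 2" using \<open>\<mu> > 0\<close> by (simp add: field_simps)
  qed
  have "\<mu> * e / 2 > 0" using \<mu>(1) e by simp
  from order_tendstoD(2)[OF lim this] obtain k where k: "(\<integral>x. (1 - \<zeta>' k x)\<^sup>2 \<partial>lebesgue_on \<Omega>) < \<mu> * e / 2"
    by (auto simp: eventually_sequentially)
  define \<zeta> where "\<zeta> = \<zeta>' k"
  have \<zeta>: "\<zeta> \<in> test_functions \<Omega>" "0 \<le> \<zeta> x" "\<zeta> x \<le> 1" for x using \<zeta>' by (auto simp: \<zeta>_def)
  have \<zeta>m[measurable]: "\<zeta> \<in> borel_measurable (lebesgue_on \<Omega>)" by (simp add: \<zeta>_def)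
  have \<zeta>2: "(\<integral>\<^sup>+x. ennreal ((1 - \<zeta> x)\<^sup>2) \<partial>lebesgue_on \<Omega>) \<le> ennreal (\<mu> * e / 2)"
  proof -
    have "integrable (lebesgue_on \<Omega>) (\<lambda>x. (1 - \<zeta> x)\<^sup>2)"
      by (rule Bochner_Integration.integrable_bound[OF one]) (use sq in \<open>auto simp: \<zeta>_def\<close>)
    then have "(\<integral>\<^sup>+x. ennreal ((1 - \<zeta> x)\<^sup>2) \<partial>lebesgue_on \<Omega>) = ennreal (\<integral>x. (1 - \<zeta> x)\<^sup>2 \<partial>lebesgue_on \<Omega>)"
      by (intro nn_integral_eq_integral) auto
    also have "\<dots> \<le> ennreal (\<mu> * e / 2)" using k by (intro ennreal_leI) (simp add: \<zeta>_def)
    finally show ?thesis .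
  qed
  have wm[measurable]: "w n \<in> borel_measurable (lebesgue_on \<Omega>)" for n
    by (intro lebesgue_on_measurable test_functions_borel[OF w])
  define z where "z n x = w n x * \<zeta> x" for n x
  have zt\<Omega>: "z n \<in> test_functions \<Omega>" for n
    using test_functions_scaleR[OF \<zeta>(1) test_functions_smooth[OF w]] by (simp add: z_def[abs_def])
  then have zt: "z n \<in> test_functions UNIV" for n by (rule test_functions_mono) simp
  have zi: "integrable lborel (z n)" for n by (rule test_functions_integrable[OF zt])
  have zm[measurable]: "z n \<in> borel_measurable (lebesgue_on \<Omega>)" for n
    by (intro lebesgue_on_measurable test_functions_borel[OF zt])
  have wz: "(\<integral>\<^sup>+x. ennreal \<bar>w n x - z n x\<bar> \<partial>lebesgue_on \<Omega>) \<le> ennreal (e / 2)" for n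
  proof -
    have "(\<integral>\<^sup>+x. ennreal \<bar>w n x * (1 - \<zeta> x)\<bar> \<partial>lebesgue_on \<Omega>) \<le> ennreal (\<mu> / 2 * C2 + (\<mu> * e / 2) / (2 * \<mu>))"
      by (rule nn_integral_abs_mult_le[OF _ _ C2 \<zeta>2 _ \<mu>(1)]) (use \<mu>(1) e in auto)
    also have "\<dots> \<le> ennreal (e / 2)" using \<mu>(2) by (rule ennreal_leI)
    finally show ?thesis by (simp add: z_def right_diff_distrib)
  qed
  have z1: "(\<integral>x. \<bar>z n x\<bar> \<partial>lborel) \<le> C1" for n
  proof (rule integral_real_bounded[OF C1(2)])
    have "(\<integral>\<^sup>+x. ennreal \<bar>z n x\<bar> \<partial>lborel) = (\<integral>\<^sup>+x. ennreal \<bar>z n x\<bar> \<partial>lebesgue_on \<Omega>)"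
      using test_functions_eq_0[OF zt\<Omega>] by (intro nn_integral_lebesgue_on_supported[OF \<Omega>(1)]) simp
    also have "\<dots> \<le> (\<integral>\<^sup>+x. ennreal \<bar>w n x\<bar> \<partial>lebesgue_on \<Omega>)"
      using \<zeta>(2,3) by (intro nn_integral_mono ennreal_leI) (simp add: z_def abs_mult mult_left_le)
    finally show "(\<integral>\<^sup>+x. ennreal \<bar>z n x\<bar> \<partial>lborel) \<le> ennreal C1" using C1(1) by (rule order_trans)
  qed
  obtain B where B: "B \<ge> 0" "\<And>x. norm (gradient \<zeta> x) \<le> B"
    using test_functions_bounded[OF test_functions_gradient[OF \<zeta>(1)]] by metis
  define Cz where "Cz = G + B * C1"
  have Cz: "Cz \<ge> 0" using G(2) B(1) C1(2) by (simp add: Cz_def)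
  have gz: "(\<integral>\<^sup>+x. ennreal (norm (gradient (z n) x)) \<partial>lborel) \<le> ennreal Cz" for n
  proof -
    have [measurable]: "gradient (w n) \<in> borel_measurable (lebesgue_on \<Omega>)"
      by (intro lebesgue_on_measurable smooth_borel smooth_gradient test_functions_smooth[OF w])
    have "(\<integral>\<^sup>+x. ennreal (norm (gradient (z n) x)) \<partial>lborel) = (\<integral>\<^sup>+x. ennreal (norm (gradient (z n) x)) \<partial>lebesgue_on \<Omega>)"
      using test_functions_eq_0[OF test_functions_gradient[OF zt\<Omega>]]
      by (intro nn_integral_lebesgue_on_supported[OF \<Omega>(1)]) simp
    also have "\<dots> \<le> (\<integral>\<^sup>+x. ennreal (norm (gradient (w n) x)) + ennreal B * ennreal \<bar>w n x\<bar> \<partial>lebesgue_on \<Omega>)"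
    proof (rule nn_integral_mono)
      fix x
      have "norm (gradient (z n) x) \<le> \<bar>w n x\<bar> * norm (gradient \<zeta> x) + \<bar>\<zeta> x\<bar> * norm (gradient (w n) x)"
        unfolding z_def[abs_def] gradient_mult[OF test_functions_smooth[OF w] test_functions_smooth[OF \<zeta>(1)]]
        by (rule order_trans[OF norm_triangle_ineq]) simp
      also have "\<dots> \<le> \<bar>w n x\<bar> * B + 1 * norm (gradient (w n) x)"
        using B \<zeta>(2,3) by (intro add_mono mult_left_mono mult_right_mono) auto
      finally have "norm (gradient (z n) x) \<le> norm (gradient (w n) x) + B * \<bar>w n x\<bar>" by (simp add: mult.commute)
      then have "ennreal (norm (gradient (z n) x)) \<le> ennreal (norm (gradient (w n) x) + B * \<bar>w n x\<bar>)" by (rule ennreal_leI)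
      then show "ennreal (norm (gradient (z n) x)) \<le> ennreal (norm (gradient (w n) x)) + ennreal B * ennreal \<bar>w n x\<bar>"
        using B(1) by (simp add: ennreal_mult)
    qed
    also have "\<dots> = (\<integral>\<^sup>+x. ennreal (norm (gradient (w n) x)) \<partial>lebesgue_on \<Omega>) + ennreal B * (\<integral>\<^sup>+x. ennreal \<bar>w n x\<bar> \<partial>lebesgue_on \<Omega>)"
      by (simp add: nn_integral_add nn_integral_cmult)
    also have "\<dots> \<le> ennreal G + ennreal B * ennreal C1" by (intro add_mono mult_left_mono G C1) simp
    also have "\<dots> = ennreal Cz" using G(2) B(1) C1(2) by (simp add: Cz_def ennreal_mult)
    finally show ?thesis .
  qed
  define \<epsilon> where "\<epsilon> = e / (2 * (Cz + 1))"
  have \<epsilon>: "\<epsilon> > 0" "\<epsilon> * Cz \<le> e / 2"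
  proof -
    show "\<epsilon> > 0" using e Cz by (simp add: \<epsilon>_def)
    have "\<epsilon> * Cz \<le> \<epsilon> * (Cz + 1)" using \<open>\<epsilon> > 0\<close> by (intro mult_left_mono) auto
    also have "\<dots> = e / 2" using Cz by (simp add: \<epsilon>_def field_simps)
    finally show "\<epsilon> * Cz \<le> e / 2" .
  qed
  obtain \<rho> :: "'a \<Rightarrow> real" where \<rho>: "mollifier \<epsilon> \<rho>" using mollifier_exists[OF \<epsilon>(1)] by blast
  have zc: "(\<integral>\<^sup>+x. ennreal \<bar>convolution \<rho> (z n) x - z n x\<bar> \<partial>lborel) \<le> ennreal (e / 2)" for n
  proof (rule L1_mollification_error[OF \<rho> zi])
    fix v :: 'a assume v: "norm v \<le> \<epsilon>"
    have "(\<integral>\<^sup>+x. ennreal \<bar>z n (x + v) - z n x\<bar> \<partial>lborel) \<le> ennreal (norm v) * (\<integral>\<^sup>+x. ennreal (norm (gradient (z n) x)) \<partial>lborel)"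
      by (rule L1_translation_le_gradient[OF test_functions_smooth[OF zt]])
    also have "\<dots> \<le> ennreal \<epsilon> * ennreal Cz" using v by (intro mult_mono ennreal_leI gz) auto
    also have "\<dots> \<le> ennreal (e / 2)" using \<epsilon> Cz by (simp add: ennreal_mult[symmetric] ennreal_leI)
    finally show "(\<integral>\<^sup>+x. ennreal \<bar>z n (x + v) - z n x\<bar> \<partial>lborel) \<le> ennreal (e / 2)" .
  qed
  have cm[measurable]: "convolution \<rho> (z n) \<in> borel_measurable (lebesgue_on \<Omega>)" for n
    by (intro lebesgue_on_measurable smooth_borel smooth_convolution[OF _ zi, of _ UNIV] mollifierD(1)[OF \<rho>])
  have "L1_dist \<Omega> (w n) (convolution \<rho> (z n)) \<le> e" for n
  proof (rule L1_distI)
    have "(\<integral>\<^sup>+x. ennreal \<bar>w n x - convolution \<rho> (z n) x\<bar> \<partial>lebesgue_on \<Omega>) \<le>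
        (\<integral>\<^sup>+x. ennreal \<bar>w n x - z n x\<bar> + ennreal \<bar>convolution \<rho> (z n) x - z n x\<bar> \<partial>lebesgue_on \<Omega>)"
      by (intro nn_integral_mono)
        (auto simp: ennreal_plus[symmetric] simp del: ennreal_plus intro!: ennreal_leI)
    also have "\<dots> = (\<integral>\<^sup>+x. ennreal \<bar>w n x - z n x\<bar> \<partial>lebesgue_on \<Omega>) + (\<integral>\<^sup>+x. ennreal \<bar>convolution \<rho> (z n) x - z n x\<bar> \<partial>lebesgue_on \<Omega>)"
      by (rule nn_integral_add) measurable
    also have "(\<integral>\<^sup>+x. ennreal \<bar>convolution \<rho> (z n) x - z n x\<bar> \<partial>lebesgue_on \<Omega>) \<le> (\<integral>\<^sup>+x. ennreal \<bar>convolution \<rho> (z n) x - z n x\<bar> \<partial>lborel)"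
      unfolding nn_integral_lebesgue_on[OF \<Omega>(1)] by (intro nn_integral_mono) (auto simp: indicator_def)
    also have "(\<integral>\<^sup>+x. ennreal \<bar>w n x - z n x\<bar> \<partial>lebesgue_on \<Omega>) + (\<integral>\<^sup>+x. ennreal \<bar>convolution \<rho> (z n) x - z n x\<bar> \<partial>lborel) \<le> ennreal (e / 2) + ennreal (e / 2)"
      by (intro add_mono wz zc)
    also have "\<dots> = ennreal e" using e by (simp flip: ennreal_plus)
    finally show "(\<integral>\<^sup>+x. ennreal \<bar>w n x - convolution \<rho> (z n) x\<bar> \<partial>lebesgue_on \<Omega>) \<le> ennreal e" by (simp add: add_left_mono)
  qed (use e in simp)
  with \<rho> zt z1 show ?thesis by (intro that)
qed

section \<open>Compactness of sublevel sets\<close>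

text \<open>A sequence of bounded energy is replaced by smooth functions with nearly the same energy, and
  these by mollified cut-offs; so it has subsequences of arbitrarily small oscillation.\<close>

lemma F_ROF_bounded_compact:
  fixes \<Omega> :: "'a::euclidean_space set"
  assumes dom: "bounded_lipschitz_domain \<Omega>" and f: "f \<in> L2 \<Omega>" and \<alpha>: "\<alpha> > 0"
    and u: "\<And>n. u n \<in> L1 \<Omega>" and bounded: "\<And>n. F_ROF \<Omega> f \<alpha> (u n) \<le> ennreal C" and C: "C \<ge> 0"
  obtains l and q :: "nat \<Rightarrow> nat" where "l \<in> L1 \<Omega>" "strict_mono q" "(\<lambda>n. L1_dist \<Omega> (u (q n)) l) \<longlonglongrightarrow> 0"
proof -
  have \<Omega>: "open \<Omega>" "bounded \<Omega>" using dom by (auto simp: bounded_lipschitz_domain_def)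
  obtain m where m: "emeasure (lebesgue_on \<Omega>) (space (lebesgue_on \<Omega>)) = ennreal m" "m \<ge> 0"
    using emeasure_lebesgue_on_space[OF \<Omega>] by metis
  have uBV: "u n \<in> BV \<Omega> \<inter> L2 \<Omega>" for n
    by (rule F_ROF_finite_imp[OF le_less_trans[OF bounded]]) simp
  have sumC: "fidelity \<Omega> f (u n) + ennreal \<alpha> * total_variation \<Omega> (u n) \<le> ennreal C" for n
    using bounded by (simp add: F_ROF_eq[OF u f \<alpha>])
  have fid: "fidelity \<Omega> f (u n) \<le> ennreal C" for n
    by (rule order_trans[OF _ sumC[of n]]) simp
  have TV: "total_variation \<Omega> (u n) \<le> ennreal (C / \<alpha>)" for n
  proof -
    have "ennreal \<alpha> * total_variation \<Omega> (u n) \<le> ennreal C" by (rule order_trans[OF _ sumC[of n]]) simp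
    then have "ennreal (1 / \<alpha>) * (ennreal \<alpha> * total_variation \<Omega> (u n)) \<le> ennreal (1 / \<alpha>) * ennreal C"
      by (rule mult_left_mono) simp
    then show ?thesis using \<alpha> C by (simp add: mult.assoc[symmetric] ennreal_mult[symmetric])
  qed
  have "\<exists>w. w \<in> test_functions UNIV \<and> (\<integral>\<^sup>+x. ennreal ((w x - u n x)\<^sup>2) \<partial>lebesgue_on \<Omega>) \<le> ennreal (1 / real (Suc n)) \<and>
      (\<integral>\<^sup>+x. ennreal (norm (gradient w x)) \<partial>lebesgue_on \<Omega>) \<le> total_variation \<Omega> (u n) + ennreal (1 / real (Suc n))" for n
    by (rule density_in_energy[OF dom uBV[of n], of "1 / real (Suc n)"]) (simp, intro exI conjI)
  from choice[OF allI[OF this]] obtain w where "\<forall>n. w n \<in> test_functions UNIV \<and>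
      (\<integral>\<^sup>+x. ennreal ((w n x - u n x)\<^sup>2) \<partial>lebesgue_on \<Omega>) \<le> ennreal (1 / real (Suc n)) \<and>
      (\<integral>\<^sup>+x. ennreal (norm (gradient (w n) x)) \<partial>lebesgue_on \<Omega>) \<le> total_variation \<Omega> (u n) + ennreal (1 / real (Suc n))"
    by (rule exE)
  then have w: "\<And>n. w n \<in> test_functions UNIV"
      "\<And>n. (\<integral>\<^sup>+x. ennreal ((w n x - u n x)\<^sup>2) \<partial>lebesgue_on \<Omega>) \<le> ennreal (1 / real (Suc n))"
      "\<And>n. (\<integral>\<^sup>+x. ennreal (norm (gradient (w n) x)) \<partial>lebesgue_on \<Omega>) \<le> total_variation \<Omega> (u n) + ennreal (1 / real (Suc n))"
    by (simp_all only:)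
  have le1: "1 / real (Suc n) \<le> 1" for n by simp
  have wL1: "w n \<in> L1 \<Omega>" for n by (rule test_functions_L1_L2[OF \<Omega>(1) w(1)])
  have [measurable]: "w n \<in> borel_measurable (lebesgue_on \<Omega>)" "u n \<in> borel_measurable (lebesgue_on \<Omega>)"
      "f \<in> borel_measurable (lebesgue_on \<Omega>)" for n
    using wL1[of n] u[of n] f by (auto simp: L1_def L2_def)
  have "(\<integral>\<^sup>+x. ennreal ((f x)\<^sup>2) \<partial>lebesgue_on \<Omega>) = ennreal (\<integral>x. (f x)\<^sup>2 \<partial>lebesgue_on \<Omega>)"
    using f by (intro nn_integral_eq_integral) (auto simp: L2_def)
  then obtain cf where cf: "(\<integral>\<^sup>+x. ennreal ((f x)\<^sup>2) \<partial>lebesgue_on \<Omega>) = ennreal cf" "cf \<ge> 0" by auto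
  define C2 where "C2 = 3 * (1 + 2 * C + cf)"
  have C2: "(\<integral>\<^sup>+x. ennreal ((w n x)\<^sup>2) \<partial>lebesgue_on \<Omega>) \<le> ennreal C2" "C2 \<ge> 0" for n
  proof -
    have "(\<integral>\<^sup>+x. ennreal ((u n x - f x)\<^sup>2) \<partial>lebesgue_on \<Omega>) = (\<integral>\<^sup>+x. ennreal 2 * ennreal (1/2 * (u n x - f x)\<^sup>2) \<partial>lebesgue_on \<Omega>)"
      by (intro nn_integral_cong) (simp add: ennreal_mult[symmetric] del: ennreal_numeral)
    also have "\<dots> = ennreal 2 * fidelity \<Omega> f (u n)"
      unfolding fidelity_def by (rule nn_integral_cmult) measurable
    also have "\<dots> \<le> ennreal 2 * ennreal C" by (intro mult_left_mono fid) simp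
    finally have uf: "(\<integral>\<^sup>+x. ennreal ((u n x - f x)\<^sup>2) \<partial>lebesgue_on \<Omega>) \<le> ennreal (2 * C)"
      using C by (simp add: ennreal_mult del: ennreal_numeral)
    have "(\<integral>\<^sup>+x. ennreal ((w n x)\<^sup>2) \<partial>lebesgue_on \<Omega>) = (\<integral>\<^sup>+x. ennreal (((w n x - u n x) + (u n x - f x) + f x)\<^sup>2) \<partial>lebesgue_on \<Omega>)" by simp
    also have "\<dots> \<le> 3 * ((\<integral>\<^sup>+x. ennreal ((w n x - u n x)\<^sup>2) \<partial>lebesgue_on \<Omega>) +
        (\<integral>\<^sup>+x. ennreal ((u n x - f x)\<^sup>2) \<partial>lebesgue_on \<Omega>) + (\<integral>\<^sup>+x. ennreal ((f x)\<^sup>2) \<partial>lebesgue_on \<Omega>))"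
      by (rule nn_integral_square_sum3) measurable
    also have "\<dots> \<le> 3 * (ennreal 1 + ennreal (2 * C) + ennreal cf)"
      by (intro mult_left_mono add_mono uf eq_refl[OF cf(1)] order_trans[OF w(2)] ennreal_leI le1) simp
    also have "ennreal 1 + ennreal (2 * C) + ennreal cf = ennreal (1 + 2 * C + cf)"
      using C cf(2) by (simp add: ennreal_plus[symmetric] del: ennreal_plus ennreal_1)
    also have "3 * ennreal (1 + 2 * C + cf) = ennreal C2"
      unfolding C2_def using C cf(2) by (subst ennreal_mult) auto
    finally show "(\<integral>\<^sup>+x. ennreal ((w n x)\<^sup>2) \<partial>lebesgue_on \<Omega>) \<le> ennreal C2" .
    show "C2 \<ge> 0" using C cf(2) by (simp add: C2_def)
  qed
  define C1 where "C1 = 1 / 2 * m + C2 / (2 * 1)"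
  have C1: "(\<integral>\<^sup>+x. ennreal \<bar>w n x\<bar> \<partial>lebesgue_on \<Omega>) \<le> ennreal C1" "C1 \<ge> 0" for n
  proof -
    show "(\<integral>\<^sup>+x. ennreal \<bar>w n x\<bar> \<partial>lebesgue_on \<Omega>) \<le> ennreal C1"
      unfolding C1_def by (rule nn_integral_abs_le_square[OF _ eq_refl[OF m(1)] m(2) C2]) auto
    show "C1 \<ge> 0" using m(2) C2(2) by (simp add: C1_def)
  qed
  have G: "(\<integral>\<^sup>+x. ennreal (norm (gradient (w n) x)) \<partial>lebesgue_on \<Omega>) \<le> ennreal (C / \<alpha> + 1)" "C / \<alpha> + 1 \<ge> 0" for n
  proof -
    show "C / \<alpha> + 1 \<ge> 0" using C \<alpha> by simp
    have "(\<integral>\<^sup>+x. ennreal (norm (gradient (w n) x)) \<partial>lebesgue_on \<Omega>) \<le> ennreal (C / \<alpha>) + ennreal 1"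
      by (intro order_trans[OF w(3)] add_mono TV ennreal_leI le1)
    then show "(\<integral>\<^sup>+x. ennreal (norm (gradient (w n) x)) \<partial>lebesgue_on \<Omega>) \<le> ennreal (C / \<alpha> + 1)"
      using C \<alpha> by simp
  qed
  have uw: "\<exists>N. \<forall>n\<ge>N. L1_dist \<Omega> (u n) (w n) \<le> e" if "e > 0" for e
  proof -
    define \<mu> where "\<mu> = e / (m + 1)"
    have \<mu>: "\<mu> > 0" "\<mu> / 2 * m \<le> e / 2"
      using \<open>e > 0\<close> m(2) by (auto simp: \<mu>_def field_simps)
    have "\<mu> * e > 0" using \<mu>(1) \<open>e > 0\<close> by simp
    then obtain N where N: "1 / real (Suc N) < \<mu> * e" using nat_approx_posE by blast
    show ?thesis
    proof (intro exI[of _ N] allI impI)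
      fix n assume "N \<le> n"
      then have "1 / real (Suc n) \<le> 1 / real (Suc N)" by (intro divide_left_mono) auto
      with N have n: "1 / real (Suc n) \<le> \<mu> * e" by linarith
      have "(\<integral>\<^sup>+x. ennreal \<bar>w n x - u n x\<bar> \<partial>lebesgue_on \<Omega>) \<le> ennreal (\<mu> / 2 * m + (\<mu> * e) / (2 * \<mu>))"
        by (rule nn_integral_abs_le_square[OF _ eq_refl[OF m(1)] m(2) order_trans[OF w(2) ennreal_leI[OF n]]])
          (use \<mu> \<open>e > 0\<close> in auto)
      also have "\<dots> \<le> ennreal e" using \<mu> by (intro ennreal_leI) simp
      finally show "L1_dist \<Omega> (u n) (w n) \<le> e"
        using \<open>e > 0\<close> by (subst L1_dist_commute) (rule L1_distI, auto)
    qed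
  qed
  have osc: "\<exists>r :: nat \<Rightarrow> nat. strict_mono r \<and> (\<exists>N. \<forall>i\<ge>N. \<forall>j\<ge>N. L1_dist \<Omega> (u (s (r i))) (u (s (r j))) < e)"
    if "e > 0" and s: "strict_mono (s :: nat \<Rightarrow> nat)" for e s
  proof -
    \<comment> \<open>The five errors on the way from one term of \<open>u\<close> to another, through the approximations \<open>w\<close> and
      the mollifications, are at most \<open>e / 6\<close> each.\<close>
    have e: "e / 6 > 0" using \<open>e > 0\<close> by simp
    obtain z \<epsilon> \<rho> where z: "mollifier \<epsilon> \<rho>" "\<And>n. z n \<in> test_functions UNIV" "\<And>n. (\<integral>x. \<bar>z n x\<bar> \<partial>lborel) \<le> C1"
        "\<And>n. L1_dist \<Omega> (w n) (convolution \<rho> (z n)) \<le> e / 6"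
      by (rule cutoff_mollification[OF \<Omega> w(1) C1 C2 G e], rule that) assumption+
    have zi: "integrable lborel (z n)" for n by (rule test_functions_integrable[OF z(2)])
    have yL1: "convolution \<rho> (z n) \<in> L1 \<Omega>" for n
    proof -
      obtain K where "compact K" "\<And>x. x \<notin> K \<Longrightarrow> z n x = 0" using test_functionsE[OF z(2)] by metis
      from shifted_convolution_test[OF mollifierD(1)[OF z(1)] zi this, of 0]
      show ?thesis by (intro test_functions_L1_L2[OF \<Omega>(1)]) simp
    qed
    define \<eta> where "\<eta> = e / (6 * (m + 1))"
    have \<eta>: "\<eta> > 0" "\<eta> * m \<le> e / 6"
      using \<open>e > 0\<close> m(2) by (auto simp: \<eta>_def field_simps)
    have cpt: "compact (closure \<Omega>)" using \<Omega>(2) by (simp add: compact_closure)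
    obtain r :: "nat \<Rightarrow> nat" and N where r: "strict_mono r"
      "\<And>i j x. i \<ge> N \<Longrightarrow> j \<ge> N \<Longrightarrow> x \<in> closure \<Omega> \<Longrightarrow>
          \<bar>convolution \<rho> (z (s (r i))) x - convolution \<rho> (z (s (r j))) x\<bar> \<le> \<eta>"
      by (rule mollified_subsequence[where z="\<lambda>n. z (s n)", OF z(1) zi z(3) cpt \<eta>(1)], rule that) assumption+
    obtain M where M: "\<And>n. n \<ge> M \<Longrightarrow> L1_dist \<Omega> (u n) (w n) \<le> e / 6" using uw[OF e] by blast
    have "L1_dist \<Omega> (u (s (r i))) (u (s (r j))) < e" if ij: "i \<ge> max M N" "j \<ge> max M N" for i j
    proof -
      define y where "y n = convolution \<rho> (z (s (r n)))" for n
      have y: "y n \<in> L1 \<Omega>" for n by (simp add: y_def yL1)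
      have ge: "s (r n) \<ge> n" for n
        using seq_suble[OF s, of "r n"] seq_suble[OF r(1), of n] by linarith
      have uy: "L1_dist \<Omega> (u (s (r n))) (y n) \<le> e / 3" if "n \<ge> max M N" for n
      proof -
        have "L1_dist \<Omega> (u (s (r n))) (y n) \<le> L1_dist \<Omega> (u (s (r n))) (w (s (r n))) + L1_dist \<Omega> (w (s (r n))) (y n)"
          by (rule L1_dist_triangle[OF u wL1 y])
        also have "\<dots> \<le> e / 6 + e / 6" using ge[of n] that unfolding y_def by (intro add_mono M z(4)) linarith
        finally show ?thesis by simp
      qed
      have "L1_dist \<Omega> (y i) (y j) \<le> \<eta> * m"
      proof (rule L1_distI)
        have "(\<integral>\<^sup>+x. ennreal \<bar>y i x - y j x\<bar> \<partial>lebesgue_on \<Omega>) \<le> (\<integral>\<^sup>+x. ennreal \<eta> \<partial>lebesgue_on \<Omega>)"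
        proof (rule nn_integral_mono)
          fix x assume "x \<in> space (lebesgue_on \<Omega>)"
          then have "x \<in> closure \<Omega>" using closure_subset[of \<Omega>] by auto
          then show "ennreal \<bar>y i x - y j x\<bar> \<le> ennreal \<eta>" unfolding y_def using ij by (intro ennreal_leI r(2)) auto
        qed
        also have "\<dots> = ennreal (\<eta> * m)" using \<eta>(1) m by (simp add: ennreal_mult)
        finally show "(\<integral>\<^sup>+x. ennreal \<bar>y i x - y j x\<bar> \<partial>lebesgue_on \<Omega>) \<le> ennreal (\<eta> * m)" .
      qed (use \<eta>(1) m(2) in simp)
      then have yy: "L1_dist \<Omega> (y i) (y j) \<le> e / 6" using \<eta>(2) by linarith
      have "L1_dist \<Omega> (u (s (r i))) (u (s (r j))) \<le> L1_dist \<Omega> (u (s (r i))) (y i) + (L1_dist \<Omega> (y i) (y j) + L1_dist \<Omega> (y j) (u (s (r j))))"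
        using L1_dist_triangle[OF u[of "s (r i)"] y[of i] u[of "s (r j)"]]
          L1_dist_triangle[OF y[of i] y[of j] u[of "s (r j)"]] by linarith
      also have "\<dots> \<le> e / 3 + (e / 6 + e / 3)"
        using uy[OF ij(1)] uy[OF ij(2)] yy by (subst L1_dist_commute[of _ "y j"]) linarith
      also have "\<dots> < e" using \<open>e > 0\<close> by simp
      finally show ?thesis .
    qed
    then show ?thesis using r(1) by blast
  qed
  obtain q :: "nat \<Rightarrow> nat" where q: "strict_mono q"
    "\<And>e. e > 0 \<Longrightarrow> \<exists>N. \<forall>i\<ge>N. \<forall>j\<ge>N. L1_dist \<Omega> (u (q i)) (u (q j)) < e"
    by (rule diagonal_Cauchy_subsequence[where D="\<lambda>i j. L1_dist \<Omega> (u i) (u j)", OF osc])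
      (assumption, assumption, rule that, assumption+)
  obtain l where "l \<in> L1 \<Omega>" "(\<lambda>n. L1_dist \<Omega> (u (q n)) l) \<longlonglongrightarrow> 0"
    by (rule L1_complete[where u="\<lambda>n. u (q n)", OF u q(2)]) (assumption, rule that, assumption+)
  then show ?thesis using q(1) by (intro that)
qed

section \<open>Recovery sequences\<close>

lemma log_plus_nonneg: "0 \<le> log_plus r"
  by (simp add: log_plus_def)

lemma log_plus_mono: "r \<le> s \<Longrightarrow> log_plus r \<le> log_plus s"
  by (auto simp: log_plus_def max_def)

text \<open>The gradient is bounded, so the factor \<open>log_plus (t / \<kappa> x)\<close> is bounded as well. The functional
  is defined through an arbitrary choice of the weak gradient; uniqueness identifies that choice with
  the classical gradient.\<close>

lemma gradient_energy_test_function: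
  fixes \<Omega> :: "'a::euclidean_space set"
  assumes \<Omega>: "open \<Omega>" "bounded \<Omega>" and w: "w \<in> test_functions UNIV" and \<alpha>: "\<alpha> > 0"
    and \<kappa>: "0 < \<kappa>m" "AE x in lebesgue_on \<Omega>. \<kappa>m \<le> \<kappa> x"
  obtains D where "D \<ge> 0" "\<And>\<gamma>. \<gamma> > 0 \<Longrightarrow> gradient_energy \<Omega> \<alpha> \<kappa> \<gamma> w \<le>
      ennreal \<alpha> * (\<integral>\<^sup>+x. ennreal (norm (gradient w x)) \<partial>lebesgue_on \<Omega>) + ennreal (\<gamma> * D)"
proof -
  obtain m where m: "emeasure (lebesgue_on \<Omega>) (space (lebesgue_on \<Omega>)) = ennreal m" "m \<ge> 0"
    using emeasure_lebesgue_on_space[OF \<Omega>] by metis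
  obtain B where B: "B \<ge> 0" "\<And>x. norm (gradient w x) \<le> B"
    using test_functions_bounded[OF test_functions_gradient[OF w]] by metis
  define E where "E = \<alpha> * B * log_plus (B / \<kappa>m)"
  have E: "E \<ge> 0" using \<alpha> B(1) by (simp add: E_def log_plus_nonneg)
  have wk: "is_weak_gradient \<Omega> w (gradient w)" by (rule smooth_is_weak_gradient[OF \<Omega>(1) w])
  then have "is_weak_gradient \<Omega> w (weak_gradient \<Omega> w)"
    unfolding weak_gradient_def by (rule someI[of "is_weak_gradient \<Omega> w"])
  from weak_gradient_unique[OF \<Omega> this wk]
  have AE: "AE x in lebesgue_on \<Omega>. weak_gradient \<Omega> w x = gradient w x" .
  have gm[measurable]: "gradient w \<in> borel_measurable (lebesgue_on \<Omega>)"
    by (intro lebesgue_on_measurable smooth_borel smooth_gradient test_functions_smooth[OF w])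
  show ?thesis
  proof (rule that[of "E * m"])
    show "E * m \<ge> 0" using E m(2) by simp
    fix \<gamma> :: real assume \<gamma>: "\<gamma> > 0"
    have "gradient_energy \<Omega> \<alpha> \<kappa> \<gamma> w \<le> (\<integral>\<^sup>+x. ennreal \<alpha> * ennreal (norm (gradient w x)) + ennreal (\<gamma> * E) \<partial>lebesgue_on \<Omega>)"
      unfolding gradient_energy_def
    proof (rule nn_integral_mono_AE)
      show "AE x in lebesgue_on \<Omega>. ennreal (phi \<alpha> \<kappa> \<gamma> x (norm (weak_gradient \<Omega> w x))) \<le>
          ennreal \<alpha> * ennreal (norm (gradient w x)) + ennreal (\<gamma> * E)"
        using AE \<kappa>(2)
      proof eventually_elim
        case (elim x)
        let ?t = "norm (gradient w x)"
        have "?t / \<kappa> x \<le> B / \<kappa>m" using B elim \<kappa>(1) by (intro frac_le) auto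
        then have "\<alpha> * ?t * (\<gamma> * log_plus (?t / \<kappa> x)) \<le> \<alpha> * B * (\<gamma> * log_plus (B / \<kappa>m))"
          using \<alpha> B \<gamma> by (intro mult_mono log_plus_mono) (auto simp: log_plus_nonneg)
        then have "phi \<alpha> \<kappa> \<gamma> x ?t \<le> \<alpha> * ?t + \<gamma> * E"
          by (simp add: phi_def E_def distrib_left mult_ac)
        then have "ennreal (phi \<alpha> \<kappa> \<gamma> x ?t) \<le> ennreal (\<alpha> * ?t + \<gamma> * E)" by (rule ennreal_leI)
        also have "\<dots> = ennreal \<alpha> * ennreal ?t + ennreal (\<gamma> * E)"
          using \<alpha> \<gamma> E by (simp add: ennreal_mult)
        finally show ?case using elim by simp
      qed
    qed
    also have "\<dots> = ennreal \<alpha> * (\<integral>\<^sup>+x. ennreal (norm (gradient w x)) \<partial>lebesgue_on \<Omega>) + ennreal (\<gamma> * (E * m))"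
      using \<gamma> E m by (simp add: nn_integral_add nn_integral_cmult ennreal_mult mult.assoc)
    finally show "gradient_energy \<Omega> \<alpha> \<kappa> \<gamma> w \<le> \<dots>" .
  qed
qed

lemma square_sum_weighted: "s > 0 \<Longrightarrow> (a + b)\<^sup>2 \<le> (1 + s) * a\<^sup>2 + (1 + 1 / s) * (b::real)\<^sup>2"
proof -
  assume s: "s > 0"
  have "2 * (s * a) * b \<le> (s * a)\<^sup>2 + b\<^sup>2" by (rule sum_squares_bound)
  then have "2 * a * b \<le> s * a\<^sup>2 + b\<^sup>2 / s"
    using s by (simp add: field_simps power2_eq_square)
  then show ?thesis by (simp add: power2_sum distrib_right)
qed

text \<open>The weighted inequality \<open>(a + b)\<^sup>2 \<le> (1 + s) a\<^sup>2 + (1 + 1/s) b\<^sup>2\<close> with \<open>a = u - f\<close> and \<open>b = w - u\<close>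
  asks for \<open>\<integral>b\<^sup>2 \<le> s\<^sup>2\<close>: then the fidelity and the variation of \<open>w\<close> exceed those of \<open>u\<close> by a multiple of
  \<open>s\<close> that depends only on \<open>q\<close> and \<open>\<alpha>\<close>.\<close>

lemma recovery_element:
  fixes \<Omega> :: "'a::euclidean_space set"
  assumes dom: "bounded_lipschitz_domain \<Omega>" and f: "f \<in> L2 \<Omega>" and \<alpha>: "\<alpha> > 0"
    and \<kappa>: "0 < \<kappa>m" "AE x in lebesgue_on \<Omega>. \<kappa>m \<le> \<kappa> x"
    and u: "u \<in> BV \<Omega> \<inter> L2 \<Omega>" and m: "emeasure (lebesgue_on \<Omega>) (space (lebesgue_on \<Omega>)) = ennreal m" "m \<ge> 0"
    and q: "fidelity \<Omega> f u = ennreal q" "q \<ge> 0" and s: "0 < s" "s \<le> 1"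
  shows "\<exists>w D. w \<in> L1 \<Omega> \<and> L1_dist \<Omega> w u \<le> s * (m + 1) \<and> D \<ge> 0 \<and>
    (\<forall>\<gamma>>0. F_gamma \<Omega> f \<alpha> \<kappa> \<gamma> w \<le> F_ROF \<Omega> f \<alpha> u + ennreal (s * (q + 1 + \<alpha>) + \<gamma> * D))"
proof -
  have \<Omega>: "open \<Omega>" "bounded \<Omega>" using dom by (auto simp: bounded_lipschitz_domain_def)
  have uL1: "u \<in> L1 \<Omega>" using u by (simp add: BV_def)
  obtain w where w: "w \<in> test_functions UNIV" "(\<integral>\<^sup>+x. ennreal ((w x - u x)\<^sup>2) \<partial>lebesgue_on \<Omega>) \<le> ennreal (s\<^sup>2)"
    "(\<integral>\<^sup>+x. ennreal (norm (gradient w x)) \<partial>lebesgue_on \<Omega>) \<le> total_variation \<Omega> u + ennreal (s\<^sup>2)"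
    using density_in_energy[OF dom u, of "s\<^sup>2"] s(1) by auto
  have wL: "w \<in> L1 \<Omega>" "w \<in> L2 \<Omega>" by (rule test_functions_L1_L2[OF \<Omega>(1) w(1)])+
  have [measurable]: "w \<in> borel_measurable (lebesgue_on \<Omega>)" "u \<in> borel_measurable (lebesgue_on \<Omega>)" "f \<in> borel_measurable (lebesgue_on \<Omega>)"
    using wL uL1 f by (auto simp: L1_def L2_def)
  have s2: "s\<^sup>2 \<le> s" using s by (simp add: power2_eq_square mult_left_le)
  have d: "L1_dist \<Omega> w u \<le> s * (m + 1)"
  proof (rule L1_distI)
    have "(\<integral>\<^sup>+x. ennreal \<bar>w x - u x\<bar> \<partial>lebesgue_on \<Omega>) \<le> ennreal (s / 2 * m + s\<^sup>2 / (2 * s))"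
      by (rule nn_integral_abs_le_square[OF _ eq_refl[OF m(1)] m(2) w(2)]) (use s in auto)
    also have "\<dots> \<le> ennreal (s * (m + 1))"
    proof (rule ennreal_leI)
      have "0 \<le> s * m" using s m(2) by simp
      then show "s / 2 * m + s\<^sup>2 / (2 * s) \<le> s * (m + 1)"
        using s by (simp add: power2_eq_square distrib_left)
    qed
    finally show "(\<integral>\<^sup>+x. ennreal \<bar>w x - u x\<bar> \<partial>lebesgue_on \<Omega>) \<le> ennreal (s * (m + 1))" .
  qed (use s m(2) in simp)
  have fid: "fidelity \<Omega> f w \<le> ennreal q + ennreal (s * (q + 1))"
  proof -
    have "fidelity \<Omega> f w \<le> (\<integral>\<^sup>+x. ennreal (1 + s) * ennreal (1/2 * (u x - f x)\<^sup>2) + ennreal (1/2 * (1 + 1 / s)) * ennreal ((w x - u x)\<^sup>2) \<partial>lebesgue_on \<Omega>)"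
      unfolding fidelity_def
    proof (rule nn_integral_mono)
      fix x
      have half: "(1 + s) * (1/2 * a) + 1/2 * c * b = 1/2 * ((1 + s) * a + c * b)" for a b c :: real
        by (simp add: algebra_simps)
      have "1/2 * (w x - f x)\<^sup>2 \<le> 1/2 * ((1 + s) * (u x - f x)\<^sup>2 + (1 + 1 / s) * (w x - u x)\<^sup>2)"
        using square_sum_weighted[OF s(1), of "u x - f x" "w x - u x"] by (intro mult_left_mono) simp_all
      then have "ennreal (1/2 * (w x - f x)\<^sup>2) \<le> ennreal ((1 + s) * (1/2 * (u x - f x)\<^sup>2) + 1/2 * (1 + 1 / s) * (w x - u x)\<^sup>2)"
        unfolding half by (rule ennreal_leI)
      also have "\<dots> = ennreal (1 + s) * ennreal (1/2 * (u x - f x)\<^sup>2) + ennreal (1/2 * (1 + 1 / s)) * ennreal ((w x - u x)\<^sup>2)"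
        using s by (simp add: ennreal_mult[symmetric] ennreal_plus[symmetric] del: ennreal_plus)
      finally show "ennreal (1/2 * (w x - f x)\<^sup>2) \<le> \<dots>" .
    qed
    also have "\<dots> = ennreal (1 + s) * fidelity \<Omega> f u + ennreal (1/2 * (1 + 1 / s)) * (\<integral>\<^sup>+x. ennreal ((w x - u x)\<^sup>2) \<partial>lebesgue_on \<Omega>)"
      unfolding fidelity_def by (subst nn_integral_add, measurable, simp add: nn_integral_cmult)
    also have "\<dots> \<le> ennreal (1 + s) * ennreal q + ennreal (1/2 * (1 + 1 / s)) * ennreal (s\<^sup>2)"
      using q(1) by (intro add_mono mult_left_mono w(2)) auto
    also have "\<dots> = ennreal ((1 + s) * q + 1/2 * (1 + 1 / s) * s\<^sup>2)"
      using s q(2) by (simp add: ennreal_mult[symmetric] ennreal_plus[symmetric] del: ennreal_plus)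
    also have "\<dots> \<le> ennreal (q + s * (q + 1))"
    proof (rule ennreal_leI)
      have "1/2 * (1 + 1 / s) * s\<^sup>2 = 1/2 * (s\<^sup>2 + s)" using s by (simp add: power2_eq_square field_simps)
      also have "\<dots> \<le> s" using s2 by simp
      finally show "(1 + s) * q + 1/2 * (1 + 1 / s) * s\<^sup>2 \<le> q + s * (q + 1)" by (simp add: algebra_simps)
    qed
    also have "\<dots> = ennreal q + ennreal (s * (q + 1))" using s q(2) by simp
    finally show ?thesis .
  qed
  obtain D where D: "D \<ge> 0" "\<And>\<gamma>. \<gamma> > 0 \<Longrightarrow> gradient_energy \<Omega> \<alpha> \<kappa> \<gamma> w \<le>
      ennreal \<alpha> * (\<integral>\<^sup>+x. ennreal (norm (gradient w x)) \<partial>lebesgue_on \<Omega>) + ennreal (\<gamma> * D)"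
    using gradient_energy_test_function[OF \<Omega> w(1) \<alpha> \<kappa>] by metis
  have "F_gamma \<Omega> f \<alpha> \<kappa> \<gamma> w \<le> F_ROF \<Omega> f \<alpha> u + ennreal (s * (q + 1 + \<alpha>) + \<gamma> * D)" if \<gamma>: "\<gamma> > 0" for \<gamma>
  proof -
    have "gradient_energy \<Omega> \<alpha> \<kappa> \<gamma> w \<le> ennreal \<alpha> * (total_variation \<Omega> u + ennreal s) + ennreal (\<gamma> * D)"
      by (intro order_trans[OF D(2)[OF \<gamma>]] add_right_mono mult_left_mono order_trans[OF w(3)] add_left_mono ennreal_leI s2) simp
    also have "\<dots> = ennreal \<alpha> * total_variation \<Omega> u + ennreal (s * \<alpha> + \<gamma> * D)"
      using \<alpha> s \<gamma> D(1) by (simp add: distrib_left ennreal_mult mult.commute add.assoc)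
    finally have en: "gradient_energy \<Omega> \<alpha> \<kappa> \<gamma> w \<le> ennreal \<alpha> * total_variation \<Omega> u + ennreal (s * \<alpha> + \<gamma> * D)" .
    have "ennreal \<alpha> * total_variation \<Omega> u < \<infinity>" using u by (simp add: BV_def ennreal_mult_less_top)
    then have "ennreal \<alpha> * total_variation \<Omega> u + ennreal (s * \<alpha> + \<gamma> * D) < \<infinity>" by simp
    then have "w \<in> X_space \<Omega> \<alpha> \<kappa> \<gamma>"
      using wL smooth_is_weak_gradient[OF \<Omega>(1) w(1)] le_less_trans[OF en] by (auto simp: X_space_def W11_def)
    then have "F_gamma \<Omega> f \<alpha> \<kappa> \<gamma> w = fidelity \<Omega> f w + gradient_energy \<Omega> \<alpha> \<kappa> \<gamma> w"
      using wL(2) f by (simp add: F_gamma_def fidelity_L2)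
    also have "\<dots> \<le> (ennreal q + ennreal (s * (q + 1))) + (ennreal \<alpha> * total_variation \<Omega> u + ennreal (s * \<alpha> + \<gamma> * D))"
      by (intro add_mono fid en)
    also have "\<dots> = (ennreal q + ennreal \<alpha> * total_variation \<Omega> u) + (ennreal (s * (q + 1)) + ennreal (s * \<alpha> + \<gamma> * D))"
      by (simp only: add.assoc add.left_commute)
    also have "\<dots> = F_ROF \<Omega> f \<alpha> u + ennreal (s * (q + 1 + \<alpha>) + \<gamma> * D)"
    proof -
      have "ennreal (s * (q + 1)) + ennreal (s * \<alpha> + \<gamma> * D) = ennreal (s * (q + 1) + (s * \<alpha> + \<gamma> * D))"
        using s q(2) \<alpha> \<gamma> D(1) by (intro ennreal_plus[symmetric]) auto
      then show ?thesis by (simp add: F_ROF_eq[OF uL1 f \<alpha>] q(1) algebra_simps del: ennreal_plus)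
    qed
    finally show ?thesis .
  qed
  with wL(1) d D(1) show ?thesis by blast
qed

text \<open>\<open>K n\<close> is the largest index up to \<open>n\<close> for which the product is already small.\<close>

lemma diagonal_index:
  fixes D :: "nat \<Rightarrow> real" and \<gamma> :: "nat \<Rightarrow> real"
  assumes \<gamma>: "\<gamma> \<longlonglongrightarrow> 0"
  obtains K :: "nat \<Rightarrow> nat" where "filterlim K at_top sequentially"
    "\<forall>\<^sub>F n in sequentially. \<gamma> n * D (K n) \<le> 1 / real (Suc (K n))"
proof -
  define A where "A n = {k. k \<le> n \<and> \<gamma> n * D k \<le> 1 / real (Suc k)}" for n
  \<comment> \<open>The index 0 is only a default for the finitely many \<open>n\<close> for which \<open>A n\<close> may be empty.\<close>
  define K where "K n = Max (insert 0 (A n))" for n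
  have fin: "finite (A n)" for n unfolding A_def by simp
  have ev: "\<forall>\<^sub>F n in sequentially. k \<in> A n" for k
  proof -
    have "(\<lambda>n. \<gamma> n * D k) \<longlonglongrightarrow> 0" using tendsto_mult_left_zero[OF \<gamma>] .
    then have "\<forall>\<^sub>F n in sequentially. \<gamma> n * D k < 1 / real (Suc k)" by (rule order_tendstoD) simp
    then show ?thesis using eventually_ge_at_top[of k] by eventually_elim (simp add: A_def)
  qed
  show ?thesis
  proof (rule that[of K])
    show "filterlim K at_top sequentially"
      unfolding filterlim_at_top
    proof
      fix k show "\<forall>\<^sub>F n in sequentially. k \<le> K n"
        using ev[of k] by eventually_elim (simp add: K_def fin)
    qed
    show "\<forall>\<^sub>F n in sequentially. \<gamma> n * D (K n) \<le> 1 / real (Suc (K n))"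
      using ev[of 0]
    proof eventually_elim
      case (elim n)
      have "K n \<in> insert 0 (A n)" unfolding K_def by (rule Max_in) (auto simp: fin)
      with elim have "K n \<in> A n" by auto
      then show ?case by (simp add: A_def)
    qed
  qed
qed

lemma recovery_sequence:
  fixes \<Omega> :: "'a::euclidean_space set"
  assumes dom: "bounded_lipschitz_domain \<Omega>" and f: "f \<in> L2 \<Omega>" and \<alpha>: "\<alpha> > 0"
    and \<kappa>: "0 < \<kappa>m" "AE x in lebesgue_on \<Omega>. \<kappa>m \<le> \<kappa> x"
    and u: "u \<in> L1 \<Omega>" and \<gamma>: "\<And>n. 0 < \<gamma> n" "\<gamma> \<longlonglongrightarrow> 0"
  shows "\<exists>v. (\<forall>n. v n \<in> L1 \<Omega>) \<and> (\<lambda>n. L1_dist \<Omega> (v n) u) \<longlonglongrightarrow> 0 \<and>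
    limsup (\<lambda>n. F_gamma \<Omega> f \<alpha> \<kappa> (\<gamma> n) (v n)) \<le> F_ROF \<Omega> f \<alpha> u"
proof (cases "u \<in> BV \<Omega> \<inter> L2 \<Omega>")
  case False
  then have "F_ROF \<Omega> f \<alpha> u = \<infinity>" by (auto simp: F_ROF_def)
  then show ?thesis using u by (intro exI[of _ "\<lambda>_. u"]) (simp add: L1_dist_def)
next
  case True
  have \<Omega>: "open \<Omega>" "bounded \<Omega>" using dom by (auto simp: bounded_lipschitz_domain_def)
  obtain m where m: "emeasure (lebesgue_on \<Omega>) (space (lebesgue_on \<Omega>)) = ennreal m" "m \<ge> 0"
    using emeasure_lebesgue_on_space[OF \<Omega>] by metis
  define q where "q = 1/2 * (L2_norm \<Omega> (\<lambda>x. u x - f x))\<^sup>2"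
  have q: "fidelity \<Omega> f u = ennreal q" "q \<ge> 0" using True f by (auto simp: q_def fidelity_L2)
  define c where "c = q + 1 + \<alpha>"
  define s where "s k = 1 / real (Suc k)" for k
  have s: "0 < s k" "s k \<le> 1" for k by (simp_all add: s_def)
  have "\<forall>k. \<exists>w D. w \<in> L1 \<Omega> \<and> L1_dist \<Omega> w u \<le> s k * (m + 1) \<and> D \<ge> 0 \<and>
    (\<forall>\<gamma>>0. F_gamma \<Omega> f \<alpha> \<kappa> \<gamma> w \<le> F_ROF \<Omega> f \<alpha> u + ennreal (s k * c + \<gamma> * D))"
    unfolding c_def by (intro allI recovery_element[OF dom f \<alpha> \<kappa> True m q s])
  then obtain w D where w: "\<And>k. w k \<in> L1 \<Omega>" "\<And>k. L1_dist \<Omega> (w k) u \<le> s k * (m + 1)" "\<And>k. D k \<ge> 0"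
    "\<And>k \<gamma>. \<gamma> > 0 \<Longrightarrow> F_gamma \<Omega> f \<alpha> \<kappa> \<gamma> (w k) \<le> F_ROF \<Omega> f \<alpha> u + ennreal (s k * c + \<gamma> * D k)"
    by metis
  obtain K where K: "filterlim K at_top sequentially" "\<forall>\<^sub>F n in sequentially. \<gamma> n * D (K n) \<le> 1 / real (Suc (K n))"
    using diagonal_index[OF \<gamma>(2)] by metis
  have "s \<longlonglongrightarrow> 0" unfolding s_def[abs_def] by (rule LIMSEQ_Suc[OF lim_1_over_n])
  then have sK: "(\<lambda>n. s (K n)) \<longlonglongrightarrow> 0" using K(1) by (rule filterlim_compose)
  show ?thesis
  proof (intro exI[of _ "\<lambda>n. w (K n)"] conjI allI)
    show "w (K n) \<in> L1 \<Omega>" for n by (rule w(1))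
    show "(\<lambda>n. L1_dist \<Omega> (w (K n)) u) \<longlonglongrightarrow> 0"
    proof (rule Lim_null_comparison)
      show "\<forall>\<^sub>F n in sequentially. norm (L1_dist \<Omega> (w (K n)) u) \<le> s (K n) * (m + 1)"
        using w(2) L1_dist_nonneg[of \<Omega>] by (intro always_eventually allI) simp
      show "(\<lambda>n. s (K n) * (m + 1)) \<longlonglongrightarrow> 0" using tendsto_mult_left_zero[OF sK] .
    qed
    have "(\<lambda>n. s (K n) * (c + 1)) \<longlonglongrightarrow> 0" using tendsto_mult_left_zero[OF sK] .
    then have "(\<lambda>n. ennreal (s (K n) * (c + 1))) \<longlonglongrightarrow> ennreal 0" by (rule tendsto_ennrealI)
    then have "(\<lambda>n. F_ROF \<Omega> f \<alpha> u + ennreal (s (K n) * (c + 1))) \<longlonglongrightarrow> F_ROF \<Omega> f \<alpha> u + ennreal 0"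
      by (intro tendsto_add tendsto_const)
    from lim_imp_Limsup[OF trivial_limit_sequentially this]
    have lim: "limsup (\<lambda>n. F_ROF \<Omega> f \<alpha> u + ennreal (s (K n) * (c + 1))) = F_ROF \<Omega> f \<alpha> u" by simp
    have "limsup (\<lambda>n. F_gamma \<Omega> f \<alpha> \<kappa> (\<gamma> n) (w (K n))) \<le> limsup (\<lambda>n. F_ROF \<Omega> f \<alpha> u + ennreal (s (K n) * (c + 1)))"
    proof (rule Limsup_mono)
      show "\<forall>\<^sub>F n in sequentially. F_gamma \<Omega> f \<alpha> \<kappa> (\<gamma> n) (w (K n)) \<le> F_ROF \<Omega> f \<alpha> u + ennreal (s (K n) * (c + 1))"
        using K(2)
      proof eventually_elim
        case (elim n)
        have "F_gamma \<Omega> f \<alpha> \<kappa> (\<gamma> n) (w (K n)) \<le> F_ROF \<Omega> f \<alpha> u + ennreal (s (K n) * c + \<gamma> n * D (K n))"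
          by (rule w(4)[OF \<gamma>(1)])
        also have "\<dots> \<le> F_ROF \<Omega> f \<alpha> u + ennreal (s (K n) * (c + 1))"
          using elim by (intro add_left_mono ennreal_leI) (simp add: s_def distrib_left)
        finally show ?case .
      qed
    qed
    then show "limsup (\<lambda>n. F_gamma \<Omega> f \<alpha> \<kappa> (\<gamma> n) (w (K n))) \<le> F_ROF \<Omega> f \<alpha> u" unfolding lim .
  qed
qed

section \<open>Gamma-convergence and equicoercivity\<close>

theorem theorem4p10:
  fixes \<Omega> :: "'a::euclidean_space set" and f \<kappa> :: "'a \<Rightarrow> real" and \<alpha> \<kappa>m \<kappa>p :: real
  assumes "bounded_lipschitz_domain \<Omega>"
    and "f \<in> L2 \<Omega>"
    and "\<alpha> > 0"
    and "\<kappa> \<in> borel_measurable (lebesgue_on \<Omega>)"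
    and "0 < \<kappa>m"
    and "AE x in lebesgue_on \<Omega>. \<kappa>m \<le> \<kappa> x \<and> \<kappa> x \<le> \<kappa>p"
  shows "gamma_converges_at_right_0 (L1 \<Omega>) (L1_dist \<Omega>) (F_gamma \<Omega> f \<alpha> \<kappa>) (F_ROF \<Omega> f \<alpha>) \<and>
    (\<forall>\<gamma> u. (\<forall>n::nat. 0 < \<gamma> n) \<longrightarrow> \<gamma> \<longlonglongrightarrow> 0 \<longrightarrow> (\<forall>n. u n \<in> L1 \<Omega>) \<longrightarrow>
       (SUP n. F_gamma \<Omega> f \<alpha> \<kappa> (\<gamma> n) (u n)) < \<infinity> \<longrightarrow>
         precompact (L1 \<Omega>) (L1_dist \<Omega>) (range u) \<and>
         (\<forall>v. cluster_point (L1 \<Omega>) (L1_dist \<Omega>) u v \<longrightarrow> v \<in> BV \<Omega> \<inter> L2 \<Omega>))"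
proof (intro conjI allI impI)
  note dom = assms(1) and f = assms(2) and \<alpha> = assms(3)
  have \<kappa>: "AE x in lebesgue_on \<Omega>. \<kappa>m \<le> \<kappa> x" using assms(6) by eventually_elim simp
  show "gamma_converges_at_right_0 (L1 \<Omega>) (L1_dist \<Omega>) (F_gamma \<Omega> f \<alpha> \<kappa>) (F_ROF \<Omega> f \<alpha>)"
    unfolding gamma_converges_at_right_0_def gamma_converges_def
  proof (intro allI impI ballI conjI, elim conjE)
    fix g :: "nat \<Rightarrow> real" and u v
    assume g: "\<forall>n. 0 < g n" and u: "u \<in> L1 \<Omega>" and v: "\<forall>n. v n \<in> L1 \<Omega>" "(\<lambda>n. L1_dist \<Omega> (v n) u) \<longlonglongrightarrow> 0"
    have "F_ROF \<Omega> f \<alpha> u \<le> liminf (\<lambda>n. F_ROF \<Omega> f \<alpha> (v n))"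
      by (rule F_ROF_lsc[OF u _ v(2) f \<alpha>]) (use v in blast)
    also have "\<dots> \<le> liminf (\<lambda>n. F_gamma \<Omega> f \<alpha> \<kappa> (g n) (v n))"
      using v(1) g by (intro Liminf_mono always_eventually allI F_ROF_le_F_gamma f \<alpha>) auto
    finally show "F_ROF \<Omega> f \<alpha> u \<le> liminf (\<lambda>n. F_gamma \<Omega> f \<alpha> \<kappa> (g n) (v n))" .
  next
    fix g :: "nat \<Rightarrow> real" and u
    assume "(\<forall>n. 0 < g n) \<and> g \<longlonglongrightarrow> 0" and u: "u \<in> L1 \<Omega>"
    then show "\<exists>v. (\<forall>n. v n \<in> L1 \<Omega>) \<and> (\<lambda>n. L1_dist \<Omega> (v n) u) \<longlonglongrightarrow> 0 \<and>
        limsup (\<lambda>n. F_gamma \<Omega> f \<alpha> \<kappa> (g n) (v n)) \<le> F_ROF \<Omega> f \<alpha> u"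
      by (intro recovery_sequence[OF dom f \<alpha> assms(5) \<kappa> u]) auto
  qed
  fix \<gamma> :: "nat \<Rightarrow> real" and u
  assume \<gamma>: "\<forall>n. 0 < \<gamma> n" "\<gamma> \<longlonglongrightarrow> 0" and u: "\<forall>n. u n \<in> L1 \<Omega>"
    and fin: "(SUP n. F_gamma \<Omega> f \<alpha> \<kappa> (\<gamma> n) (u n)) < \<infinity>"
  define C where "C = enn2real (SUP n. F_gamma \<Omega> f \<alpha> \<kappa> (\<gamma> n) (u n))"
  have C: "(SUP n. F_gamma \<Omega> f \<alpha> \<kappa> (\<gamma> n) (u n)) = ennreal C" "C \<ge> 0" using fin by (auto simp: C_def)
  have bound: "F_ROF \<Omega> f \<alpha> (u n) \<le> ennreal C" for n
  proof -
    have "F_ROF \<Omega> f \<alpha> (u n) \<le> F_gamma \<Omega> f \<alpha> \<kappa> (\<gamma> n) (u n)"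
      using u \<gamma>(1) by (intro F_ROF_le_F_gamma f \<alpha>) auto
    also have "\<dots> \<le> ennreal C" unfolding C(1)[symmetric] by (rule SUP_upper) simp
    finally show ?thesis .
  qed
  show "precompact (L1 \<Omega>) (L1_dist \<Omega>) (range u)"
    unfolding precompact_def
  proof (intro conjI allI impI)
    show "range u \<subseteq> L1 \<Omega>" using u by blast
    fix s :: "nat \<Rightarrow> 'a \<Rightarrow> real" assume "\<forall>n. s n \<in> range u"
    then have "\<forall>n. \<exists>k. s n = u k" by auto
    from choice[OF this] obtain \<sigma> where \<sigma>: "\<And>n. s n = u (\<sigma> n)" by auto
    obtain l and q :: "nat \<Rightarrow> nat" where "l \<in> L1 \<Omega>" "strict_mono q" "(\<lambda>n. L1_dist \<Omega> (u (\<sigma> (q n))) l) \<longlonglongrightarrow> 0"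
      by (rule F_ROF_bounded_compact[where u="\<lambda>n. u (\<sigma> n)", OF dom f \<alpha> u[rule_format] bound C(2)])
    then show "\<exists>l\<in>L1 \<Omega>. \<exists>r. strict_mono r \<and> (\<lambda>n. L1_dist \<Omega> (s (r n)) l) \<longlonglongrightarrow> 0"
      unfolding \<sigma> by blast
  qed
  fix v assume v: "cluster_point (L1 \<Omega>) (L1_dist \<Omega>) u v"
  then have vL1: "v \<in> L1 \<Omega>" by (simp add: cluster_point_def)
  have "\<exists>n. L1_dist \<Omega> (u n) v < 1 / real (Suc k)" for k
  proof -
    have "\<exists>\<^sub>F n in sequentially. L1_dist \<Omega> (u n) v < 1 / real (Suc k)"
      using v unfolding cluster_point_def by (simp del: of_nat_Suc)
    then show ?thesis by (rule frequently_ex)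
  qed
  then obtain \<sigma> where \<sigma>: "\<And>k. L1_dist \<Omega> (u (\<sigma> k)) v < 1 / real (Suc k)" by metis
  have lim: "(\<lambda>k. L1_dist \<Omega> (u (\<sigma> k)) v) \<longlonglongrightarrow> 0"
  proof (rule Lim_null_comparison)
    show "\<forall>\<^sub>F k in sequentially. norm (L1_dist \<Omega> (u (\<sigma> k)) v) \<le> 1 / real (Suc k)"
      using \<sigma> L1_dist_nonneg[of \<Omega>] by (intro always_eventually allI) (simp add: less_imp_le)
    show "(\<lambda>k. 1 / real (Suc k)) \<longlonglongrightarrow> 0" by (rule LIMSEQ_Suc[OF lim_1_over_n])
  qed
  have "F_ROF \<Omega> f \<alpha> v \<le> liminf (\<lambda>k. F_ROF \<Omega> f \<alpha> (u (\<sigma> k)))"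
    by (rule F_ROF_lsc[OF vL1 _ lim f \<alpha>]) (use u in blast)
  also have "\<dots> \<le> limsup (\<lambda>k. F_ROF \<Omega> f \<alpha> (u (\<sigma> k)))" by (rule Liminf_le_Limsup) simp
  also have "\<dots> \<le> ennreal C" by (intro Limsup_bounded always_eventually allI bound)
  finally have "F_ROF \<Omega> f \<alpha> v < \<infinity>" by (rule le_less_trans) simp
  then show "v \<in> BV \<Omega> \<inter> L2 \<Omega>" by (rule F_ROF_finite_imp)
qed

end
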